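(* There is a universal constant $c>0$ such that the following holds. Let $n>12$, $k,q>0$, and let $P\subseteq\mathbb{R}^n$ be a polytope with at most $n^k$ facets and contained in the ball of radius $n^q$ centered at the origin. For a random point $X$ uniformly distributed in $P$, \[\operatorname{var}\|X\|^2\ge \operatorname{vol}(P)^{\frac4n+\frac{3c}{n\log n}}\,e^{-c(k+3q)}\,\frac{n}{\log n}.\]
   Context: $\|\cdot\|$ is the Euclidean norm; $\operatorname{vol}$ is $n$-dimensional Lebesgue measure. *)

theory Defs
  imports "HOL-Probability.Probability" "HOL-Library.Function_Algebras"
begin

text \<open>
  The dimension is quantified inside the theorem, after the universal constant, so it cannot be a
  type. A point of the Euclidean \<open>n\<close>-space is therefore an element of
  \<open>{..<n} \<rightarrow>\<^sub>E UNIV\<close>, the underlying set of the product measure of \<open>n\<close> copies of \<open>lborel\<close>.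
  Pointwise operations turn \<open>nat \<Rightarrow> real\<close> into a real vector space in which this set is an affine
  subspace (all its points agree outside \<open>{..<n}\<close>). Convex combinations and segments of its points
  thus remain in it and are the coordinatewise ones, and differences of its points vanish outside
  \<open>{..<n}\<close>, so that \<open>polytope\<close>, \<open>face_of\<close> and \<open>dim\<close> have their usual meaning.
\<close>

instantiation "fun" :: (type, real_vector) real_vector
begin

definition scaleR_fun :: "real \<Rightarrow> ('a \<Rightarrow> 'b) \<Rightarrow> 'a \<Rightarrow> 'b" where
  "scaleR_fun r f = (\<lambda>x. r *\<^sub>R f x)"

instance
  by standard (simp_all add: scaleR_fun_def plus_fun_def fun_eq_iff scaleR_add_right scaleR_add_left)

end

definition euclid :: "nat \<Rightarrow> (nat \<Rightarrow> real) set" where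
  "euclid n = {..<n} \<rightarrow>\<^sub>E UNIV"

definition euclid_norm :: "nat \<Rightarrow> (nat \<Rightarrow> real) \<Rightarrow> real" where
  "euclid_norm n x = L2_set x {..<n}"

definition euclid_cball :: "nat \<Rightarrow> real \<Rightarrow> (nat \<Rightarrow> real) set" where
  "euclid_cball n r = {x \<in> euclid n. euclid_norm n x \<le> r}"

definition euclid_lborel :: "nat \<Rightarrow> (nat \<Rightarrow> real) measure" where
  "euclid_lborel n = (\<Pi>\<^sub>M i\<in>{..<n}. lborel)"

abbreviation vol :: "nat \<Rightarrow> (nat \<Rightarrow> real) set \<Rightarrow> real" where
  "vol n \<equiv> measure (euclid_lborel n)"

text \<open>
  The library's \<open>aff_dim\<close> and \<open>facet_of\<close> are restricted to the class \<open>euclidean_space\<close>. The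
  dimension of a nonempty set is that of the linear span of its differences; the value at the empty
  set is junk.
\<close>

definition affine_dim :: "'a::real_vector set \<Rightarrow> nat" where
  "affine_dim S = dim {x - y | x y. x \<in> S \<and> y \<in> S}"

definition facets :: "'a::real_vector set \<Rightarrow> 'a set set" where
  "facets P = {F. F face_of P \<and> F \<noteq> {} \<and> affine_dim F + 1 = affine_dim P}"

end

(*
  Let F be an m-dimensional face of P, o any point and p the point of F closest to o. Writing x = p + r (y - p) with y on
  the relative boundary of F cuts F into cones from p over its facets; for x uniform in F, the variable r has density
  m r^(m-1) and is independent of y. Given y, |x - o|^2 = r^2 |y - p|^2 + 2 r <y - p, p - o> + |p - o|^2, where the inner
  product is nonnegative because p is the closest point, so its conditional variance is at least
  var(r^2) |y - p|^4 ~ |y - p|^4 / m^2. Its conditional mean is, up to affine normalisation, |y - o'|^2 for a point o' that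
  does not depend on the facet, so the argument can be repeated on each facet. Every one of n / ln n such steps gains
  |y - p|^4 / n^2. This is of order vol(P)^(4/n), because otherwise the points of P would lie in few small balls: each step
  multiplies the number of balls by at most the number of facets times a polynomial in n and in the diameter.
*)
theory Submission imports Defs begin

section \<open>Lebesgue measure on flats in polar coordinates\<close>

text \<open>A variance cannot be carried through the induction, because conditioning gives each
  facet its own normalised function. The induction instead bounds the integral of (|x - z|^2 - c)^2
  over a face for every centre z and every constant c, so the mean over a facet never has to be
  known and the fluctuation between facets is simply given away. Each passage to a conditional mean
  contracts the later gains by (d / (d + 2))^2; these factors telescope, and as at most n / 2
  dimensions are dropped, every gain keeps a weight of order 1 / n^2. A ball of volume v has radius
  of order sqrt(n) v^(1/n), so the threshold for |y - p|^4 is of order n^2 vol(P)^(4/n) and the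
  powers of n cancel. The loss from the exceptional balls, polynomial in n per step, is exponential
  in n after n / ln n steps; it is beaten by shrinking the radius by a factor governed by the degree
  of that polynomial, because volume takes its n-th power. Measures on faces are needed only up to a
  factor, which permits describing a flat as a graph over some of the coordinates.\<close>

abbreviation lborels :: "nat set \<Rightarrow> (nat \<Rightarrow> real) measure" where
  "lborels I \<equiv> Pi\<^sub>M I (\<lambda>_. lborel)"

interpretation lborels: product_sigma_finite "\<lambda>_::nat. lborel :: real measure"
  by (simp add: product_sigma_finite_def lborel.sigma_finite_measure_axioms)

text \<open>The parameter is unrestricted, so that segments can also be extended beyond their ends.
  Where both points take the same default value, so does the result.\<close>

definition lerp :: "(nat \<Rightarrow> real) \<Rightarrow> (nat \<Rightarrow> real) \<Rightarrow> real \<Rightarrow> nat \<Rightarrow> real" where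
  "lerp p y r = (\<lambda>i. p i + r * (y i - p i))"

text \<open>The identity is required on all of \<open>nat \<Rightarrow> real\<close>, not only on
  \<open>euclid n\<close>: the functional then depends on the coordinates in \<open>I\<close> alone
  and can be composed with parametrisations whose arguments are arbitrary functions.\<close>

definition affine_fun :: "nat set \<Rightarrow> ((nat \<Rightarrow> real) \<Rightarrow> real) \<Rightarrow> bool" where
  "affine_fun I g \<longleftrightarrow> (\<exists>a b. \<forall>x. g x = b + (\<Sum>i\<in>I. a i * x i))"

lemma affine_funI: "(\<And>x. g x = b + (\<Sum>i\<in>I. a i * x i)) \<Longrightarrow> affine_fun I g"
  unfolding affine_fun_def by blast

lemma affine_funE:
  assumes "affine_fun I g"
  obtains a b where "\<And>x. g x = b + (\<Sum>i\<in>I. a i * x i)"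
  using assms unfolding affine_fun_def by blast

lemma affine_fun_const [simp]: "affine_fun I (\<lambda>x. c)"
  by (rule affine_funI[where a = "\<lambda>_. 0" and b = c]) simp

lemma affine_fun_coord: "finite I \<Longrightarrow> i \<in> I \<Longrightarrow> affine_fun I (\<lambda>x. x i)"
  by (rule affine_funI[where a = "\<lambda>j. if j = i then 1 else 0" and b = 0])
     (simp add: if_distrib[of "\<lambda>t. t * _"] cong: if_cong)

lemma affine_fun_add: 
  assumes "affine_fun I g" "affine_fun I h" shows "affine_fun I (\<lambda>x. g x + h x)"
proof -
  obtain a b where 1: "\<And>x. g x = b + (\<Sum>i\<in>I. a i * x i)" by (rule affine_funE[OF assms(1)]) blast
  obtain a' b' where 2: "\<And>x. h x = b' + (\<Sum>i\<in>I. a' i * x i)" by (rule affine_funE[OF assms(2)]) blast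
  show ?thesis
    by (rule affine_funI[where a = "\<lambda>i. a i + a' i" and b = "b + b'"])
       (simp add: 1 2 sum.distrib distrib_right)
qed

lemma affine_fun_cmult: 
  assumes "affine_fun I g" shows "affine_fun I (\<lambda>x. c * g x)"
proof -
  obtain a b where 1: "\<And>x. g x = b + (\<Sum>i\<in>I. a i * x i)" by (rule affine_funE[OF assms(1)]) blast
  show ?thesis
    by (rule affine_funI[where a = "\<lambda>i. c * a i" and b = "c * b"])
       (simp add: 1 distrib_left sum_distrib_left mult.assoc)
qed

lemma affine_fun_diff: "affine_fun I g \<Longrightarrow> affine_fun I h \<Longrightarrow> affine_fun I (\<lambda>x. g x - h x)"
  using affine_fun_add[of I g "\<lambda>x. -1 * h x"] affine_fun_cmult[of I h "-1"] by simp

lemma affine_fun_divide: "affine_fun I g \<Longrightarrow> affine_fun I (\<lambda>x. g x / c)"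
  using affine_fun_cmult[of I g "1 / c"] by simp

lemma affine_fun_sum: 
  "finite S \<Longrightarrow> (\<And>i. i \<in> S \<Longrightarrow> affine_fun I (g i)) \<Longrightarrow> affine_fun I (\<lambda>x. \<Sum>i\<in>S. g i x)"
  by (induction S rule: finite_induct) (auto intro!: affine_fun_add)

lemma affine_fun_compose:
  assumes "affine_fun J g" "finite J" "\<And>i. i \<in> J \<Longrightarrow> affine_fun I (\<lambda>x. L x i)"
  shows "affine_fun I (\<lambda>x. g (L x))"
proof -
  obtain a b where 1: "\<And>x. g x = b + (\<Sum>i\<in>J. a i * x i)" by (rule affine_funE[OF assms(1)]) blast
  show ?thesis unfolding 1
    by (intro affine_fun_add affine_fun_const affine_fun_sum affine_fun_cmult assms)
qed

lemma affine_fun_cong: "affine_fun I g \<Longrightarrow> (\<And>i. i \<in> I \<Longrightarrow> x i = y i) \<Longrightarrow> g x = g y"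
  by (auto simp: affine_fun_def intro!: sum.cong)

lemma affine_fun_lerp: "affine_fun I g \<Longrightarrow> g (lerp p y r) = g p + r * (g y - g p)"
  by (elim affine_funE)
     (simp add: lerp_def sum.distrib sum_distrib_left sum_subtractf algebra_simps)

lemma measurable_affine_fun:
  assumes "affine_fun I g" "I \<subseteq> K"
  shows "g \<in> borel_measurable (lborels K)"
proof -
  obtain a b where 1: "\<And>x. g x = b + (\<Sum>i\<in>I. a i * x i)" by (rule affine_funE[OF assms(1)]) blast
  have [measurable]: "(\<lambda>x. x i) \<in> borel_measurable (lborels K)" if "i \<in> I" for i
    using measurable_component_singleton[of i K "\<lambda>_. lborel"] that assms(2) by auto
  have "(\<lambda>x. b + (\<Sum>i\<in>I. a i * x i)) \<in> borel_measurable (lborels K)"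
    by (intro borel_measurable_add borel_measurable_sum borel_measurable_times) auto
  then show ?thesis using 1 by presburger
qed

text \<open>Each coordinate contributes one factor \<open>r\<close> by the one-dimensional
  substitution, so the homothety of ratio \<open>r\<close> centred at \<open>q\<close> has Jacobian
  \<open>r ^ card I\<close>.\<close>

lemma nn_integral_lborels_scale:
  assumes "finite I" "r > 0" "g \<in> borel_measurable (lborels I)"
  shows "(\<integral>\<^sup>+x. g x \<partial>lborels I) 
       = ennreal (r ^ card I) * (\<integral>\<^sup>+x. g (\<lambda>i\<in>I. q i + r * (x i - q i)) \<partial>lborels I)"
  using assms
proof (induction I arbitrary: g rule: finite_induct)
  case empty
  then show ?case by (simp add: PiM_empty nn_integral_count_space_finite)
next
  case (insert l I)
  note [measurable] = insert.prems(2)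
  define S where "S I' x = (\<lambda>i\<in>I'. q i + r * (x i - q i))" for I' x
  have [measurable]: "S I' \<in> lborels I' \<rightarrow>\<^sub>M lborels I'" for I'
    unfolding S_def by measurable
  have upd: "(\<lambda>x. x(l := t)) \<in> lborels I \<rightarrow>\<^sub>M lborels (insert l I)" for t
    by (rule measurable_fun_upd[where J=I]) auto
  have upd2: "(\<lambda>t. x(l := t)) \<in> lborel \<rightarrow>\<^sub>M lborels (insert l I)" if "x \<in> space (lborels I)" for x
    using that by (intro measurable_fun_upd[where J=I]) auto
  have "(\<integral>\<^sup>+x. g x \<partial>lborels (insert l I)) = (\<integral>\<^sup>+t. (\<integral>\<^sup>+x. g (x(l := t)) \<partial>lborels I) \<partial>lborel)"
    using insert by (intro lborels.product_nn_integral_insert_rev) auto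
  also have "\<dots> = (\<integral>\<^sup>+t. ennreal (r ^ card I) * (\<integral>\<^sup>+x. g ((S I x)(l := t)) \<partial>lborels I) \<partial>lborel)"
    unfolding S_def using insert.prems(1) measurable_compose[OF upd insert.prems(2)]
    by (intro nn_integral_cong insert.IH) auto
  also have "\<dots> = ennreal (r ^ card I) * (\<integral>\<^sup>+t. (\<integral>\<^sup>+x. g ((S I x)(l := t)) \<partial>lborels I) \<partial>lborel)"
  proof (rule nn_integral_cmult)
    have [measurable]: "(\<lambda>p. ((S I (snd p))(l := fst p))) \<in> lborel \<Otimes>\<^sub>M lborels I \<rightarrow>\<^sub>M lborels (insert l I)"
      by (rule measurable_fun_upd[where J=I]) auto
    interpret sigma_finite_measure "lborels I" by (rule lborels.sigma_finite[OF insert.hyps(1)])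
    show "(\<lambda>t. \<integral>\<^sup>+ x. g ((S I x)(l := t)) \<partial>lborels I) \<in> borel_measurable lborel"
      by measurable
  qed
  \<comment> \<open>The order of integration is exchanged to put the new coordinate innermost, where
    the substitution is one-dimensional.\<close>
  also have "(\<integral>\<^sup>+t. (\<integral>\<^sup>+x. g ((S I x)(l := t)) \<partial>lborels I) \<partial>lborel)
     = (\<integral>\<^sup>+x. (\<integral>\<^sup>+t. g ((S I x)(l := t)) \<partial>lborel) \<partial>lborels I)"
  proof -
    have [measurable]: "(\<lambda>p. ((S I (fst p))(l := snd p))) \<in> lborels I \<Otimes>\<^sub>M lborel \<rightarrow>\<^sub>M lborels (insert l I)"
      by (rule measurable_fun_upd[where J=I]) auto
    interpret sigma_finite_measure "lborels I" by (rule lborels.sigma_finite[OF insert.hyps(1)])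
    interpret pair_sigma_finite "lborels I" lborel ..
    show ?thesis by (rule Fubini') measurable
  qed
  also have "\<dots> = (\<integral>\<^sup>+x. ennreal r * (\<integral>\<^sup>+t. g ((S (insert l I) (x(l:=t)))) \<partial>lborel) \<partial>lborels I)"
  proof (rule nn_integral_cong)
    fix x assume x: "x \<in> space (lborels I)"
    have Sx: "S I x \<in> space (lborels I)" using x by (auto simp: S_def space_PiM)
    have m: "(\<lambda>t. g ((S I x)(l := t))) \<in> borel_measurable borel"
      using measurable_compose[OF upd2[OF Sx] insert.prems(2)] by (simp only: measurable_lborel2)
    have eq: "(S I x)(l := (q l - r * q l) + r * t) = S (insert l I) (x(l:=t))" for t
      using insert.hyps by (auto simp: S_def fun_eq_iff algebra_simps)
    show "(\<integral>\<^sup>+t. g ((S I x)(l := t)) \<partial>lborel) = ennreal r * (\<integral>\<^sup>+t. g ((S (insert l I) (x(l:=t)))) \<partial>lborel)"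
      using nn_integral_real_affine[OF m, of r "q l - r * q l"] insert.prems(1) by (simp add: eq)
  qed
  also have "\<dots> = ennreal r * (\<integral>\<^sup>+x. (\<integral>\<^sup>+t. g ((S (insert l I) (x(l:=t)))) \<partial>lborel) \<partial>lborels I)"
  proof (rule nn_integral_cmult)
    have [measurable]: "(\<lambda>p. ((fst p)(l := snd p))) \<in> lborels I \<Otimes>\<^sub>M lborel \<rightarrow>\<^sub>M lborels (insert l I)"
      by (rule measurable_fun_upd[where J=I]) auto
    show "(\<lambda>x. \<integral>\<^sup>+ t. g (S (insert l I) (x(l:=t))) \<partial>lborel) \<in> borel_measurable (lborels I)"
      by measurable
  qed
  also have "(\<integral>\<^sup>+x. (\<integral>\<^sup>+t. g ((S (insert l I) (x(l:=t)))) \<partial>lborel) \<partial>lborels I)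
      = (\<integral>\<^sup>+x. g (S (insert l I) x) \<partial>lborels (insert l I))"
    using insert by (intro lborels.product_nn_integral_insert[symmetric]) auto
  finally show ?case
    using insert.hyps insert.prems(1) unfolding S_def
    by (simp add: ennreal_mult' mult.commute flip: mult.assoc del: restrict_apply)
qed

definition flat_measure :: "nat \<Rightarrow> nat \<Rightarrow> (nat \<Rightarrow> real) set \<Rightarrow> (nat \<Rightarrow> real) measure \<Rightarrow> bool" where
  "flat_measure n m E \<mu> \<longleftrightarrow> (\<exists>I L \<kappa>. I \<subseteq> {..<n} \<and> card I = m \<and> 0 < \<kappa> \<and>
     (\<forall>k. affine_fun I (\<lambda>x. L x k)) \<and> (\<forall>x. L x \<in> euclid n) \<and> (\<forall>x. \<forall>i\<in>I. L x i = x i) \<and>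
     E = range L \<and> \<mu> = scale_measure (ennreal \<kappa>) (distr (lborels I) (euclid_lborel n) L))"

lemma space_euclid_lborel [simp]: "space (euclid_lborel n) = euclid n"
  by (simp add: euclid_lborel_def euclid_def space_PiM)

lemma measurable_affine_map:
  assumes "\<And>k. affine_fun I (\<lambda>x. L x k)" "\<And>x. L x \<in> euclid n"
  shows "L \<in> lborels I \<rightarrow>\<^sub>M euclid_lborel n"
  unfolding euclid_lborel_def
proof (rule measurable_PiM_single')
  show "L \<in> space (lborels I) \<rightarrow> {..<n} \<rightarrow>\<^sub>E space lborel"
    using assms(2) by (auto simp: euclid_def)
qed (use measurable_affine_fun[OF assms(1) order_refl] in auto)

lemma nn_integral_flat:
  assumes "\<mu> = scale_measure (ennreal \<kappa>) (distr (lborels I) (euclid_lborel n) L)"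
    "\<And>k. affine_fun I (\<lambda>x. L x k)" "\<And>x. L x \<in> euclid n"
    "f \<in> borel_measurable (euclid_lborel n)"
  shows "(\<integral>\<^sup>+x. f x \<partial>\<mu>) = ennreal \<kappa> * (\<integral>\<^sup>+x. f (L x) \<partial>lborels I)"
  unfolding assms(1) using assms(4) measurable_affine_map[OF assms(2,3)]
  by (simp add: nn_integral_scale_measure nn_integral_distr)

text \<open>Integration along the levels of \<open>\<psi>\<close>: the homothety of ratio
  \<open>r\<close> centred at \<open>p\<close> carries level \<open>1\<close> of \<open>E\<close>
  onto level \<open>r\<close> with Jacobian \<open>r ^ m\<close>. This is the source of the density
  of the radial variable on a cone.\<close>

lemma flat_measure_polar:
  assumes "flat_measure n (Suc m) E \<mu>" and p: "p \<in> E"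
    and \<psi>: "affine_fun {..<n} \<psi>" "\<psi> p = 0" and x1: "x1 \<in> E" "\<psi> x1 \<noteq> 0"
  shows "\<exists>\<mu>'. flat_measure n m {x \<in> E. \<psi> x = 1} \<mu>' \<and>
     (\<forall>f \<in> borel_measurable (euclid_lborel n). 
       (\<integral>\<^sup>+x. f x * indicator {x. 0 < \<psi> x \<and> \<psi> x \<le> 1} x \<partial>\<mu>)
      = (\<integral>\<^sup>+y. (\<integral>\<^sup>+r. f (lerp p y r) * ennreal (r ^ m) * indicator {0<..1} r \<partial>lborel) \<partial>\<mu>'))"
proof -
  obtain I L \<kappa> where I: "I \<subseteq> {..<n}" "card I = Suc m" and \<kappa>: "0 < \<kappa>" 
    and aL: "\<And>k. affine_fun I (\<lambda>x. L x k)" and eL: "\<And>x. L x \<in> euclid n" 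
    and LI: "\<And>x i. i \<in> I \<Longrightarrow> L x i = x i"
    and E: "E = range L" and \<mu>: "\<mu> = scale_measure (ennreal \<kappa>) (distr (lborels I) (euclid_lborel n) L)"
    using assms(1) unfolding flat_measure_def by blast
  have finI: "finite I" using I finite_subset by blast
  have Lcong: "L x = L y" if "\<And>i. i \<in> I \<Longrightarrow> x i = y i" for x y
    using affine_fun_cong[OF aL] that by blast
  have LE: "L x = x" if "x \<in> E" for x
    using that LI Lcong unfolding E by (metis (full_types) rangeE)
  have Llerp: "L (lerp u v r) = lerp (L u) (L v) r" for u v r
    using affine_fun_lerp[OF aL] by (auto simp: lerp_def)
  have a\<psi>: "affine_fun I (\<lambda>x. \<psi> (L x))"
    by (rule affine_fun_compose[OF \<psi>(1)]) (use aL in auto)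
  then obtain a b where ab: "\<And>x. \<psi> (L x) = b + (\<Sum>i\<in>I. a i * x i)" by (rule affine_funE) blast
  have "\<exists>l\<in>I. a l \<noteq> 0"
  proof (rule ccontr)
    assume "\<not> ?thesis"
    then have "\<psi> (L x1) = \<psi> (L p)" unfolding ab by simp
    then show False using \<psi>(2) x1 LE p by simp
  qed
  \<comment> \<open>\<open>\<psi>\<close> separates \<open>p\<close> from \<open>x1\<close>, so it
    can be solved for some coordinate \<open>l\<close>; the other \<open>m\<close> coordinates
    parametrise each level.\<close>
  then obtain l where l: "l \<in> I" "a l \<noteq> 0" by blast
  define I' where "I' = I - {l}"
  have I': "finite I'" "l \<notin> I'" "insert l I' = I" "card I' = m" "I' \<subseteq> I" "I' \<subseteq> {..<n}"
    using finI I l by (auto simp: I'_def)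
  define w where "w y = b + (\<Sum>i\<in>I'. a i * y i)" for y :: "nat \<Rightarrow> real"
  have aw: "affine_fun I' w" by (rule affine_funI[where a = a and b = b]) (simp add: w_def)
  have ab': "\<psi> (L x) = w x + a l * x l" for x
    unfolding ab w_def using I'(1,2) by (subst I'(3)[symmetric]) simp
  have wupd: "w (x(l := t)) = w x" for x t
    by (rule affine_fun_cong[OF aw]) (use I' in auto)
  \<comment> \<open>The point of \<open>E\<close> on level \<open>r\<close> of \<open>\<psi>\<close>
    whose coordinates in \<open>I'\<close> are those of \<open>y\<close>.\<close>
  define X where "X y r = L (y(l := (r - w y) / a l))" for y r
  have \<psi>X: "\<psi> (X y r) = r" for y r
    unfolding X_def ab' wupd using l by simp
  have XE: "X y r \<in> E" for y r unfolding X_def E by blast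
  have XI': "X y r i = y i" if "i \<in> I'" for y r i
    unfolding X_def using that I' LI[of i] by auto
  have X_unique: "x = X y (\<psi> x)" if x: "x \<in> E" and y: "\<And>i. i \<in> I' \<Longrightarrow> x i = y i" for x y
  proof -
    have "\<psi> x = w x + a l * x l" using ab'[of x] LE[OF x] by simp
    moreover have "w x = w y" by (rule affine_fun_cong[OF aw]) (rule y)
    ultimately have "x l = (\<psi> x - w y) / a l" using l by (simp add: field_simps)
    then have "L x = X y (\<psi> x)" unfolding X_def using y I'(3) by (intro Lcong) auto
    then show ?thesis using LE[OF x] by simp
  qed
  define L' where "L' y = X y 1" for y
  have aX: "affine_fun I' (\<lambda>y. X y r k)" for r k
    unfolding X_def
  proof (rule affine_fun_compose[OF aL finI])
    fix i assume i: "i \<in> I"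
    show "affine_fun I' (\<lambda>x. (x(l := (r - w x) / a l)) i)"
    proof (cases "i = l")
      case True
      then show ?thesis using aw by (auto intro!: affine_fun_divide affine_fun_diff)
    next
      case False
      then show ?thesis using i I' by (auto intro!: affine_fun_coord)
    qed
  qed
  have aL': "affine_fun I' (\<lambda>y. L' y k)" for k unfolding L'_def by (rule aX)
  have eL': "L' y \<in> euclid n" for y unfolding L'_def X_def by (rule eL)
  \<comment> \<open>At fixed \<open>y\<close> the coordinate \<open>l\<close> is affine in
    \<open>r\<close> with slope \<open>1 / a l\<close>; the Jacobian is absorbed into the new
    constant.\<close>
  define \<kappa>' where "\<kappa>' = \<kappa> / \<bar>a l\<bar>"
  have \<kappa>': "\<kappa>' > 0" using \<kappa> l by (simp add: \<kappa>'_def)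
  define \<mu>' where "\<mu>' = scale_measure (ennreal \<kappa>') (distr (lborels I') (euclid_lborel n) L')"
  have "{x \<in> E. \<psi> x = 1} = range L'"
  proof (intro equalityI subsetI)
    fix x assume "x \<in> {x \<in> E. \<psi> x = 1}"
    then have "x = L' x" using X_unique[of x x] by (simp add: L'_def)
    then show "x \<in> range L'" by blast
  qed (auto simp: L'_def \<psi>X XE)
  then have "flat_measure n m {x \<in> E. \<psi> x = 1} \<mu>'"
    unfolding flat_measure_def
    by (intro exI[of _ I'] exI[of _ L'] exI[of _ \<kappa>'] conjI allI ballI I' \<kappa>' aL' eL' \<mu>'_def)
       (auto simp: L'_def XI')
  moreover have "(\<integral>\<^sup>+x. f x * indicator {x. 0 < \<psi> x \<and> \<psi> x \<le> 1} x \<partial>\<mu>)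
      = (\<integral>\<^sup>+y. (\<integral>\<^sup>+r. f (lerp p y r) * ennreal (r ^ m) * indicator {0<..1} r \<partial>lborel) \<partial>\<mu>')"
    if f[measurable]: "f \<in> borel_measurable (euclid_lborel n)" for f
  proof -
    have [measurable]: "\<psi> \<in> borel_measurable (euclid_lborel n)"
      unfolding euclid_lborel_def by (rule measurable_affine_fun[OF \<psi>(1)]) auto
    have mL[measurable]: "L \<in> lborels I \<rightarrow>\<^sub>M euclid_lborel n"
      by (rule measurable_affine_map[OF aL eL])
    have [measurable]: "w \<in> borel_measurable (lborels I')"
      by (rule measurable_affine_fun[OF aw]) auto
    have upd[measurable]: "(\<lambda>(y, t). y(l := t)) \<in> lborels I' \<Otimes>\<^sub>M lborel \<rightarrow>\<^sub>M lborels I"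
      using measurable_add_dim[of l I' "\<lambda>_. lborel"] I'(3) by simp
    have upd2: "(\<lambda>t. x(l := t)) \<in> lborel \<rightarrow>\<^sub>M lborels I" if "x \<in> space (lborels I')" for x
      using measurable_compose[OF measurable_Pair1'[OF that] upd] by simp
    have mX: "(\<lambda>(y, r). X y r) \<in> lborels I' \<Otimes>\<^sub>M lborel \<rightarrow>\<^sub>M euclid_lborel n"
      unfolding X_def
    proof -
      have "(\<lambda>z. (fst z, (snd z - w (fst z)) / a l)) \<in> lborels I' \<Otimes>\<^sub>M lborel \<rightarrow>\<^sub>M lborels I' \<Otimes>\<^sub>M lborel"
        by measurable
      from measurable_compose[OF this measurable_compose[OF upd mL]]
      show "(\<lambda>(y, r). L (y(l := (r - w y) / a l))) \<in> lborels I' \<Otimes>\<^sub>M lborel \<rightarrow>\<^sub>M euclid_lborel n"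
        by (simp add: case_prod_unfold)
    qed
    have mX1[measurable]: "(\<lambda>z. X (fst z) (snd z)) \<in> lborels I' \<Otimes>\<^sub>M lborel \<rightarrow>\<^sub>M euclid_lborel n"
      using mX by (simp add: case_prod_unfold)
    have mXr: "(\<lambda>y. X y r) \<in> lborels I' \<rightarrow>\<^sub>M euclid_lborel n" for r
      by (rule measurable_affine_map[OF aX]) (simp add: X_def eL)
    have mL': "L' \<in> lborels I' \<rightarrow>\<^sub>M euclid_lborel n" unfolding L'_def by (rule mXr)
    interpret sigma_finite_measure "lborels I'" by (rule lborels.sigma_finite[OF I'(1)])
    interpret P: pair_sigma_finite "lborels I'" lborel ..
    define F where "F x = f x * indicator {x. 0 < \<psi> x \<and> \<psi> x \<le> 1} x" for x
    have [measurable]: "F \<in> borel_measurable (euclid_lborel n)"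
      unfolding F_def by measurable
    have "(\<integral>\<^sup>+x. F x \<partial>\<mu>) = ennreal \<kappa> * (\<integral>\<^sup>+x. F (L x) \<partial>lborels I)"
      by (rule nn_integral_flat[OF \<mu> aL eL]) measurable
    also have "(\<integral>\<^sup>+x. F (L x) \<partial>lborels I) = (\<integral>\<^sup>+y. (\<integral>\<^sup>+t. F (L (y(l := t))) \<partial>lborel) \<partial>lborels I')"
      using lborels.product_nn_integral_insert[OF I'(1,2), of "\<lambda>x. F (L x)"] I'(3) by simp
    also have "\<dots> = (\<integral>\<^sup>+y. ennreal (1 / \<bar>a l\<bar>) * (\<integral>\<^sup>+r. F (X y r) \<partial>lborel) \<partial>lborels I')"
    proof (rule nn_integral_cong)
      fix y assume y: "y \<in> space (lborels I')"
      have m: "(\<lambda>t. F (L (y(l := t)))) \<in> borel_measurable borel"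
        using measurable_compose[OF upd2[OF y], of "\<lambda>x. F (L x)" borel] by simp
      have "X y r = L (y(l := - w y / a l + (1 / a l) * r))" for r
        unfolding X_def by (simp add: diff_divide_distrib)
      then show "(\<integral>\<^sup>+t. F (L (y(l := t))) \<partial>lborel) = ennreal (1 / \<bar>a l\<bar>) * (\<integral>\<^sup>+r. F (X y r) \<partial>lborel)"
        using nn_integral_real_affine[OF m, of "1 / a l" "- w y / a l"] l by simp
    qed
    also have "\<dots> = ennreal (1 / \<bar>a l\<bar>) * (\<integral>\<^sup>+y. (\<integral>\<^sup>+r. F (X y r) \<partial>lborel) \<partial>lborels I')"
      by (rule nn_integral_cmult) measurable
    also have "(\<integral>\<^sup>+y. (\<integral>\<^sup>+r. F (X y r) \<partial>lborel) \<partial>lborels I') = (\<integral>\<^sup>+r. (\<integral>\<^sup>+y. F (X y r) \<partial>lborels I') \<partial>lborel)"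
      by (rule P.Fubini'[symmetric]) measurable
    also have "\<dots> = (\<integral>\<^sup>+r. (\<integral>\<^sup>+y. f (lerp p (L' y) r) * ennreal (r ^ m) * indicator {0<..1} r \<partial>lborels I') \<partial>lborel)"
    proof (rule nn_integral_cong)
      fix r :: real
      show "(\<integral>\<^sup>+y. F (X y r) \<partial>lborels I') = (\<integral>\<^sup>+y. f (lerp p (L' y) r) * ennreal (r ^ m) * indicator {0<..1} r \<partial>lborels I')"
      proof (cases "r \<in> {0<..1}")
        case False
        then show ?thesis by (simp add: F_def \<psi>X)
      next
        case True
        then have r: "r > 0" "r \<le> 1" by auto
        have m: "(\<lambda>y. F (X y r)) \<in> borel_measurable (lborels I')"
          by (rule measurable_compose[OF mXr]) measurable
        \<comment> \<open>In the parameters the homothety is again a homothety: scaling the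
          coordinates in \<open>I'\<close> about those of \<open>p\<close> moves a point of level
          \<open>1\<close> to level \<open>r\<close> along its ray from \<open>p\<close>.\<close>
        have "X (\<lambda>i\<in>I'. p i + r * (y i - p i)) r = lerp p (L' y) r" for y
        proof -
          have 1: "lerp p (L' y) r \<in> E"
            using Llerp[of p "L' y" r] LE[OF p] LE[OF XE[of y 1]] unfolding E L'_def by (metis rangeI)
          have 2: "\<psi> (lerp p (L' y) r) = r"
            using affine_fun_lerp[OF \<psi>(1), of p "L' y" r] \<psi>(2) by (simp add: L'_def \<psi>X)
          have "lerp p (L' y) r = X (\<lambda>i\<in>I'. p i + r * (y i - p i)) (\<psi> (lerp p (L' y) r))"
            by (rule X_unique[OF 1]) (simp add: lerp_def L'_def XI')
          then show ?thesis by (simp add: 2)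
        qed
        then have "(\<integral>\<^sup>+y. F (X y r) \<partial>lborels I') = ennreal (r ^ m) * (\<integral>\<^sup>+y. F (lerp p (L' y) r) \<partial>lborels I')"
          using nn_integral_lborels_scale[OF I'(1) r(1) m, of p] I'(4) by simp
        also have "\<dots> = ennreal (r ^ m) * (\<integral>\<^sup>+y. f (lerp p (L' y) r) \<partial>lborels I')"
        proof -
          have "\<psi> (lerp p (L' y) r) = r" for y
            using affine_fun_lerp[OF \<psi>(1), of p "L' y" r] \<psi>(2) by (simp add: L'_def \<psi>X)
          then show ?thesis using r by (simp add: F_def)
        qed
        also have "\<dots> = (\<integral>\<^sup>+y. ennreal (r ^ m) * f (lerp p (L' y) r) \<partial>lborels I')"
        proof (rule nn_integral_cmult[symmetric])
          have "(\<lambda>y. lerp p (L' y) r) \<in> lborels I' \<rightarrow>\<^sub>M euclid_lborel n"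
          proof (rule measurable_affine_map)
            show "affine_fun I' (\<lambda>x. lerp p (L' x) r k)" for k unfolding lerp_def
              by (intro affine_fun_add affine_fun_cmult affine_fun_diff affine_fun_const aL')
            show "lerp p (L' x) r \<in> euclid n" for x
              using eL'[of x] p eL unfolding E lerp_def euclid_def by (force simp: PiE_def extensional_def)
          qed
          then show "(\<lambda>y. f (lerp p (L' y) r)) \<in> borel_measurable (lborels I')" by measurable
        qed
        finally show ?thesis using r by (simp add: mult.commute)
      qed
    qed
    also have "\<dots> = (\<integral>\<^sup>+y. (\<integral>\<^sup>+r. f (lerp p (L' y) r) * ennreal (r ^ m) * indicator {0<..1} r \<partial>lborel) \<partial>lborels I')"
    proof (rule P.Fubini')
      have "(\<lambda>z. lerp p (L' (fst z)) (snd z)) \<in> lborels I' \<Otimes>\<^sub>M lborel \<rightarrow>\<^sub>M euclid_lborel n"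
        unfolding euclid_lborel_def
      proof (rule measurable_PiM_single')
        show "(\<lambda>z. lerp p (L' (fst z)) (snd z)) \<in> space (lborels I' \<Otimes>\<^sub>M lborel) \<rightarrow> {..<n} \<rightarrow>\<^sub>E space lborel"
          using eL' p eL unfolding E lerp_def euclid_def by (force simp: PiE_def extensional_def)
        fix i assume "i \<in> {..<n}"
        have [measurable]: "(\<lambda>y. L' y i) \<in> borel_measurable (lborels I')"
          by (rule measurable_affine_fun[OF aL']) auto
        show "(\<lambda>z. lerp p (L' (fst z)) (snd z) i) \<in> lborels I' \<Otimes>\<^sub>M lborel \<rightarrow>\<^sub>M lborel"
          unfolding lerp_def by measurable
      qed
      then show "(\<lambda>(x, y). f (lerp p (L' x) y) * ennreal (y ^ m) * indicator {0<..1} y) \<in> borel_measurable (lborels I' \<Otimes>\<^sub>M lborel)"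
        unfolding case_prod_unfold by measurable
    qed
    also have "ennreal \<kappa> * (ennreal (1 / \<bar>a l\<bar>) * \<dots>) = ennreal \<kappa>' * \<dots>"
      unfolding \<kappa>'_def using \<kappa> by (simp flip: mult.assoc ennreal_mult')
    also have "\<dots> = (\<integral>\<^sup>+y. (\<integral>\<^sup>+r. f (lerp p y r) * ennreal (r ^ m) * indicator {0<..1} r \<partial>lborel) \<partial>\<mu>')"
    proof (rule nn_integral_flat[OF \<mu>'_def aL' eL', symmetric])
      have pe: "p \<in> euclid n" using p eL unfolding E by blast
      have "(\<lambda>z. lerp p (fst z) (snd z)) \<in> euclid_lborel n \<Otimes>\<^sub>M lborel \<rightarrow>\<^sub>M euclid_lborel n"
        unfolding euclid_lborel_def
      proof (rule measurable_PiM_single')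
        show "(\<lambda>z. lerp p (fst z) (snd z)) \<in> space (lborels {..<n} \<Otimes>\<^sub>M lborel) \<rightarrow> {..<n} \<rightarrow>\<^sub>E space lborel"
          using pe unfolding lerp_def euclid_def by (force simp: PiE_def extensional_def space_pair_measure space_PiM)
        fix i assume i: "i \<in> {..<n}"
        then show "(\<lambda>z. lerp p (fst z) (snd z) i) \<in> lborels {..<n} \<Otimes>\<^sub>M lborel \<rightarrow>\<^sub>M lborel"
          unfolding lerp_def by measurable
      qed
      then show "(\<lambda>y. \<integral>\<^sup>+ r. f (lerp p y r) * ennreal (r ^ m) * indicator {0<..1} r \<partial>lborel)
          \<in> borel_measurable (euclid_lborel n)"
        by measurable
    qed
    finally show ?thesis unfolding F_def .
  qed
  ultimately show ?thesis by blast
qed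

text \<open>Along a coordinate on which \<open>\<psi>\<close> depends, every line meets the zero set
  in one point, so Fubini gives measure zero. If \<open>\<psi>\<close> is constant on
  \<open>E\<close>, the witness \<open>x1\<close> makes the constant nonzero.\<close>

lemma flat_measure_hyperplane:
  assumes "flat_measure n m E \<mu>" and \<psi>: "affine_fun {..<n} \<psi>" and x1: "x1 \<in> E" "\<psi> x1 \<noteq> 0"
  shows "emeasure \<mu> {x \<in> euclid n. \<psi> x = 0} = 0"
proof -
  obtain I L \<kappa> where I: "I \<subseteq> {..<n}" and \<kappa>: "0 < \<kappa>" 
    and aL: "\<And>k. affine_fun I (\<lambda>x. L x k)" and eL: "\<And>x. L x \<in> euclid n" 
    and E: "E = range L" and \<mu>: "\<mu> = scale_measure (ennreal \<kappa>) (distr (lborels I) (euclid_lborel n) L)"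
    using assms(1) unfolding flat_measure_def by blast
  have finI: "finite I" using I finite_subset by blast
  have a\<psi>: "affine_fun I (\<lambda>x. \<psi> (L x))"
    by (rule affine_fun_compose[OF \<psi>(1)]) (use aL in auto)
  then obtain a b where ab: "\<And>x. \<psi> (L x) = b + (\<Sum>i\<in>I. a i * x i)" by (rule affine_funE) blast
  have [measurable]: "\<psi> \<in> borel_measurable (euclid_lborel n)"
    unfolding euclid_lborel_def by (rule measurable_affine_fun[OF \<psi>(1)]) auto
  have mL[measurable]: "L \<in> lborels I \<rightarrow>\<^sub>M euclid_lborel n"
    by (rule measurable_affine_map[OF aL eL])
  have meas: "{x \<in> euclid n. \<psi> x = 0} \<in> sets (euclid_lborel n)"
    using measurable_sets[of \<psi> "euclid_lborel n" borel "{0}"] by (simp add: vimage_def Int_def conj_commute)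
  have "emeasure \<mu> {x \<in> euclid n. \<psi> x = 0} = (\<integral>\<^sup>+x. indicator {x \<in> euclid n. \<psi> x = 0} x \<partial>\<mu>)"
    by (rule nn_integral_indicator[symmetric]) (use meas in \<open>simp add: \<mu>\<close>)
  also have "\<dots> = ennreal \<kappa> * (\<integral>\<^sup>+x. indicator {x \<in> euclid n. \<psi> x = 0} (L x) \<partial>lborels I)"
    by (rule nn_integral_flat[OF \<mu> aL eL]) (use meas in measurable)
  also have "(\<integral>\<^sup>+x. indicator {x \<in> euclid n. \<psi> x = 0} (L x) \<partial>lborels I) = (\<integral>\<^sup>+x. indicator {x. \<psi> (L x) = 0} x \<partial>lborels I)"
    by (intro nn_integral_cong) (auto simp: indicator_def eL)
  also have "\<dots> = 0"
  proof (cases "\<exists>l\<in>I. a l \<noteq> 0")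
    case False
    then have c: "\<psi> (L x) = b" for x unfolding ab by simp
    then have "b \<noteq> 0" using x1 unfolding E by auto
    then show ?thesis by (simp add: c)
  next
    case True
    then obtain l where l: "l \<in> I" "a l \<noteq> 0" by blast
    define I' where "I' = I - {l}"
    have I': "finite I'" "l \<notin> I'" "insert l I' = I"
      using finI l by (auto simp: I'_def)
    have m: "(\<lambda>x. indicator {x. \<psi> (L x) = 0} x :: ennreal) \<in> borel_measurable (lborels I)" by measurable
    have "(\<integral>\<^sup>+x. indicator {x. \<psi> (L x) = 0} x \<partial>lborels I) 
        = (\<integral>\<^sup>+y. (\<integral>\<^sup>+t. indicator {x. \<psi> (L x) = 0} (y(l := t)) \<partial>lborel) \<partial>lborels I')"
      using lborels.product_nn_integral_insert[OF I'(1,2), of "\<lambda>x. indicator {x. \<psi> (L x) = 0} x"] m I'(3) by simp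
    also have "\<dots> = (\<integral>\<^sup>+y. 0 \<partial>lborels I')"
    proof (rule nn_integral_cong)
      fix y :: "nat \<Rightarrow> real"
      define w where "w = b + (\<Sum>i\<in>I'. a i * y i)"
      have "\<psi> (L (y(l := t))) = w + a l * t" for t
      proof -
        have "(\<Sum>i\<in>I'. a i * (y(l := t)) i) = (\<Sum>i\<in>I'. a i * y i)"
          using I'(2) by (intro sum.cong) auto
        then show ?thesis unfolding ab w_def using I'(1,2) by (subst I'(3)[symmetric]) simp
      qed
      then have "indicator {x. \<psi> (L x) = 0} (y(l := t)) = (indicator {- w / a l} t :: ennreal)" for t
        using l by (auto simp: indicator_def field_simps)
      then show "(\<integral>\<^sup>+t. indicator {x. \<psi> (L x) = 0} (y(l := t)) \<partial>lborel) = 0" by simp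
    qed
    finally show ?thesis by simp
  qed
  finally show ?thesis by simp
qed

lemma flat_measure_euclid: "flat_measure n n (euclid n) (euclid_lborel n)"
proof -
  have 1: "distr (euclid_lborel n) (euclid_lborel n) (\<lambda>x. restrict x {..<n}) = euclid_lborel n"
  proof -
    have "distr (euclid_lborel n) (euclid_lborel n) (\<lambda>x. restrict x {..<n}) = distr (euclid_lborel n) (euclid_lborel n) (\<lambda>x. x)"
      by (rule distr_cong) (auto simp: euclid_def)
    then show ?thesis by (simp add: distr_id)
  qed
  have 2: "affine_fun {..<n} (\<lambda>x. restrict x {..<n} k)" for k
    by (cases "k < n") (auto simp: affine_fun_coord)
  have 4: "restrict x {..<n} \<in> euclid n" for x :: "nat \<Rightarrow> real"
    by (simp add: euclid_def)
  have 3: "euclid n = range (\<lambda>x. restrict x {..<n})"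
  proof (intro equalityI subsetI)
    fix x :: "nat \<Rightarrow> real" assume "x \<in> euclid n"
    then have "x = restrict x {..<n}" by (simp add: euclid_def)
    then show "x \<in> range (\<lambda>x. restrict x {..<n})" by blast
  qed (use 4 in blast)
  show ?thesis
    unfolding flat_measure_def
    by (intro exI[of _ "{..<n}"] exI[of _ "\<lambda>x. restrict x {..<n}"] exI[of _ 1] conjI allI ballI 2 3 4)
       (use 1 in \<open>auto simp: euclid_lborel_def\<close>)
qed

lemma sets_flat_measure: "flat_measure n m E \<mu> \<Longrightarrow> sets \<mu> = sets (euclid_lborel n)"
  by (auto simp: flat_measure_def)

section \<open>Radial variance\<close>

definition sqdist :: "nat \<Rightarrow> (nat \<Rightarrow> real) \<Rightarrow> (nat \<Rightarrow> real) \<Rightarrow> real" where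
  "sqdist n x y = (\<Sum>i<n. (x i - y i)\<^sup>2)"

definition euclid_ball :: "nat \<Rightarrow> (nat \<Rightarrow> real) \<Rightarrow> real \<Rightarrow> (nat \<Rightarrow> real) set" where
  "euclid_ball n y r = {x \<in> euclid n. sqdist n x y \<le> r\<^sup>2}"

lemma sqdist_nonneg [simp]: "0 \<le> sqdist n x y"
  by (simp add: sqdist_def sum_nonneg)

lemma sqdist_lerp:
  "sqdist n (lerp p y r) z = r\<^sup>2 * sqdist n y p + 2 * r * (\<Sum>i<n. (y i - p i) * (p i - z i)) + sqdist n p z"
  unfolding sqdist_def lerp_def sum_distrib_left
  by (simp add: sum.distrib[symmetric] power2_eq_square algebra_simps)

lemma sqdist_le_iff: "0 \<le> r \<Longrightarrow> sqdist n x y \<le> r\<^sup>2 \<longleftrightarrow> L2_set (\<lambda>i. x i - y i) {..<n} \<le> r"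
  by (metis L2_set_def L2_set_nonneg power2_le_iff_abs_le abs_of_nonneg real_sqrt_pow2 sqdist_def sqdist_nonneg)

lemma measurable_sqdist [measurable]: "(\<lambda>x. sqdist n x z) \<in> borel_measurable (euclid_lborel n)"
  unfolding sqdist_def euclid_lborel_def by measurable

lemma sets_euclid_ball [measurable]: "euclid_ball n y r \<in> sets (euclid_lborel n)"
  using measurable_sets[OF measurable_sqdist, of "{..r\<^sup>2}" n y]
  by (simp add: euclid_ball_def vimage_def Int_def conj_commute)

lemma lerp_euclid: "p \<in> euclid n \<Longrightarrow> y \<in> euclid n \<Longrightarrow> lerp p y r \<in> euclid n"
  by (auto simp: euclid_def lerp_def PiE_def extensional_def)

text \<open>Let \<open>r\<close> have density \<open>d * r ^ (d - 1)\<close> on the unit interval,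
  so that \<open>r ^ j\<close> has mean \<open>d / (d + j)\<close>. Up to the factor
  \<open>d\<close>, the left side is the second moment of
  \<open>r\<^sup>2 * A + 2 * r * B + D\<close>, and the right side keeps its squared mean and the
  variance of \<open>r\<^sup>2 * A\<close>. What is dropped is the variance of
  \<open>2 * r * B\<close> and twice its covariance with \<open>r\<^sup>2 * A\<close>, which is
  nonnegative because \<open>A\<close> and \<open>B\<close> are.\<close>

lemma radial_variance:
  fixes A B D d :: real
  assumes "d > 0" "A \<ge> 0" "B \<ge> 0"
  shows "A\<^sup>2 / (d + 4) + 4 * A * B / (d + 3) + (4 * B\<^sup>2 + 2 * A * D) / (d + 2) + 4 * B * D / (d + 1) + D\<^sup>2 / d
     \<ge> (4 * d / ((d + 4) * (d + 2)\<^sup>2) * A\<^sup>2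
        + (d / (d + 2))\<^sup>2 * (A + 2 * ((d + 2) / (d + 1)) * B + D * (d + 2) / d)\<^sup>2) / d"
proof -
  have 1: "A\<^sup>2 / (d + 4) + 4 * A * B / (d + 3) + (4 * B\<^sup>2 + 2 * A * D) / (d + 2) + 4 * B * D / (d + 1) + D\<^sup>2 / d
     - (4 * d / ((d + 4) * (d + 2)\<^sup>2) * A\<^sup>2
        + (d / (d + 2))\<^sup>2 * (A + 2 * ((d + 2) / (d + 1)) * B + D * (d + 2) / d)\<^sup>2) / d
     = 8 * A * B / ((d + 1) * (d + 2) * (d + 3)) + 4 * B\<^sup>2 / ((d + 2) * (d + 1)\<^sup>2)"
    (is "?l = ?r")
  proof -
    \<comment> \<open>With the inverses as unknowns tied by polynomial equations, the identity
      becomes a question of ideal membership.\<close>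
    define a b c e where "a = inverse (d + 1)" "b = inverse (d + 2)" "c = inverse (d + 3)" "e = inverse (d + 4)"
    define f where "f = inverse d"
    have i: "a * (d + 1) = 1" "b * (d + 2) = 1" "c * (d + 3) = 1" "e * (d + 4) = 1" "f * d = 1"
      using assms(1) by (auto simp: a_b_c_e_def f_def)
    have l: "?l = A\<^sup>2 * e + 4 * A * B * c + (4 * B\<^sup>2 + 2 * A * D) * b + 4 * B * D * a + D\<^sup>2 * f
        - (4 * d * (e * b\<^sup>2) * A\<^sup>2 + (d * b)\<^sup>2 * (A + 2 * ((d + 2) * a) * B + D * (d + 2) * f)\<^sup>2) * f"
      by (simp add: a_b_c_e_def f_def divide_inverse power_inverse inverse_mult_distrib)
    have r: "?r = 8 * A * B * (a * b * c) + 4 * B\<^sup>2 * (b * a\<^sup>2)"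
      by (simp add: a_b_c_e_def f_def divide_inverse power_inverse inverse_mult_distrib)
    show ?thesis unfolding l r using i by algebra
  qed
  moreover have "?r \<ge> 0" using assms by simp
  ultimately show ?thesis by linarith
qed

lemma nn_integral_radial:
  fixes A B D :: real
  shows "(\<integral>\<^sup>+r. ennreal ((r\<^sup>2 * A + 2 * r * B + D)\<^sup>2) * ennreal (r ^ m) * indicator {0<..1} r \<partial>lborel)
    = ennreal (A\<^sup>2 / (real m + 5) + 4 * A * B / (real m + 4) + (4 * B\<^sup>2 + 2 * A * D) / (real m + 3)
        + 4 * B * D / (real m + 2) + D\<^sup>2 / (real m + 1))"
proof -
  define G where "G x = A\<^sup>2 / (real m + 5) * x ^ (m + 5) + 4 * A * B / (real m + 4) * x ^ (m + 4) 
     + (4 * B\<^sup>2 + 2 * A * D) / (real m + 3) * x ^ (m + 3)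
     + 4 * B * D / (real m + 2) * x ^ (m + 2) + D\<^sup>2 / (real m + 1) * x ^ (m + 1)" for x :: real
  have "(\<integral>\<^sup>+r. ennreal ((r\<^sup>2 * A + 2 * r * B + D)\<^sup>2) * ennreal (r ^ m) * indicator {0<..1} r \<partial>lborel)
      = (\<integral>\<^sup>+r. ennreal ((r\<^sup>2 * A + 2 * r * B + D)\<^sup>2 * r ^ m) * indicator {0..1} r \<partial>lborel)"
    by (rule nn_integral_cong_AE, rule AE_mp[OF AE_lborel_singleton[of "0::real"]])
       (auto simp: indicator_def ennreal_mult')
  also have "\<dots> = ennreal (G 1 - G 0)"
  proof (rule nn_integral_FTC_Icc)
    fix x :: real
    have D: "((\<lambda>x. a / (real m + real (Suc j)) * x ^ (m + Suc j)) has_real_derivative a * x ^ (m + j)) (at x)" for a j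
    proof -
      have "((\<lambda>x. a / (real m + real (Suc j)) * x ^ (m + Suc j)) has_real_derivative
          a / (real m + real (Suc j)) * (real (m + Suc j) * x ^ (m + Suc j - Suc 0))) (at x)"
        by (rule DERIV_cmult[OF DERIV_pow])
      moreover have "a / (real m + real (Suc j)) * (real (m + Suc j) * x ^ (m + Suc j - Suc 0)) = a * x ^ (m + j)"
        by (simp add: field_simps)
      ultimately show ?thesis by simp
    qed
    have "(G has_real_derivative (A\<^sup>2 * x ^ (m + 4) + 4 * A * B * x ^ (m + 3) + (4 * B\<^sup>2 + 2 * A * D) * x ^ (m + 2)
        + 4 * B * D * x ^ (m + 1) + D\<^sup>2 * x ^ (m + 0))) (at x)"
      unfolding G_def
      using D[of "A\<^sup>2" 4] D[of "4 * A * B" 3] D[of "4 * B\<^sup>2 + 2 * A * D" 2] D[of "4 * B * D" 1] D[of "D\<^sup>2" 0]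
      by (intro DERIV_add) (simp_all add: add.commute)
    moreover have "A\<^sup>2 * x ^ (m + 4) + 4 * A * B * x ^ (m + 3) + (4 * B\<^sup>2 + 2 * A * D) * x ^ (m + 2)
        + 4 * B * D * x ^ (m + 1) + D\<^sup>2 * x ^ (m + 0) = (x\<^sup>2 * A + 2 * x * B + D)\<^sup>2 * x ^ m"
      by (simp add: power_add power2_eq_square power3_eq_cube power4_eq_xxxx algebra_simps)
    ultimately show "(G has_real_derivative (x\<^sup>2 * A + 2 * x * B + D)\<^sup>2 * x ^ m) (at x)"
      by simp
  qed (auto simp: G_def)
  also have "G 0 = 0" by (simp add: G_def power_0_left)
  finally show ?thesis by (simp add: G_def add.commute)
qed

lemma nn_integral_power_unit:
  "(\<integral>\<^sup>+r. ennreal (r ^ m) * indicator {0<..1} r \<partial>lborel) = ennreal (1 / (real m + 1))"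
  using nn_integral_radial[of 0 0 1 m] by simp

section \<open>Cone decomposition of faces\<close>

lemma coord_neq: 
  assumes "x \<in> euclid n" "y \<in> euclid n" "x \<noteq> y" obtains i where "i < n" "x i \<noteq> y i"
proof -
  have "\<exists>i<n. x i \<noteq> y i"
  proof (rule ccontr)
    assume "\<not> ?thesis"
    then have "x = y" using assms(1,2) unfolding euclid_def by (intro PiE_ext[of x _ _ y]) auto
    then show False using assms(3) by simp
  qed
  then show thesis using that by blast
qed

lemma sqdist_eq_0:
  assumes "x \<in> euclid n" "y \<in> euclid n" "sqdist n x y \<le> 0" shows "x = y"
proof (rule ccontr)
  assume "x \<noteq> y"
  then obtain i where "i < n" "x i \<noteq> y i" using coord_neq[OF assms(1,2)] by blast
  moreover have "sqdist n x y = 0" using assms(3) sqdist_nonneg[of n x y] by linarith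
  ultimately show False by (simp add: sqdist_def sum_nonneg_eq_0_iff)
qed

text \<open>Outside \<open>{..<n}\<close> the points of \<open>euclid n\<close> take the single
  value \<open>undefined\<close>, so the box is a product of compact sets over all of
  \<open>nat\<close> and Tychonoff's theorem applies.\<close>

lemma compact_euclid_box: "compact {x \<in> euclid n. \<forall>i<n. \<bar>x i\<bar> \<le> R}"
proof -
  define S where "S i = (if i < n then {-R..R} else {undefined :: real})" for i
  have "compactin (product_topology (\<lambda>_. euclidean) UNIV) (PiE UNIV S)"
    by (subst compactin_PiE) (auto simp: S_def)
  moreover have "PiE UNIV S = {x \<in> euclid n. \<forall>i<n. \<bar>x i\<bar> \<le> R}"
    by (auto simp: S_def euclid_def PiE_def Pi_def extensional_def abs_le_iff split: if_splits)
  ultimately show ?thesis by (simp add: euclidean_product_topology)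
qed

lemma continuous_on_affine_fun: "affine_fun I g \<Longrightarrow> continuous_on S g"
proof (elim affine_funE)
  fix a b assume g: "\<And>x. g x = b + (\<Sum>i\<in>I. a i * x i)"
  have "continuous_on UNIV (\<lambda>x. b + (\<Sum>i\<in>I. a i * x i))"
    by (intro continuous_intros) auto
  then show "continuous_on S g" using g by (metis (mono_tags, lifting) continuous_on_cong continuous_on_subset subset_UNIV)
qed

text \<open>\<open>L\<close> is idempotent, so \<open>E\<close> is its set of fixed points;
  closedness, measurability and stability under lines are read off from the affine equations
  \<open>L x k = x k\<close>.\<close>

lemma flat_measure_carrier:
  assumes "flat_measure n m E \<mu>"
  shows "E \<subseteq> euclid n" "E \<in> sets (euclid_lborel n)" "closed E" "emeasure \<mu> (euclid n - E) = 0"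
    "x \<in> E \<Longrightarrow> y \<in> E \<Longrightarrow> lerp x y r \<in> E"
proof -
  obtain I L \<kappa> where I: "I \<subseteq> {..<n}" and \<kappa>: "0 < \<kappa>" 
    and aL: "\<And>k. affine_fun I (\<lambda>x. L x k)" and eL: "\<And>x. L x \<in> euclid n"
    and LI: "\<And>x i. i \<in> I \<Longrightarrow> L x i = x i" 
    and E: "E = range L" and \<mu>: "\<mu> = scale_measure (ennreal \<kappa>) (distr (lborels I) (euclid_lborel n) L)"
    using assms(1) unfolding flat_measure_def by blast
  have Lcong: "L x = L y" if "\<And>i. i \<in> I \<Longrightarrow> x i = y i" for x y
    using affine_fun_cong[OF aL] that by blast
  have LL: "L (L x) = L x" for x by (rule Lcong) (rule LI)
  show 1: "E \<subseteq> euclid n" using eL E by auto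
  have E2: "E = {x. \<forall>k. L x k = x k}"
  proof (intro equalityI subsetI)
    fix x assume "x \<in> {x. \<forall>k. L x k = x k}"
    then have "L x = x" by auto
    then show "x \<in> E" unfolding E by (metis rangeI)
  qed (auto simp: E LL)
  have "closed {x. \<forall>k. L x k = x k}"
    by (intro closed_Collect_all closed_Collect_eq continuous_on_affine_fun[OF aL]) auto
  then show "closed E" by (simp add: E2)
  \<comment> \<open>From \<open>n\<close> on both sides are \<open>undefined\<close>, so finitely
    many equations remain.\<close>
  have E3: "E = {x \<in> space (euclid_lborel n). \<forall>k\<in>{..<n}. L x k = x k}"
  proof -
    have "L x k = x k" if "x \<in> euclid n" "\<not> k < n" for x k
      using that eL[of x] by (auto simp: euclid_def PiE_def extensional_def)
    then show ?thesis using 1 unfolding E2 by auto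
  qed
  have [measurable]: "(\<lambda>x. L x k) \<in> borel_measurable (euclid_lborel n)" for k
    unfolding euclid_lborel_def by (rule measurable_affine_fun[OF aL I])
  have [measurable]: "(\<lambda>x. x k) \<in> borel_measurable (euclid_lborel n)" if "k < n" for k
    using that measurable_component_singleton[of k "{..<n}" "\<lambda>_. lborel"] unfolding euclid_lborel_def by simp
  have "{x \<in> space (euclid_lborel n). \<forall>k\<in>{..<n}. L x k = x k} \<in> sets (euclid_lborel n)"
    by (rule sets.sets_Collect_finite_All) (auto simp del: space_euclid_lborel)
  then show 2[measurable]: "E \<in> sets (euclid_lborel n)" using E3 by simp
  have *: "euclid n - E \<in> sets (euclid_lborel n)"
    using sets.compl_sets[OF 2] by simp
  have "emeasure \<mu> (euclid n - E) = (\<integral>\<^sup>+x. indicator (euclid n - E) x \<partial>\<mu>)"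
    using * by (intro nn_integral_indicator[symmetric]) (simp add: \<mu>)
  also have "\<dots> = ennreal \<kappa> * (\<integral>\<^sup>+x. indicator (euclid n - E) (L x) \<partial>lborels I)"
    by (rule nn_integral_flat[OF \<mu> aL eL]) (use * in measurable)
  also have "\<dots> = 0" by (simp add: E)
  finally show "emeasure \<mu> (euclid n - E) = 0" .
  assume xy: "x \<in> E" "y \<in> E"
  have "L (lerp x y r) = lerp (L x) (L y) r"
    using affine_fun_lerp[OF aL] by (auto simp: lerp_def)
  moreover have "L x = x" "L y = y" using xy unfolding E2 by auto
  ultimately show "lerp x y r \<in> E" unfolding E by (metis rangeI)
qed

lemma flat_measure_singleton:
  assumes "flat_measure n (Suc m) E \<mu>" "p \<in> E"
  shows "emeasure \<mu> {p} = 0"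
proof -
  obtain I L \<kappa> where I: "I \<subseteq> {..<n}" "card I = Suc m"
    and eL: "\<And>x. L x \<in> euclid n" and LI: "\<And>x i. i \<in> I \<Longrightarrow> L x i = x i" and E: "E = range L"
    using assms(1) unfolding flat_measure_def by blast
  obtain l where l: "l \<in> I" using I(2) by fastforce
  have a: "affine_fun {..<n} (\<lambda>x. x l - p l)"
    by (intro affine_fun_diff affine_fun_const affine_fun_coord) (use l I in auto)
  have "emeasure \<mu> {x \<in> euclid n. x l - p l = 0} = 0"
    by (rule flat_measure_hyperplane[OF assms(1) a, of "L (p(l := p l + 1))"]) (use E l LI in auto)
  moreover have "{p} \<subseteq> {x \<in> euclid n. x l - p l = 0}" using assms(2) E eL by auto
  moreover have "{x \<in> euclid n. x l - p l = 0} \<in> sets \<mu>"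
  proof -
    have "(\<lambda>x. x l - p l) \<in> borel_measurable (euclid_lborel n)"
      unfolding euclid_lborel_def by (rule measurable_affine_fun[OF a]) auto
    from measurable_sets[OF this, of "{0}"] show ?thesis
      by (simp add: sets_flat_measure[OF assms(1)] vimage_def Int_def conj_commute)
  qed
  ultimately show ?thesis using emeasure_mono[of "{p}" "{x \<in> euclid n. x l - p l = 0}" \<mu>] by simp
qed

text \<open>Constraints are indexed by naturals so that the least index can break ties between
  cones. Faces occur as \<open>P \<inter> E\<close> with a flat \<open>E\<close>, all with the same
  family of constraints.\<close>

locale bounded_polyhedron =
  fixes n :: nat and J :: "nat set" and h :: "nat \<Rightarrow> (nat \<Rightarrow> real) \<Rightarrow> real" and R :: real
    and P :: "(nat \<Rightarrow> real) set"
  defines "P \<equiv> {x \<in> euclid n. \<forall>j\<in>J. h j x \<le> 0}"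
  assumes finJ: "finite J" and affine_h: "\<And>j. j \<in> J \<Longrightarrow> affine_fun {..<n} (h j)"
    and bounded: "P \<subseteq> euclid_cball n R"
begin

lemma coord_bound: "x \<in> P \<Longrightarrow> i < n \<Longrightarrow> \<bar>x i\<bar> \<le> R"
  using bounded member_le_L2_set[of "{..<n}" i "\<lambda>i. \<bar>x i\<bar>"]
  by (force simp: L2_set_def euclid_cball_def euclid_norm_def)

lemma P_euclid: "x \<in> P \<Longrightarrow> x \<in> euclid n"
  by (simp add: P_def)

lemma lerp_P:
  assumes "x \<in> P" "y \<in> P" "0 \<le> r" "r \<le> 1" shows "lerp x y r \<in> P"
proof -
  have "h j (lerp x y r) \<le> 0" if j: "j \<in> J" for j
  proof -
    have "h j (lerp x y r) = (1 - r) * h j x + r * h j y"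
      by (subst affine_fun_lerp[OF affine_h[OF j]]) (simp add: algebra_simps)
    moreover have "(1 - r) * h j x \<le> 0" "r * h j y \<le> 0"
      using assms j by (auto simp: P_def mult_le_0_iff)
    ultimately show ?thesis by linarith
  qed
  then show ?thesis using assms(1,2) by (simp add: P_def lerp_euclid)
qed

lemma measurable_h: "j \<in> J \<Longrightarrow> h j \<in> borel_measurable (euclid_lborel n)"
  unfolding euclid_lborel_def by (rule measurable_affine_fun[OF affine_h]) auto

lemma sets_P [measurable]: "P \<in> sets (euclid_lborel n)"
proof -
  have [measurable]: "j \<in> J \<Longrightarrow> h j \<in> borel_measurable (euclid_lborel n)" for j by (rule measurable_h)
  have "{x \<in> space (euclid_lborel n). \<forall>j\<in>J. h j x \<le> 0} \<in> sets (euclid_lborel n)"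
    by (rule sets.sets_Collect_finite_All[OF _ finJ]) (auto simp del: space_euclid_lborel)
  then show ?thesis by (simp add: P_def)
qed

text \<open>Moving from the minimiser of the distance to \<open>z\<close> towards another point of
  the convex set \<open>P \<inter> E\<close> cannot decrease the distance; the derivative at the
  start has the stated sign. It is the sign of the cross term along every ray from
  \<open>p\<close>.\<close>

lemma closest_point:
  assumes "closed E" "P \<inter> E \<noteq> {}" and conv: "\<And>x y r. x \<in> E \<Longrightarrow> y \<in> E \<Longrightarrow> lerp x y r \<in> E"
  obtains p where "p \<in> P" "p \<in> E" 
    "\<And>y. y \<in> P \<Longrightarrow> y \<in> E \<Longrightarrow> 0 \<le> (\<Sum>i<n. (y i - p i) * (p i - z i))"
proof -
  define B where "B = {x \<in> euclid n. \<forall>i<n. \<bar>x i\<bar> \<le> R}"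
  have "closed (\<Inter>j\<in>J. {x. h j x \<le> 0})"
    by (intro closed_INT ballI closed_Collect_le continuous_on_affine_fun[OF affine_h]) auto
  moreover have "(\<Inter>j\<in>J. {x. h j x \<le> 0}) = {x. \<forall>j\<in>J. h j x \<le> 0}" by auto
  ultimately have "closed (E \<inter> {x. \<forall>j\<in>J. h j x \<le> 0})"
    using assms(1) by (intro closed_Int) auto
  then have "compact (B \<inter> (E \<inter> {x. \<forall>j\<in>J. h j x \<le> 0}))"
    unfolding B_def by (intro compact_Int_closed compact_euclid_box)
  moreover have "B \<inter> (E \<inter> {x. \<forall>j\<in>J. h j x \<le> 0}) = P \<inter> E"
    using coord_bound by (auto simp: B_def P_def)
  ultimately have "compact (P \<inter> E)" by simp
  moreover have "continuous_on (P \<inter> E) (\<lambda>x. sqdist n x z)"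
    unfolding sqdist_def
    by (intro continuous_intros continuous_on_subset[OF continuous_on_product_coordinates]) auto
  ultimately obtain p where p: "p \<in> P" "p \<in> E" and min: "\<And>y. y \<in> P \<Longrightarrow> y \<in> E \<Longrightarrow> sqdist n p z \<le> sqdist n y z"
    using continuous_attains_inf[of "P \<inter> E" "\<lambda>x. sqdist n x z"] assms(2) by blast
  show thesis
  proof (rule that[OF p])
    fix y assume y: "y \<in> P" "y \<in> E"
    define A where "A = sqdist n y p"
    define S where "S = (\<Sum>i<n. (y i - p i) * (p i - z i))"
    have "A \<ge> 0" by (simp add: A_def)
    have *: "0 \<le> t\<^sup>2 * A + 2 * t * S" if "0 \<le> t" "t \<le> 1" for t
      using min[OF lerp_P[OF p(1) y(1) that] conv[OF p(2) y(2)]] sqdist_lerp[of n p y t z]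
      by (simp add: A_def S_def)
    show "0 \<le> S"
    proof (rule ccontr)
      assume S: "\<not> 0 \<le> S"
      \<comment> \<open>Small enough for the linear term \<open>2 * t * S\<close> to dominate the
        quadratic one; \<open>A + 1\<close> keeps the denominator positive.\<close>
      define t where "t = min 1 (- S / (A + 1))"
      have "- S / (A + 1) > 0" using S \<open>A \<ge> 0\<close> by (intro divide_pos_pos) auto
      then have t: "0 < t" "t \<le> 1" by (auto simp: t_def)
      have "t * A \<le> t * (A + 1)" using t by simp
      also have "\<dots> \<le> - S"
      proof -
        have "t \<le> - S / (A + 1)" by (simp add: t_def)
        then show ?thesis using \<open>A \<ge> 0\<close> by (subst (asm) pos_le_divide_eq) auto
      qed
      finally have "t * A + 2 * S < 0" using S by linarith
      then have "t * (t * A + 2 * S) < 0" using t by (simp add: mult_pos_neg)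
      then show False using *[of t] t by (simp add: power2_eq_square algebra_simps)
    qed
  qed
qed

text \<open>A face \<open>P \<inter> E\<close> is cut into the cones from \<open>p\<close> over the faces cut out by the constraints
  that are not tight at \<open>p\<close>. The normalised constraint \<open>\<psi> k\<close> vanishes at \<open>p\<close> and equals \<open>1\<close> on
  its face; \<open>x\<close> belongs to the cone of the first index at which \<open>\<psi> k x\<close> is maximal.\<close>

lemma cone_decomposition:
  assumes flat: "flat_measure n (Suc m) E \<mu>" and p: "p \<in> P" "p \<in> E"
  obtains I C F \<nu> where "I \<subseteq> J" "disjoint_family_on C I"
    "\<And>i. i \<in> I \<Longrightarrow> C i \<in> sets (euclid_lborel n)" "\<And>i. i \<in> I \<Longrightarrow> C i \<subseteq> P \<inter> E"
    "emeasure \<mu> (P \<inter> E) \<le> (\<Sum>i\<in>I. emeasure \<mu> (C i))"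
    "\<And>i. i \<in> I \<Longrightarrow> F i \<subseteq> E" "\<And>i. i \<in> I \<Longrightarrow> flat_measure n m (F i) (\<nu> i)"
    "\<And>i f. i \<in> I \<Longrightarrow> f \<in> borel_measurable (euclid_lborel n) \<Longrightarrow>
        (\<integral>\<^sup>+x. f x * indicator (C i) x \<partial>\<mu>)
      = (\<integral>\<^sup>+y. (\<integral>\<^sup>+r. f (lerp p y r) * ennreal (r ^ m) * indicator {0<..1} r \<partial>lborel) * indicator (P \<inter> F i) y \<partial>\<nu> i)"
proof -
  note carrier = flat_measure_carrier[OF flat]
  define \<psi> where "\<psi> k x = 1 - h k x / h k p" for k x
  \<comment> \<open>A constraint slack at \<open>p\<close> and constant on \<open>E\<close> never
    becomes tight on \<open>E\<close>, so only the other slack ones can bound a cone.\<close>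
  define Jp where "Jp = {k \<in> J. h k p < 0 \<and> (\<exists>x\<in>E. \<psi> k x \<noteq> 0)}"
  have JpJ: "Jp \<subseteq> J" and finJp: "finite Jp" using finJ by (auto simp: Jp_def)
  have a\<psi>: "affine_fun {..<n} (\<psi> k)" if "k \<in> J" for k
    unfolding \<psi>_def by (intro affine_fun_diff affine_fun_const affine_fun_divide affine_h that)
  have \<psi>p: "\<psi> k p = 0" if "k \<in> Jp" for k using that by (simp add: \<psi>_def Jp_def)
  have \<psi>1: "\<psi> k x \<le> 1 \<longleftrightarrow> h k x \<le> 0" if "k \<in> Jp" for k x 
    using that by (auto simp: \<psi>_def Jp_def divide_le_0_iff zero_le_divide_iff)
  have \<psi>lerp: "\<psi> k (lerp p x r) = r * \<psi> k x" if "k \<in> Jp" for k x r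
    using affine_fun_lerp[OF a\<psi>] \<psi>p[OF that] that JpJ by auto
  have m\<psi>: "\<psi> k \<in> borel_measurable (euclid_lborel n)" if "k \<in> Jp" for k
    unfolding euclid_lborel_def by (rule measurable_affine_fun[OF a\<psi>]) (use that JpJ in auto)
  define C where "C i = {x \<in> P \<inter> E. 0 < \<psi> i x \<and> (\<forall>k\<in>Jp. \<psi> k x \<le> \<psi> i x \<and> (k < i \<longrightarrow> \<psi> k x < \<psi> i x))}" for i
  define F where "F i = {x \<in> E. \<psi> i x = 1}" for i
  \<comment> \<open>The base of the cone \<open>C i\<close>: ties with a later index are allowed,
    ties with an earlier one are excluded.\<close>
  define B where "B i = {y \<in> P \<inter> F i. \<forall>k\<in>Jp. k < i \<longrightarrow> \<psi> k y < 1}" for i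
  \<comment> \<open>A point of the base is what makes the excluded ties a null set of the
    face.\<close>
  define I where "I = {i \<in> Jp. B i \<noteq> {}}"
  have IJp: "I \<subseteq> Jp" by (auto simp: I_def)
  have Csets: "C i \<in> sets (euclid_lborel n)" if i: "i \<in> Jp" for i
  proof -
    note [measurable] = m\<psi> carrier(2) i finJp
    have "{x \<in> space (euclid_lborel n). x \<in> P \<inter> E \<and> 0 < \<psi> i x \<and> 
        (\<forall>k\<in>Jp. \<psi> k x \<le> \<psi> i x \<and> (k < i \<longrightarrow> \<psi> k x < \<psi> i x))} \<in> sets (euclid_lborel n)"
    proof (intro sets.sets_Collect_conj sets.sets_Collect_finite_All[OF _ finJp])
      fix k assume k[measurable]: "k \<in> Jp"
      show "{x \<in> space (euclid_lborel n). \<psi> k x \<le> \<psi> i x} \<in> sets (euclid_lborel n)"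
        using m\<psi>[OF k] m\<psi>[OF i] by measurable
      show "{x \<in> space (euclid_lborel n). k < i \<longrightarrow> \<psi> k x < \<psi> i x} \<in> sets (euclid_lborel n)"
        using m\<psi>[OF k] m\<psi>[OF i] by measurable
    next
      show "{x \<in> space (euclid_lborel n). 0 < \<psi> i x} \<in> sets (euclid_lborel n)"
        using m\<psi>[OF i] by measurable
      show "{x \<in> space (euclid_lborel n). x \<in> P \<inter> E} \<in> sets (euclid_lborel n)"
        by measurable
    qed
    also have "{x \<in> space (euclid_lborel n). x \<in> P \<inter> E \<and> 0 < \<psi> i x \<and> 
        (\<forall>k\<in>Jp. \<psi> k x \<le> \<psi> i x \<and> (k < i \<longrightarrow> \<psi> k x < \<psi> i x))} = C i"
      using carrier(1) by (auto simp: C_def)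
    finally show ?thesis .
  qed
  have disj: "disjoint_family_on C Jp"
  proof -
    have "C i \<inter> C k = {}" if "i \<in> Jp" "k \<in> Jp" "i < k" for i k
      using that by (force simp: C_def)
    then have "C i \<inter> C k = {}" if "i \<in> Jp" "k \<in> Jp" "i \<noteq> k" for i k
      using that linorder_neqE_nat[of i k] by (metis Int_commute)
    then show ?thesis unfolding disjoint_family_on_def by blast
  qed
  \<comment> \<open>Here \<open>t\<close> may exceed \<open>1\<close>: only the constraints in
    \<open>Jp\<close> limit how far the ray from \<open>p\<close> through \<open>x\<close> runs
    inside \<open>P\<close>.\<close>
  have in_P: "lerp p x t \<in> P" 
    if x: "x \<in> P" "x \<in> E" and t: "0 \<le> t" and le: "\<And>k. k \<in> Jp \<Longrightarrow> t * \<psi> k x \<le> 1" for x t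
  proof -
    have "h k (lerp p x t) \<le> 0" if k: "k \<in> J" for k
    proof (cases "h k p = 0")
      case True
      then show ?thesis using affine_fun_lerp[OF affine_h[OF k], of p x t] x t k by (simp add: P_def mult_le_0_iff)
    next
      case False
      then have neg: "h k p < 0" using p k by (auto simp: P_def less_le)
      show ?thesis
      proof (cases "k \<in> Jp")
        case True
        then show ?thesis using \<psi>1[OF True, of "lerp p x t"] \<psi>lerp[OF True, of x t] le[OF True] by metis
      next
        case False
        then have "\<psi> k x = 0" using neg x k by (auto simp: Jp_def)
        then have "h k x = h k p" using neg by (simp add: \<psi>_def field_simps)
        then show ?thesis using affine_fun_lerp[OF affine_h[OF k], of p x t] neg by simp
      qed
    qed
    then show ?thesis using x p by (simp add: P_def lerp_euclid)
  qed
  have cover: "P \<inter> E - {p} \<subseteq> (\<Union>i\<in>Jp. C i)"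
  proof
    fix x assume x: "x \<in> P \<inter> E - {p}"
    \<comment> \<open>Otherwise no constraint stops the ray from \<open>p\<close> through
      \<open>x\<close>. A displacement of \<open>2 * R + 1\<close> in one coordinate is impossible
      between points whose coordinates are bounded by \<open>R\<close>.\<close>
    have "\<exists>k\<in>Jp. 0 < \<psi> k x"
    proof (rule ccontr)
      assume no: "\<not> ?thesis"
      have inP: "lerp p x t \<in> P" if "0 \<le> t" for t
      proof (rule in_P)
        fix k assume "k \<in> Jp"
        then have "\<psi> k x \<le> 0" using no by (meson not_le)
        then have "t * \<psi> k x \<le> 0" using that by (simp add: mult_nonneg_nonpos)
        then show "t * \<psi> k x \<le> 1" by simp
      qed (use x that in auto)
      obtain i where i: "i < n" "x i \<noteq> p i"
        using coord_neq[of x n p] P_euclid x p(1) by blast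
      define t where "t = (2 * R + 1) / \<bar>x i - p i\<bar>"
      have R: "\<bar>p i\<bar> \<le> R" using coord_bound[OF p(1) i(1)] .
      then have t: "0 \<le> t" by (simp add: t_def)
      have "\<bar>lerp p x t i\<bar> \<le> R" by (rule coord_bound[OF inP[OF t] i(1)])
      moreover have "\<bar>t * (x i - p i)\<bar> = 2 * R + 1" using i R by (simp add: t_def abs_mult)
      ultimately show False using R by (simp add: lerp_def)
    qed
    then obtain k0 where k0: "k0 \<in> Jp" "0 < \<psi> k0 x" by blast
    define M where "M = Max ((\<lambda>k. \<psi> k x) ` Jp)"
    have M: "\<psi> k x \<le> M" if "k \<in> Jp" for k using that finJp by (simp add: M_def)
    have "M \<in> (\<lambda>k. \<psi> k x) ` Jp" unfolding M_def using k0 finJp by (intro Max_in) auto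
    then have ex: "\<exists>k. k \<in> Jp \<and> \<psi> k x = M" by auto
    define i where "i = (LEAST k. k \<in> Jp \<and> \<psi> k x = M)"
    have i: "i \<in> Jp" "\<psi> i x = M" using LeastI_ex[OF ex] unfolding i_def by auto
    have "\<psi> k x < M" if "k \<in> Jp" "k < i" for k
      using not_less_Least[of k "\<lambda>k. k \<in> Jp \<and> \<psi> k x = M"] that M[of k] unfolding i_def by auto
    then have "x \<in> C i" using i M k0 x by (force simp: C_def)
    then show "x \<in> (\<Union>i\<in>Jp. C i)" using i by blast
  qed
  \<comment> \<open>Each \<open>\<psi> k\<close> is homogeneous about \<open>p\<close>, so the order
    among their values is constant along a ray and membership in \<open>C i\<close> is decided at
    the base.\<close>
  have scale: "lerp p y r \<in> C i \<longleftrightarrow> y \<in> B i" if i: "i \<in> Jp" and y: "y \<in> F i" and r: "0 < r" "r \<le> 1" for i y r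
  proof
    have yE: "y \<in> E" and yi: "\<psi> i y = 1" using y by (auto simp: F_def)
    { assume "lerp p y r \<in> C i"
      then have x: "lerp p y r \<in> P" "lerp p y r \<in> E" and 
        k: "\<And>k. k \<in> Jp \<Longrightarrow> r * \<psi> k y \<le> r" "\<And>k. k \<in> Jp \<Longrightarrow> k < i \<Longrightarrow> r * \<psi> k y < r"
        using i yi by (auto simp: C_def \<psi>lerp)
      have k1: "\<psi> k y \<le> 1" if "k \<in> Jp" for k using k(1)[OF that] r by simp
      have k2: "\<psi> k y < 1" if "k \<in> Jp" "k < i" for k using k(2)[OF that] r by simp
      have "lerp p (lerp p y r) (1 / r) \<in> P"
        by (rule in_P[OF x]) (use r k1 in \<open>auto simp: \<psi>lerp\<close>)
      moreover have "lerp p (lerp p y r) (1 / r) = y" using r by (auto simp: lerp_def fun_eq_iff)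
      ultimately show "y \<in> B i" using y k2 by (simp add: B_def)
    }
    { assume B: "y \<in> B i"
      then have "y \<in> P" and k2: "\<And>k. k \<in> Jp \<Longrightarrow> k < i \<Longrightarrow> \<psi> k y < 1" by (auto simp: B_def)
      have k1: "\<psi> k y \<le> 1" if "k \<in> Jp" for k
        using \<psi>1[OF that] \<open>y \<in> P\<close> that JpJ by (auto simp: P_def)
      have "lerp p y r \<in> P" "lerp p y r \<in> E" 
        using lerp_P[OF p(1) \<open>y \<in> P\<close>] carrier(5)[OF p(2) yE] r by auto
      then show "lerp p y r \<in> C i"
        using i yi r k1 k2 by (auto simp: C_def \<psi>lerp) 
    }
  qed
  have "\<forall>i\<in>Jp. \<exists>\<nu>. flat_measure n m (F i) \<nu> \<and>
     (\<forall>f \<in> borel_measurable (euclid_lborel n). 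
       (\<integral>\<^sup>+x. f x * indicator {x. 0 < \<psi> i x \<and> \<psi> i x \<le> 1} x \<partial>\<mu>)
      = (\<integral>\<^sup>+y. (\<integral>\<^sup>+r. f (lerp p y r) * ennreal (r ^ m) * indicator {0<..1} r \<partial>lborel) \<partial>\<nu>))"
  proof
    fix i assume i: "i \<in> Jp"
    then obtain x1 where "x1 \<in> E" "\<psi> i x1 \<noteq> 0" by (auto simp: Jp_def)
    then show "\<exists>\<nu>. flat_measure n m (F i) \<nu> \<and>
     (\<forall>f \<in> borel_measurable (euclid_lborel n). 
       (\<integral>\<^sup>+x. f x * indicator {x. 0 < \<psi> i x \<and> \<psi> i x \<le> 1} x \<partial>\<mu>)
      = (\<integral>\<^sup>+y. (\<integral>\<^sup>+r. f (lerp p y r) * ennreal (r ^ m) * indicator {0<..1} r \<partial>lborel) \<partial>\<nu>))"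
      unfolding F_def using i JpJ by (intro flat_measure_polar[OF flat p(2) a\<psi> \<psi>p]) auto
  qed
  from bchoice[OF this] obtain \<nu> where \<nu>_polar: "\<forall>i\<in>Jp. flat_measure n m (F i) (\<nu> i) \<and>
     (\<forall>f \<in> borel_measurable (euclid_lborel n). 
       (\<integral>\<^sup>+x. f x * indicator {x. 0 < \<psi> i x \<and> \<psi> i x \<le> 1} x \<partial>\<mu>)
      = (\<integral>\<^sup>+y. (\<integral>\<^sup>+r. f (lerp p y r) * ennreal (r ^ m) * indicator {0<..1} r \<partial>lborel) \<partial>\<nu> i))" ..
  have \<nu>: "flat_measure n m (F i) (\<nu> i)" if "i \<in> Jp" for i
    using \<nu>_polar[rule_format, OF that] by (rule conjunct1)
  have polar: "(\<integral>\<^sup>+x. f x * indicator {x. 0 < \<psi> i x \<and> \<psi> i x \<le> 1} x \<partial>\<mu>)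
      = (\<integral>\<^sup>+y. (\<integral>\<^sup>+r. f (lerp p y r) * ennreal (r ^ m) * indicator {0<..1} r \<partial>lborel) \<partial>\<nu> i)"
    if "i \<in> Jp" "f \<in> borel_measurable (euclid_lborel n)" for i f
    using \<nu>_polar[rule_format, OF that(1), THEN conjunct2] that(2) by (rule bspec)
  have C_sub: "C i \<subseteq> {x. 0 < \<psi> i x \<and> \<psi> i x \<le> 1}" if "i \<in> Jp" for i
    using \<psi>1[OF that] that JpJ by (auto simp: C_def P_def)
  have formula: "(\<integral>\<^sup>+x. f x * indicator (C i) x \<partial>\<mu>)
      = (\<integral>\<^sup>+y. (\<integral>\<^sup>+r. f (lerp p y r) * ennreal (r ^ m) * indicator {0<..1} r \<partial>lborel) * indicator (B i) y \<partial>\<nu> i)"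
    if i: "i \<in> Jp" and f: "f \<in> borel_measurable (euclid_lborel n)" for i f
  proof -
    have AE: "AE y in \<nu> i. y \<in> F i"
    proof (rule AE_I)
      show "{x \<in> space (\<nu> i). x \<notin> F i} \<subseteq> euclid n - F i"
        using sets_eq_imp_space_eq[OF sets_flat_measure[OF \<nu>[OF i]]] by auto
      show "emeasure (\<nu> i) (euclid n - F i) = 0" by (rule flat_measure_carrier(4)[OF \<nu>[OF i]])
      show "euclid n - F i \<in> sets (\<nu> i)"
        using flat_measure_carrier(2)[OF \<nu>[OF i]] sets.compl_sets[of "F i" "euclid_lborel n"]
        by (simp add: sets_flat_measure[OF \<nu>[OF i]])
    qed
    have "(\<integral>\<^sup>+x. f x * indicator (C i) x \<partial>\<mu>) = (\<integral>\<^sup>+x. (f x * indicator (C i) x) * indicator {x. 0 < \<psi> i x \<and> \<psi> i x \<le> 1} x \<partial>\<mu>)"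
      using C_sub[OF i] by (intro nn_integral_cong) (auto simp: indicator_def)
    also have "\<dots> = (\<integral>\<^sup>+y. (\<integral>\<^sup>+r. (f (lerp p y r) * indicator (C i) (lerp p y r)) * ennreal (r ^ m) * indicator {0<..1} r \<partial>lborel) \<partial>\<nu> i)"
      by (rule polar[OF i]) (use f Csets[OF i] in measurable)
    also have "\<dots> = (\<integral>\<^sup>+y. (\<integral>\<^sup>+r. f (lerp p y r) * ennreal (r ^ m) * indicator {0<..1} r \<partial>lborel) * indicator (B i) y \<partial>\<nu> i)"
    proof (rule nn_integral_cong_AE, rule AE_mp[OF AE], intro AE_I2 impI)
      fix y assume y: "y \<in> F i"
      have "(\<integral>\<^sup>+r. (f (lerp p y r) * indicator (C i) (lerp p y r)) * ennreal (r ^ m) * indicator {0<..1} r \<partial>lborel)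
         = (\<integral>\<^sup>+r. (f (lerp p y r) * ennreal (r ^ m) * indicator {0<..1} r) * indicator (B i) y \<partial>lborel)"
        using scale[OF i y] by (intro nn_integral_cong) (auto simp: indicator_def)
      then show "(\<integral>\<^sup>+r. (f (lerp p y r) * indicator (C i) (lerp p y r)) * ennreal (r ^ m) * indicator {0<..1} r \<partial>lborel)
         = (\<integral>\<^sup>+r. f (lerp p y r) * ennreal (r ^ m) * indicator {0<..1} r \<partial>lborel) * indicator (B i) y"
        by (cases "y \<in> B i") auto
    qed
    finally show ?thesis .
  qed
  \<comment> \<open>\<open>P \<inter> F i\<close> exceeds \<open>B i\<close> only by points where an
    earlier \<open>\<psi> k\<close> equals \<open>1\<close> too; each such set lies in a hyperplane
    that misses the witness in \<open>B i\<close>, hence is null.\<close>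
  have B_AE: "AE y in \<nu> i. y \<in> P \<inter> F i \<longleftrightarrow> y \<in> B i" if i: "i \<in> I" for i
  proof -
    have iJp: "i \<in> Jp" using i IJp by auto
    obtain y0 where y0: "y0 \<in> B i" using i by (auto simp: I_def)
    have k: "AE y in \<nu> i. \<psi> k y \<noteq> 1" if k: "k \<in> Jp" "k < i" for k
    proof -
      have a: "affine_fun {..<n} (\<lambda>y. \<psi> k y - 1)" using k JpJ by (intro affine_fun_diff a\<psi> affine_fun_const) auto
      have "emeasure (\<nu> i) {y \<in> euclid n. \<psi> k y - 1 = 0} = 0"
        by (rule flat_measure_hyperplane[OF \<nu>[OF iJp] a, of y0]) (use y0 k in \<open>auto simp: B_def\<close>)
      moreover have "{y \<in> euclid n. \<psi> k y - 1 = 0} \<in> sets (\<nu> i)"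
        using measurable_sets[OF m\<psi>[OF k(1)], of "{1}"]
        by (simp add: sets_flat_measure[OF \<nu>[OF iJp]] vimage_def Int_def conj_commute)
      ultimately show ?thesis
        using sets_eq_imp_space_eq[OF sets_flat_measure[OF \<nu>[OF iJp]]]
        by (intro AE_I[where N = "{y \<in> euclid n. \<psi> k y - 1 = 0}"]) auto
    qed
    have "AE y in \<nu> i. \<forall>k\<in>{k \<in> Jp. k < i}. \<psi> k y \<noteq> 1"
      by (rule AE_finite_allI) (use finJp k in auto)
    then show ?thesis
    proof (rule AE_mp, intro AE_I2 impI)
      fix y assume "\<forall>k\<in>{k \<in> Jp. k < i}. \<psi> k y \<noteq> 1"
      moreover have "\<psi> k y \<le> 1" if "k \<in> Jp" "y \<in> P" for k
        using \<psi>1[OF that(1)] that JpJ by (auto simp: P_def)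
      ultimately show "y \<in> P \<inter> F i \<longleftrightarrow> y \<in> B i" by (force simp: B_def)
    qed
  qed
  have C_empty: "C i = {}" if i: "i \<in> Jp" "i \<notin> I" for i
  proof (rule ccontr)
    assume "C i \<noteq> {}"
    then obtain x where x: "x \<in> C i" by blast
    define r where "r = \<psi> i x"
    have r: "0 < r" "r \<le> 1" using x C_sub[OF i(1)] by (auto simp: r_def C_def)
    have "lerp p x (1 / r) \<in> F i"
      using x r carrier(5)[OF p(2)] i(1) by (auto simp: F_def C_def \<psi>lerp r_def)
    moreover have "lerp p (lerp p x (1 / r)) r = x" using r by (auto simp: lerp_def)
    ultimately show False using scale[OF i(1) _ r, of "lerp p x (1 / r)"] x i by (auto simp: I_def)
  qed
  show thesis
  proof (rule that)
    show "I \<subseteq> J" using IJp JpJ by blast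
    show "disjoint_family_on C I" by (rule disjoint_family_on_mono[OF IJp disj])
    fix i assume i: "i \<in> I"
    then have iJp: "i \<in> Jp" using IJp by blast
    show "C i \<in> sets (euclid_lborel n)" by (rule Csets[OF iJp])
    show "C i \<subseteq> P \<inter> E" by (auto simp: C_def)
    show "flat_measure n m (F i) (\<nu> i)" by (rule \<nu>[OF iJp])
    show "F i \<subseteq> E" by (auto simp: F_def)
    fix f :: "(nat \<Rightarrow> real) \<Rightarrow> ennreal" assume f: "f \<in> borel_measurable (euclid_lborel n)"
    show "(\<integral>\<^sup>+x. f x * indicator (C i) x \<partial>\<mu>)
      = (\<integral>\<^sup>+y. (\<integral>\<^sup>+r. f (lerp p y r) * ennreal (r ^ m) * indicator {0<..1} r \<partial>lborel) * indicator (P \<inter> F i) y \<partial>\<nu> i)"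
      unfolding formula[OF iJp f]
      by (rule nn_integral_cong_AE, rule AE_mp[OF B_AE[OF i]]) (auto simp: indicator_def)
  next
    \<comment> \<open>Only the apex lies outside all cones, and it is null because the flat has
      positive dimension.\<close>
    have "P \<inter> E \<subseteq> {p} \<union> (\<Union>i\<in>I. C i)"
      using cover C_empty by blast
    moreover have sing: "{p} \<in> sets \<mu>"
    proof -
      have "{p} = euclid_ball n p 0"
        using p(1) P_euclid sqdist_eq_0[of _ n p] by (auto simp: euclid_ball_def sqdist_def)
      then show ?thesis by (simp add: sets_flat_measure[OF flat])
    qed
    moreover have UC: "(\<Union>i\<in>I. C i) \<in> sets \<mu>"
      using Csets IJp finite_subset[OF IJp finJp] by (auto simp: sets_flat_measure[OF flat] intro!: sets.finite_UN)
    ultimately have "emeasure \<mu> (P \<inter> E) \<le> emeasure \<mu> ({p} \<union> (\<Union>i\<in>I. C i))"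
      by (intro emeasure_mono sets.Un)
    also have "\<dots> \<le> emeasure \<mu> {p} + emeasure \<mu> (\<Union>i\<in>I. C i)"
      by (rule emeasure_subadditive[OF sing UC])
    also have "\<dots> \<le> 0 + (\<Sum>i\<in>I. emeasure \<mu> (C i))"
      using Csets IJp finite_subset[OF IJp finJp] 
      by (intro add_mono emeasure_subadditive_finite) (auto simp: sets_flat_measure[OF flat] flat_measure_singleton[OF flat p(2)])
    finally show "emeasure \<mu> (P \<inter> E) \<le> (\<Sum>i\<in>I. emeasure \<mu> (C i))" by simp
  qed
qed

end

section \<open>Variance on a face\<close>

text \<open>The weights satisfy \<open>kappa n (d - 1) * (d / (d + 2))\<^sup>2 = kappa n d\<close>, where \<open>d / (d + 2)\<close> is the mean of
  \<open>r\<^sup>2\<close> for the density \<open>d * r ^ (d - 1)\<close> on \<open>[0, 1]\<close>, and stay below its variance.\<close>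

definition kappa :: "nat \<Rightarrow> nat \<Rightarrow> real" where
  "kappa n d = (real n)\<^sup>2 / (5 * ((real d + 1)\<^sup>2 * (real d + 2)\<^sup>2))"

lemma kappa_nonneg: "0 \<le> kappa n d"
  by (simp add: kappa_def)

lemma kappa_Suc: "kappa n (Suc m) = ((real m + 1) / (real m + 3))\<^sup>2 * kappa n m"
  by (simp add: kappa_def power_divide field_simps)

lemma kappa_le_variance:
  assumes "n \<le> 2 * Suc m"
  shows "kappa n (Suc m) \<le> 4 * (real m + 1) / ((real m + 5) * (real m + 3)\<^sup>2)"
proof -
  have "real n \<le> real (2 * Suc m)" using assms by (simp only: of_nat_le_iff)
  then have "real n \<le> 2 * (real m + 1)" by simp
  then have "(real n)\<^sup>2 \<le> (2 * (real m + 1))\<^sup>2" by (intro power_mono) auto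
  also have "\<dots> \<le> 4 * (real m + 2)\<^sup>2" by (simp add: power2_eq_square algebra_simps)
  finally have 1: "(real n)\<^sup>2 \<le> 4 * (real m + 2)\<^sup>2" .
  have "kappa n (Suc m) = (real n)\<^sup>2 / (5 * (real m + 2)\<^sup>2 * (real m + 3)\<^sup>2)"
    by (simp add: kappa_def add.commute)
  also have "\<dots> \<le> (4 * (real m + 2)\<^sup>2) / (5 * (real m + 2)\<^sup>2 * (real m + 3)\<^sup>2)"
    using 1 by (rule divide_right_mono) simp
  also have "\<dots> = (4 / 5) / (real m + 3)\<^sup>2"
    by (simp add: field_simps)
  \<comment> \<open>The worst case is \<open>m = 0\<close>, where both sides agree; it dictates the
    factor \<open>5\<close> in the weights.\<close>
  also have "\<dots> \<le> (4 * (real m + 1) / (real m + 5)) / (real m + 3)\<^sup>2"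
    by (rule divide_right_mono) (simp_all add: field_simps)
  finally show ?thesis by simp
qed

lemma ennreal_lincomb:
  fixes N :: ennreal
  assumes "0 \<le> a" "0 \<le> b" "0 \<le> a'" "0 \<le> b'"
  shows "ennreal (a * b + a' * b') * N = ennreal a * (ennreal b * N) + ennreal a' * (ennreal b' * N)"
  using assms by (simp add: ennreal_mult distrib_right mult.assoc)

text \<open>For \<open>l\<close> the quotient of the means of \<open>r\<close> and
  \<open>r\<^sup>2\<close>, the cross term becomes that of the conditional mean, which is thus a
  squared distance from a shifted centre up to an affine change.\<close>

lemma sqdist_shift:
  "sqdist n y (\<lambda>i. p i - l * (p i - z i)) 
    = sqdist n y p + 2 * l * (\<Sum>i<n. (y i - p i) * (p i - z i)) + l\<^sup>2 * sqdist n p z"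
  unfolding sqdist_def sum_distrib_left
  by (simp add: sum.distrib[symmetric] power2_eq_square algebra_simps)

context bounded_polyhedron
begin

text \<open>A ratio \<open>r \<le> 1\<close> does not enlarge the ball about \<open>y\<close>, and
  rounding \<open>r\<close> up to a multiple of \<open>1 / M\<close> moves its centre along a
  segment of length at most \<open>2 * R\<close> by at most \<open>2 * R / M\<close>.\<close>

lemma euclid_ball_cone_cover:
  assumes y: "y \<in> P" and p: "p \<in> P" and x: "x \<in> euclid_ball n y \<sigma>" and r: "0 < r" "r \<le> 1"
    and \<sigma>: "0 \<le> \<sigma>" and M: "0 < M" "2 * R / real M \<le> \<delta>"
  shows "\<exists>l\<in>{1..M}. lerp p x r \<in> euclid_ball n (lerp p y (real l / real M)) (\<sigma> + \<delta>)"
proof -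
  define l where "l = nat \<lceil>r * real M\<rceil>"
  have rM: "0 < r * real M" "r * real M \<le> real M" using r M by auto
  then have "1 \<le> l" by (simp add: l_def Suc_le_eq)
  moreover have "l \<le> M" using rM by (simp add: l_def ceiling_le_iff)
  ultimately have l: "l \<in> {1..M}" by simp
  have rl: "real l = of_int \<lceil>r * real M\<rceil>" using rM by (simp add: l_def)
  have "\<bar>r * real M - real l\<bar> \<le> 1" unfolding rl by linarith
  then have "\<bar>r - real l / real M\<bar> \<le> 1 / real M" 
    using M by (simp add: abs_le_iff field_simps)
  define t where "t = r - real l / real M"
  have t: "\<bar>t\<bar> \<le> 1 / real M" unfolding t_def by fact
  have norm: "L2_set x {..<n} \<le> R" if "x \<in> P" for x
    using that bounded by (auto simp: euclid_cball_def euclid_norm_def)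
  have yp: "L2_set (\<lambda>i. y i - p i) {..<n} \<le> 2 * R"
  proof -
    have "L2_set (\<lambda>i. y i + - p i) {..<n} \<le> L2_set y {..<n} + L2_set (\<lambda>i. - p i) {..<n}"
      by (rule L2_set_triangle_ineq)
    also have "L2_set (\<lambda>i. - p i) {..<n} = L2_set p {..<n}" by (simp add: L2_set_def)
    finally show ?thesis using norm[OF y] norm[OF p] by simp
  qed
  have R: "0 \<le> R" using norm[OF p] L2_set_nonneg[of p "{..<n}"] by linarith
  have scale: "L2_set (\<lambda>i. a * f i) {..<n} = \<bar>a\<bar> * L2_set f {..<n}" for a :: real and f :: "nat \<Rightarrow> real"
    using L2_set_right_distrib[of "\<bar>a\<bar>" f "{..<n}"] by (simp add: L2_set_def power_mult_distrib)
  have "L2_set (\<lambda>i. x i - y i) {..<n} \<le> \<sigma>"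
    using x \<sigma> by (simp add: euclid_ball_def sqdist_le_iff)
  have "L2_set (\<lambda>i. lerp p x r i - lerp p y (real l / real M) i) {..<n}
      = L2_set (\<lambda>i. r * (x i - y i) + t * (y i - p i)) {..<n}"
    by (simp add: lerp_def t_def algebra_simps)
  also have "\<dots> \<le> L2_set (\<lambda>i. r * (x i - y i)) {..<n} + L2_set (\<lambda>i. t * (y i - p i)) {..<n}"
    by (rule L2_set_triangle_ineq)
  also have "\<dots> = r * L2_set (\<lambda>i. x i - y i) {..<n} + \<bar>t\<bar> * L2_set (\<lambda>i. y i - p i) {..<n}"
    using r by (simp only: scale abs_of_pos)
  also have "\<dots> \<le> 1 * \<sigma> + 1 / real M * (2 * R)"
    using r t yp R \<open>L2_set (\<lambda>i. x i - y i) {..<n} \<le> \<sigma>\<close> by (intro add_mono mult_mono) auto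
  also have "\<dots> \<le> \<sigma> + \<delta>" using M by simp
  finally have "L2_set (\<lambda>i. lerp p x r i - lerp p y (real l / real M) i) {..<n} \<le> \<sigma> + \<delta>" .
  moreover have "0 \<le> \<delta>" using M R by (meson divide_nonneg_nonneg of_nat_0_le_iff order_trans mult_nonneg_nonneg zero_le_numeral)
  moreover have "lerp p x r \<in> euclid n" using x p by (intro lerp_euclid) (auto simp: euclid_ball_def P_def)
  ultimately have "lerp p x r \<in> euclid_ball n (lerp p y (real l / real M)) (\<sigma> + \<delta>)"
    using \<sigma> by (simp add: euclid_ball_def sqdist_le_iff)
  then show ?thesis using l by blast
qed

text \<open>The hypothesis on balls is what survives of the volume bound after passing to a face: the cone from \<open>p\<close>
  over a ball of radius \<open>\<sigma>\<close> in a face is covered by \<open>K\<close> balls of radius \<open>\<sigma> * (1 + 1 / n)\<close>.\<close>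

lemma face_variance:
  assumes "flat_measure n m E \<mu>" "2 * s + n \<le> 2 * m" "0 < n" "0 < \<rho>" "2 * R * real n / \<rho> + 1 \<le> K" "0 \<le> \<Delta>"
    and "\<And>y. y \<in> P \<Longrightarrow> emeasure \<mu> (P \<inter> E \<inter> euclid_ball n y (\<rho> * (1 + 1 / real n) ^ s)) \<le> ennreal \<Delta>"
  shows "ennreal (\<rho> ^ 4 * kappa n m * real s) * emeasure \<mu> (P \<inter> E)
      \<le> (\<integral>\<^sup>+x. ennreal ((sqdist n x z - c)\<^sup>2) * indicator (P \<inter> E) x \<partial>\<mu>) 
        + ennreal (\<rho> ^ 4 * kappa n m * (real s * (real (card J) * K) ^ s * \<Delta>))"
  using assms
proof (induction s arbitrary: m E \<mu> \<Delta> z c)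
  case 0
  then show ?case by simp
next
  case (Suc s)
  note balls = Suc.prems(7)
  \<comment> \<open>Both sides of \<open>2 * s + n \<le> 2 * m\<close> fall by two per step. The
    inequality keeps dimensions at \<open>n / 2\<close> or above, where the weights stay below the
    variance.\<close>
  obtain m' where m: "m = Suc m'" using Suc.prems(2) by (cases m) auto
  define d where "d = real m' + 1"
  have d: "d > 0" by (simp add: d_def)
  note flat = Suc.prems(1)[unfolded m]
  note carrier = flat_measure_carrier[OF flat]
  note n_pos = Suc.prems(3) and \<rho> = Suc.prems(4) and \<Delta> = Suc.prems(6)
  show ?case
  proof (cases "P \<inter> E = {}")
    case True
    then show ?thesis by simp
  next
    case False
    obtain p where p: "p \<in> P" "p \<in> E" 
      and acute: "\<And>y. y \<in> P \<Longrightarrow> y \<in> E \<Longrightarrow> 0 \<le> (\<Sum>i<n. (y i - p i) * (p i - z i))"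
      using closest_point[OF carrier(3) False carrier(5)] by blast
    have "L2_set p {..<n} \<le> R" using p(1) bounded by (auto simp: euclid_cball_def euclid_norm_def)
    then have R: "0 \<le> R" using L2_set_nonneg[of p "{..<n}"] by linarith
    have K1: "1 \<le> K" 
    proof -
      have "0 \<le> 2 * R * real n / \<rho>" using R \<rho> by simp
      then show ?thesis using Suc.prems(5) by linarith
    qed
    obtain I C F \<nu> where I: "I \<subseteq> J" and disj: "disjoint_family_on C I"
      and Csets: "\<And>i. i \<in> I \<Longrightarrow> C i \<in> sets (euclid_lborel n)" and CPE: "\<And>i. i \<in> I \<Longrightarrow> C i \<subseteq> P \<inter> E"
      and cover: "emeasure \<mu> (P \<inter> E) \<le> (\<Sum>i\<in>I. emeasure \<mu> (C i))"
      and FE: "\<And>i. i \<in> I \<Longrightarrow> F i \<subseteq> E" and \<nu>: "\<And>i. i \<in> I \<Longrightarrow> flat_measure n m' (F i) (\<nu> i)"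
      and formula: "\<And>i f. i \<in> I \<Longrightarrow> f \<in> borel_measurable (euclid_lborel n) \<Longrightarrow>
        (\<integral>\<^sup>+x. f x * indicator (C i) x \<partial>\<mu>)
      = (\<integral>\<^sup>+y. (\<integral>\<^sup>+r. f (lerp p y r) * ennreal (r ^ m') * indicator {0<..1} r \<partial>lborel) * indicator (P \<inter> F i) y \<partial>\<nu> i)"
    proof (rule cone_decomposition[OF flat p], goal_cases)
      case (1 I C F \<nu>)
      show ?case by (rule 1(1)[OF 1(2-9)])
    qed
    have finI: "finite I" using I finJ finite_subset by blast
    define g where "g x = ennreal ((sqdist n x z - c)\<^sup>2)" for x
    have [measurable]: "g \<in> borel_measurable (euclid_lborel n)" unfolding g_def by measurable
    have sets\<mu>: "sets \<mu> = sets (euclid_lborel n)" by (rule sets_flat_measure[OF flat])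
    define X where "X i = (\<integral>\<^sup>+x. g x * indicator (C i) x \<partial>\<mu>)" for i
    define \<Theta> where "\<Theta> = (real (card J) * K) ^ s"
    have \<Theta>: "0 \<le> \<Theta>" using K1 by (simp add: \<Theta>_def)
    \<comment> \<open>The cone over a part of a face has \<open>1 / d\<close> times the mass of that
      part, so a bound for the cone is multiplied by \<open>d\<close> on the face; \<open>K\<close>
      counts the covering balls.\<close>
    define \<Delta>' where "\<Delta>' = d * (K * \<Delta>)"
    have \<Delta>': "0 \<le> \<Delta>'" using d K1 \<Delta> by (simp add: \<Delta>'_def)
    \<comment> \<open>Each passage to a face divides the radius by \<open>1 + 1 / n\<close>; after
      the last one it is \<open>\<rho>\<close>.\<close>
    define \<sigma> where "\<sigma> = \<rho> * (1 + 1 / real n) ^ s"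
    have \<sigma>: "\<rho> \<le> \<sigma>" using \<rho> by (simp add: \<sigma>_def)
    have \<sigma>_step: "\<sigma> + \<sigma> / real n = \<rho> * (1 + 1 / real n) ^ Suc s" by (simp add: \<sigma>_def algebra_simps)
    define e where "e = d / (d + 2)"
    have e: "e > 0" using d by (simp add: e_def)
    have e\<kappa>: "e\<^sup>2 * kappa n m' = kappa n m" unfolding m kappa_Suc by (simp add: e_def d_def add.commute add.left_commute)
    have \<kappa>v: "kappa n m \<le> 4 * d / ((d + 4) * (d + 2)\<^sup>2)"
      using kappa_le_variance[of n m'] Suc.prems(2) unfolding m by (simp add: d_def add.commute add.left_commute)
    note \<kappa>0 = kappa_nonneg[of n]
    have mass: "emeasure \<mu> (C i) = ennreal (1 / d) * emeasure (\<nu> i) (P \<inter> F i)" 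
      and face: "ennreal (\<rho> ^ 4 * kappa n m * (real s + 1)) * emeasure \<mu> (C i) 
         \<le> X i + ennreal (\<rho> ^ 4 * kappa n m * ((1 + real s * \<Theta>) * (K * \<Delta>)))"
      if i: "i \<in> I" for i
    proof -
      note car = flat_measure_carrier[OF \<nu>[OF i]]
      have sets\<nu>[measurable_cong]: "sets (\<nu> i) = sets (euclid_lborel n)" by (rule sets_flat_measure[OF \<nu>[OF i]])
      note [measurable] = car(2)
      have "emeasure \<mu> (C i) = (\<integral>\<^sup>+x. 1 * indicator (C i) x \<partial>\<mu>)"
        using Csets[OF i] by (simp add: sets\<mu>)
      also have "\<dots> = (\<integral>\<^sup>+y. ennreal (1 / d) * indicator (P \<inter> F i) y \<partial>\<nu> i)"
        by (subst formula[OF i]) (auto simp: nn_integral_power_unit d_def)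
      also have "\<dots> = ennreal (1 / d) * emeasure (\<nu> i) (P \<inter> F i)"
        by (subst nn_integral_cmult_indicator) auto
      finally show mass: "emeasure \<mu> (C i) = ennreal (1 / d) * emeasure (\<nu> i) (P \<inter> F i)" .
      have ball\<nu>: "emeasure (\<nu> i) (P \<inter> F i \<inter> euclid_ball n y \<sigma>) \<le> ennreal \<Delta>'" if y: "y \<in> P" for y
      proof -
        \<comment> \<open>Enough balls for a rounding error of at most \<open>\<sigma> / n\<close>,
          yet at most \<open>K\<close>, which exceeds the quotient by at least one.\<close>
        define M where "M = nat \<lfloor>2 * R * real n / \<rho>\<rfloor> + 1"
        have "0 \<le> 2 * R * real n / \<rho>" using R \<rho> by simp
        then have M: "2 * R * real n / \<rho> \<le> real M" "real M \<le> K" "0 < M"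
          using Suc.prems(5) unfolding M_def by linarith+
        have M2: "2 * R / real M \<le> \<sigma> / real n"
        proof -
          have "2 * R * real n \<le> real M * \<rho>" using M(1) \<rho> by (simp add: field_simps)
          also have "\<dots> \<le> real M * \<sigma>" using \<sigma> by (intro mult_left_mono) auto
          finally show ?thesis using M(3) n_pos by (simp add: field_simps)
        qed
        define U where "U = (\<Union>l\<in>{1..M}. P \<inter> E \<inter> euclid_ball n (lerp p y (real l / real M)) (\<sigma> + \<sigma> / real n))"
        have [measurable]: "U \<in> sets (euclid_lborel n)" unfolding U_def using carrier(2) by measurable
        have U: "lerp p x r \<in> U" if "x \<in> P \<inter> F i \<inter> euclid_ball n y \<sigma>" "0 < r" "r \<le> 1" for x r
        proof -
          have "lerp p x r \<in> P \<inter> E" using that FE[OF i] p by (auto intro!: lerp_P carrier(5))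
          then show ?thesis
            using euclid_ball_cone_cover[OF y p(1), of x \<sigma> r M "\<sigma> / real n"] that \<rho> \<sigma> M(3) M2 unfolding U_def by auto
        qed
        have "ennreal (1 / d) * emeasure (\<nu> i) (P \<inter> F i \<inter> euclid_ball n y \<sigma>) 
            = (\<integral>\<^sup>+x. ennreal (1 / d) * indicator (P \<inter> F i \<inter> euclid_ball n y \<sigma>) x \<partial>\<nu> i)"
          by (subst nn_integral_cmult_indicator) auto
        also have "\<dots> \<le> (\<integral>\<^sup>+x. (\<integral>\<^sup>+r. indicator U (lerp p x r) * ennreal (r ^ m') * indicator {0<..1} r \<partial>lborel) * indicator (P \<inter> F i) x \<partial>\<nu> i)"
        proof (rule nn_integral_mono)
          fix x
          show "ennreal (1 / d) * indicator (P \<inter> F i \<inter> euclid_ball n y \<sigma>) x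
            \<le> (\<integral>\<^sup>+r. indicator U (lerp p x r) * ennreal (r ^ m') * indicator {0<..1} r \<partial>lborel) * indicator (P \<inter> F i) x"
          proof (cases "x \<in> P \<inter> F i \<inter> euclid_ball n y \<sigma>")
            case True
            have "(\<integral>\<^sup>+r. indicator U (lerp p x r) * ennreal (r ^ m') * indicator {0<..1} r \<partial>lborel)
              = (\<integral>\<^sup>+r. ennreal (r ^ m') * indicator {0<..1} r \<partial>lborel)"
              using U[OF True] by (intro nn_integral_cong) (auto simp: indicator_def)
            then show ?thesis using True by (simp add: nn_integral_power_unit d_def)
          qed simp
        qed
        also have "\<dots> = (\<integral>\<^sup>+x. indicator U x * indicator (C i) x \<partial>\<mu>)"
          by (rule formula[OF i, symmetric]) measurable
        also have "\<dots> \<le> (\<integral>\<^sup>+x. indicator U x \<partial>\<mu>)"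
          by (rule nn_integral_mono) (auto simp: indicator_def)
        also have "\<dots> = emeasure \<mu> U" by (simp add: sets\<mu>)
        also have "\<dots> \<le> (\<Sum>l\<in>{1..M}. emeasure \<mu> (P \<inter> E \<inter> euclid_ball n (lerp p y (real l / real M)) (\<sigma> + \<sigma> / real n)))"
          unfolding U_def using carrier(2) by (intro emeasure_subadditive_finite) (auto simp: sets\<mu>)
        also have "\<dots> \<le> (\<Sum>l\<in>{1..M}. ennreal \<Delta>)"
          unfolding \<sigma>_step by (intro sum_mono balls lerp_P p y) auto
        also have "\<dots> = ennreal (real M * \<Delta>)" using \<Delta> by (simp add: ennreal_mult ennreal_of_nat_eq_real_of_nat)
        also have "\<dots> \<le> ennreal (K * \<Delta>)" using M \<Delta> by (intro ennreal_leI mult_right_mono) auto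
        finally have "ennreal d * (ennreal (1 / d) * emeasure (\<nu> i) (P \<inter> F i \<inter> euclid_ball n y \<sigma>)) \<le> ennreal d * ennreal (K * \<Delta>)"
          by (rule mult_left_mono) simp
        then show ?thesis using d K1 \<Delta> by (simp add: \<Delta>'_def ennreal_mult flip: mult.assoc) (simp flip: ennreal_mult)
      qed
      \<comment> \<open>The mean over \<open>r\<close> of \<open>sqdist n (lerp p y r) z - c\<close>
        is \<open>e * (sqdist n y z' - c')\<close>. Neither \<open>z'\<close> nor \<open>c'\<close>
        depends on \<open>y\<close>, and the induction hypothesis admits any centre and any
        constant.\<close>
      define l where "l = (d + 2) / (d + 1)"
      define z' where "z' = (\<lambda>k. p k - l * (p k - z k))"
      define c' where "c' = l\<^sup>2 * sqdist n p z - (sqdist n p z - c) * (d + 2) / d"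
      define T1 where "T1 = (\<integral>\<^sup>+y. ennreal ((sqdist n y p)\<^sup>2) * indicator (P \<inter> F i) y \<partial>\<nu> i)"
      define T2 where "T2 = (\<integral>\<^sup>+y. ennreal ((sqdist n y z' - c')\<^sup>2) * indicator (P \<inter> F i) y \<partial>\<nu> i)"
      \<comment> \<open>Variance plus squared mean of the radial integrand, with the variance
        bounded below by the weight; the choice of \<open>p\<close> makes the discarded cross term
        nonnegative.\<close>
      have inner: "ennreal (kappa n m / d * (sqdist n y p)\<^sup>2) + ennreal (e\<^sup>2 / d * (sqdist n y z' - c')\<^sup>2)
        \<le> (\<integral>\<^sup>+r. g (lerp p y r) * ennreal (r ^ m') * indicator {0<..1} r \<partial>lborel)"
        if y: "y \<in> P \<inter> F i" for y
      proof -
        define A where "A = sqdist n y p"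
        define B where "B = (\<Sum>i<n. (y i - p i) * (p i - z i))"
        define D where "D = sqdist n p z - c"
        have A: "0 \<le> A" by (simp add: A_def)
        have B: "0 \<le> B" using acute[of y] y FE[OF i] by (auto simp: B_def)
        have "g (lerp p y r) = ennreal ((r\<^sup>2 * A + 2 * r * B + D)\<^sup>2)" for r
          unfolding g_def sqdist_lerp A_def B_def D_def by (simp add: algebra_simps)
        moreover have "d + 4 = real m' + 5" "d + 3 = real m' + 4" "d + 2 = real m' + 3" "d + 1 = real m' + 2"
          by (simp_all add: d_def)
        ultimately have eq: "(\<integral>\<^sup>+r. g (lerp p y r) * ennreal (r ^ m') * indicator {0<..1} r \<partial>lborel)
          = ennreal (A\<^sup>2 / (d + 4) + 4 * A * B / (d + 3) + (4 * B\<^sup>2 + 2 * A * D) / (d + 2)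
              + 4 * B * D / (d + 1) + D\<^sup>2 / d)"
          by (simp only: nn_integral_radial) (simp add: d_def)
        have "sqdist n y z' - c' = A + 2 * ((d + 2) / (d + 1)) * B + D * (d + 2) / d"
          unfolding z'_def c'_def sqdist_shift A_def B_def D_def l_def by simp
        then have "kappa n m / d * (sqdist n y p)\<^sup>2 + e\<^sup>2 / d * (sqdist n y z' - c')\<^sup>2
          \<le> (4 * d / ((d + 4) * (d + 2)\<^sup>2) * A\<^sup>2
            + (d / (d + 2))\<^sup>2 * (A + 2 * ((d + 2) / (d + 1)) * B + D * (d + 2) / d)\<^sup>2) / d"
          using mult_right_mono[OF \<kappa>v, of "A\<^sup>2 / d"] d
          by (simp add: A_def e_def add_divide_distrib)
        also note radial_variance[OF d A B, of D]
        finally show ?thesis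
          unfolding eq using d \<kappa>0 by (subst ennreal_plus[symmetric]; intro ennreal_leI divide_nonneg_nonneg mult_nonneg_nonneg) auto
      qed
      have X_ge: "ennreal (kappa n m / d) * T1 + ennreal (e\<^sup>2 / d) * T2 \<le> X i"
      proof -
        have "ennreal (kappa n m / d) * T1 + ennreal (e\<^sup>2 / d) * T2
          = (\<integral>\<^sup>+y. ennreal (kappa n m / d) * (ennreal ((sqdist n y p)\<^sup>2) * indicator (P \<inter> F i) y) 
              + ennreal (e\<^sup>2 / d) * (ennreal ((sqdist n y z' - c')\<^sup>2) * indicator (P \<inter> F i) y) \<partial>\<nu> i)"
          unfolding T1_def T2_def by (simp add: nn_integral_add nn_integral_cmult)
        also have "\<dots> \<le> (\<integral>\<^sup>+y. (\<integral>\<^sup>+r. g (lerp p y r) * ennreal (r ^ m') * indicator {0<..1} r \<partial>lborel) * indicator (P \<inter> F i) y \<partial>\<nu> i)"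
        proof (rule nn_integral_mono)
          fix y
          show "ennreal (kappa n m / d) * (ennreal ((sqdist n y p)\<^sup>2) * indicator (P \<inter> F i) y) 
              + ennreal (e\<^sup>2 / d) * (ennreal ((sqdist n y z' - c')\<^sup>2) * indicator (P \<inter> F i) y)
            \<le> (\<integral>\<^sup>+r. g (lerp p y r) * ennreal (r ^ m') * indicator {0<..1} r \<partial>lborel) * indicator (P \<inter> F i) y"
          proof (cases "y \<in> P \<inter> F i")
            case True
            have "0 \<le> kappa n m / d" "0 \<le> e\<^sup>2 / d" using d \<kappa>0 by auto
            then show ?thesis using inner[OF True] True by (simp only: ennreal_mult' indicator_simps mult_1_right)
          qed simp
        qed
        also have "\<dots> = X i" unfolding X_def by (rule formula[OF i, symmetric]) measurable
        finally show ?thesis .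
      qed
      define N where "N = emeasure (\<nu> i) (P \<inter> F i)"
      \<comment> \<open>Off the ball of radius \<open>\<sigma>\<close> about \<open>p\<close> the
        integrand is at least \<open>\<rho> ^ 4\<close>; the part of the face inside has mass at
        most \<open>\<Delta>'\<close>.\<close>
      have T1_ge: "ennreal (\<rho> ^ 4) * N \<le> T1 + ennreal (\<rho> ^ 4 * \<Delta>')"
      proof -
        have "ennreal (\<rho> ^ 4) * N = (\<integral>\<^sup>+y. ennreal (\<rho> ^ 4) * indicator (P \<inter> F i) y \<partial>\<nu> i)"
          unfolding N_def by (subst nn_integral_cmult_indicator) auto
        also have "\<dots> \<le> (\<integral>\<^sup>+y. ennreal ((sqdist n y p)\<^sup>2) * indicator (P \<inter> F i) y 
            + ennreal (\<rho> ^ 4) * indicator (P \<inter> F i \<inter> euclid_ball n p \<sigma>) y \<partial>\<nu> i)"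
        proof (rule nn_integral_mono)
          fix y
          show "ennreal (\<rho> ^ 4) * indicator (P \<inter> F i) y \<le> ennreal ((sqdist n y p)\<^sup>2) * indicator (P \<inter> F i) y 
            + ennreal (\<rho> ^ 4) * indicator (P \<inter> F i \<inter> euclid_ball n p \<sigma>) y"
          proof (cases "y \<in> P \<inter> F i \<and> y \<notin> euclid_ball n p \<sigma>")
            case True
            then have "\<sigma>\<^sup>2 \<le> sqdist n y p" using P_euclid by (auto simp: euclid_ball_def)
            then have "\<rho>\<^sup>2 \<le> sqdist n y p" using power_mono[OF \<sigma>, of 2] \<rho> by linarith
            then have "(\<rho>\<^sup>2)\<^sup>2 \<le> (sqdist n y p)\<^sup>2" by (rule power_mono) simp
            then have "\<rho> ^ 4 \<le> (sqdist n y p)\<^sup>2" by simp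
            then show ?thesis using True by (auto simp: indicator_def intro: ennreal_leI)
          qed (auto simp: indicator_def)
        qed
        also have "\<dots> = T1 + ennreal (\<rho> ^ 4) * emeasure (\<nu> i) (P \<inter> F i \<inter> euclid_ball n p \<sigma>)"
          unfolding T1_def by (subst nn_integral_add) (auto simp: nn_integral_cmult_indicator)
        also have "\<dots> \<le> T1 + ennreal (\<rho> ^ 4) * ennreal \<Delta>'"
          by (intro add_left_mono mult_left_mono ball\<nu> p) auto
        also have "\<dots> = T1 + ennreal (\<rho> ^ 4 * \<Delta>')" using \<rho> \<Delta>' by (simp add: ennreal_mult)
        finally show ?thesis .
      qed
      have T2_ge: "ennreal (\<rho> ^ 4 * kappa n m' * real s) * N \<le> T2 + ennreal (\<rho> ^ 4 * kappa n m' * (real s * \<Theta> * \<Delta>'))"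
        unfolding T2_def N_def \<Theta>_def
        by (rule Suc.IH[OF \<nu>[OF i] _ n_pos \<rho> Suc.prems(5) \<Delta>']) 
           (use ball\<nu> Suc.prems(2) in \<open>auto simp: \<sigma>_def m\<close>)
      have "ennreal (\<rho> ^ 4 * kappa n m * (real s + 1)) * emeasure \<mu> (C i)
         = ennreal (\<rho> ^ 4 * kappa n m * (real s + 1) * (1 / d)) * N"
      proof -
        have "ennreal (\<rho> ^ 4 * kappa n m * (real s + 1) * (1 / d)) = ennreal (\<rho> ^ 4 * kappa n m * (real s + 1)) * ennreal (1 / d)"
          by (rule ennreal_mult) (use d \<rho> \<kappa>0 in auto)
        then show ?thesis unfolding mass N_def by (simp only: mult.assoc)
      qed
      \<comment> \<open>The recursion of the weights gives the new gain and the \<open>s\<close>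
        contracted gains of the facet the common weight \<open>kappa n m\<close>.\<close>
      also have "\<rho> ^ 4 * kappa n m * (real s + 1) * (1 / d) = kappa n m / d * \<rho> ^ 4 + e\<^sup>2 / d * (\<rho> ^ 4 * kappa n m' * real s)"
        using e\<kappa>[symmetric] by (simp add: algebra_simps)
      also have "ennreal (kappa n m / d * \<rho> ^ 4 + e\<^sup>2 / d * (\<rho> ^ 4 * kappa n m' * real s)) * N
         = ennreal (kappa n m / d) * (ennreal (\<rho> ^ 4) * N) + ennreal (e\<^sup>2 / d) * (ennreal (\<rho> ^ 4 * kappa n m' * real s) * N)"
        by (rule ennreal_lincomb) (use d \<rho> \<kappa>0 in auto)
      also have "\<dots> \<le> ennreal (kappa n m / d) * (T1 + ennreal (\<rho> ^ 4 * \<Delta>')) 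
           + ennreal (e\<^sup>2 / d) * (T2 + ennreal (\<rho> ^ 4 * kappa n m' * (real s * \<Theta> * \<Delta>')))"
        by (intro add_mono mult_left_mono T1_ge T2_ge) auto
      also have "\<dots> = (ennreal (kappa n m / d) * T1 + ennreal (e\<^sup>2 / d) * T2) 
           + (ennreal (kappa n m / d) * ennreal (\<rho> ^ 4 * \<Delta>') + ennreal (e\<^sup>2 / d) * ennreal (\<rho> ^ 4 * kappa n m' * (real s * \<Theta> * \<Delta>')))"
        by (simp add: distrib_left add_ac)
      also have "ennreal (kappa n m / d) * ennreal (\<rho> ^ 4 * \<Delta>') + ennreal (e\<^sup>2 / d) * ennreal (\<rho> ^ 4 * kappa n m' * (real s * \<Theta> * \<Delta>'))
          = ennreal (kappa n m / d * (\<rho> ^ 4 * \<Delta>') + e\<^sup>2 / d * (\<rho> ^ 4 * kappa n m' * (real s * \<Theta> * \<Delta>')))"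
        using d \<rho> \<kappa>0 \<Delta>' \<Theta> by (subst ennreal_plus) (auto simp flip: ennreal_mult)
      also have "kappa n m / d * (\<rho> ^ 4 * \<Delta>') + e\<^sup>2 / d * (\<rho> ^ 4 * kappa n m' * (real s * \<Theta> * \<Delta>'))
          = \<rho> ^ 4 * kappa n m * ((1 + real s * \<Theta>) * (K * \<Delta>))"
        using e\<kappa>[symmetric] d by (simp add: \<Delta>'_def field_simps)
      also note add_right_mono[OF X_ge]
      finally show "ennreal (\<rho> ^ 4 * kappa n m * (real s + 1)) * emeasure \<mu> (C i) 
         \<le> X i + ennreal (\<rho> ^ 4 * kappa n m * ((1 + real s * \<Theta>) * (K * \<Delta>)))" .
    qed
    have "ennreal (\<rho> ^ 4 * kappa n m * real (Suc s)) * emeasure \<mu> (P \<inter> E)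
       \<le> ennreal (\<rho> ^ 4 * kappa n m * (real s + 1)) * (\<Sum>i\<in>I. emeasure \<mu> (C i))"
      using cover by (intro mult_mono) (auto simp: add.commute)
    also have "\<dots> = (\<Sum>i\<in>I. ennreal (\<rho> ^ 4 * kappa n m * (real s + 1)) * emeasure \<mu> (C i))"
      by (rule sum_distrib_left)
    also have "\<dots> \<le> (\<Sum>i\<in>I. X i + ennreal (\<rho> ^ 4 * kappa n m * ((1 + real s * \<Theta>) * (K * \<Delta>))))"
      by (intro sum_mono face)
    also have "\<dots> = (\<Sum>i\<in>I. X i) + ennreal (real (card I) * (\<rho> ^ 4 * kappa n m * ((1 + real s * \<Theta>) * (K * \<Delta>))))"
      using \<rho> \<kappa>0 \<Theta> K1 \<Delta> by (simp add: sum.distrib ennreal_mult ennreal_of_nat_eq_real_of_nat)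
    also have "\<dots> \<le> (\<integral>\<^sup>+x. g x * indicator (P \<inter> E) x \<partial>\<mu>) 
        + ennreal (\<rho> ^ 4 * kappa n m * (real (Suc s) * (real (card J) * K) ^ Suc s * \<Delta>))"
    proof (rule add_mono)
      \<comment> \<open>As the cones are disjoint, their integrals add up to at most the one over
        \<open>P \<inter> E\<close>.\<close>
      have "(\<Sum>i\<in>I. X i) = (\<integral>\<^sup>+x. (\<Sum>i\<in>I. g x * indicator (C i) x) \<partial>\<mu>)"
        unfolding X_def using Csets 
        by (intro nn_integral_sum[symmetric] borel_measurable_times_ennreal) (auto simp: sets\<mu> measurable_cong_sets[OF sets\<mu> refl])
      also have "\<dots> \<le> (\<integral>\<^sup>+x. g x * indicator (P \<inter> E) x \<partial>\<mu>)"
      proof (rule nn_integral_mono)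
        fix x
        have "(\<Sum>i\<in>I. g x * indicator (C i) x) = g x * indicator (\<Union>i\<in>I. C i) x"
          unfolding indicator_UN_disjoint[OF finI disj] by (simp add: sum_distrib_left)
        also have "\<dots> \<le> g x * indicator (P \<inter> E) x"
          using CPE by (intro mult_left_mono) (auto simp: indicator_def)
        finally show "(\<Sum>i\<in>I. g x * indicator (C i) x) \<le> g x * indicator (P \<inter> E) x" .
      qed
      finally show "(\<Sum>i\<in>I. X i) \<le> (\<integral>\<^sup>+x. g x * indicator (P \<inter> E) x \<partial>\<mu>)" .
      define N where "N = real (card J)"
      have cI: "real (card I) \<le> N" using card_mono[OF finJ I] by (simp add: N_def)
      \<comment> \<open>The summand \<open>1\<close> is absorbed by \<open>\<Theta>\<close>, which
        is at least \<open>1\<close> unless there are no constraints, and then both sides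
        vanish.\<close>
      have "N * (1 + real s * \<Theta>) \<le> (real s + 1) * \<Theta> * N"
      proof (cases "card J = 0")
        case False
        then have "1 \<le> N * K" using K1 by (intro mult_ge1_I) (auto simp: N_def)
        then have "1 \<le> \<Theta>" unfolding \<Theta>_def N_def[symmetric] by (rule one_le_power)
        then have "N * (1 + real s * \<Theta>) \<le> N * (\<Theta> + real s * \<Theta>)" by (intro mult_left_mono) (auto simp: N_def)
        then show ?thesis by (simp add: algebra_simps)
      qed (simp add: N_def)
      then have "N * (1 + real s * \<Theta>) * (K * \<Delta>) \<le> (real s + 1) * \<Theta> * N * (K * \<Delta>)"
        using K1 \<Delta> by (intro mult_right_mono) auto
      moreover have "real (card I) * ((1 + real s * \<Theta>) * (K * \<Delta>)) \<le> N * ((1 + real s * \<Theta>) * (K * \<Delta>))"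
        using cI \<Theta> K1 \<Delta> by (intro mult_right_mono) auto
      ultimately have "real (card I) * ((1 + real s * \<Theta>) * (K * \<Delta>)) \<le> real (Suc s) * (N * K) ^ Suc s * \<Delta>"
        unfolding \<Theta>_def N_def[symmetric] by (simp add: algebra_simps)
      then have "\<rho> ^ 4 * kappa n m * (real (card I) * ((1 + real s * \<Theta>) * (K * \<Delta>))) 
          \<le> \<rho> ^ 4 * kappa n m * (real (Suc s) * (N * K) ^ Suc s * \<Delta>)"
        using \<kappa>0 by (intro mult_left_mono) auto
      then show "ennreal (real (card I) * (\<rho> ^ 4 * kappa n m * ((1 + real s * \<Theta>) * (K * \<Delta>))))
          \<le> ennreal (\<rho> ^ 4 * kappa n m * (real (Suc s) * (real (card J) * K) ^ Suc s * \<Delta>))"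
        unfolding N_def[symmetric] by (intro ennreal_leI) (simp only: mult_ac)
    qed
    finally show ?thesis unfolding g_def .
  qed
qed

end

section \<open>Facets of polytopes\<close>

definition polyhedron_of :: "nat \<Rightarrow> ((nat \<Rightarrow> real) \<Rightarrow> real) set \<Rightarrow> (nat \<Rightarrow> real) set" where
  "polyhedron_of n H = {x \<in> euclid n. \<forall>h\<in>H. h x \<le> 0}"

lemma lerp_scaleR: "lerp p y r = (1 - r) *\<^sub>R p + r *\<^sub>R y"
  by (auto simp: lerp_def scaleR_fun_def fun_eq_iff algebra_simps)

text \<open>A positive \<open>\<beta>\<close> bounds \<open>t\<close> from above, a negative one
  from below. A common \<open>t\<close> exists iff every lower bound is at most every upper bound,
  and after clearing denominators these comparisons are affine in \<open>x\<close>.\<close>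

lemma fourier_motzkin:
  assumes fin: "finite T" and aff: "\<And>g \<beta>. (g, \<beta>) \<in> T \<Longrightarrow> affine_fun I g"
  shows "\<exists>H. finite H \<and> (\<forall>h\<in>H. affine_fun I h) \<and>
     (\<forall>x. (\<forall>h\<in>H. h x \<le> 0) \<longleftrightarrow> (\<exists>t::real. \<forall>(g, \<beta>)\<in>T. g x + \<beta> * t \<le> 0))"
proof -
  define Z where "Z = {(g, \<beta>) \<in> T. \<beta> = 0}"
  define Up where "Up = {(g, \<beta>) \<in> T. \<beta> > 0}"
  define Lo where "Lo = {(g, \<beta>) \<in> T. \<beta> < 0}"
  have finUL: "finite Up" "finite Lo" "finite Z"
    using fin by (auto simp: Up_def Lo_def Z_def intro: rev_finite_subset)
  define H where "H = fst ` Z \<union> (\<lambda>((g, \<beta>), (g', \<beta>')). (\<lambda>x. \<beta> * g' x - \<beta>' * g x)) ` (Up \<times> Lo)"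
  have "finite H" using finUL by (simp add: H_def)
  moreover have "\<forall>h\<in>H. affine_fun I h"
    using aff by (auto simp: H_def Up_def Lo_def Z_def intro!: affine_fun_diff affine_fun_cmult)
  moreover have "(\<forall>h\<in>H. h x \<le> 0) \<longleftrightarrow> (\<exists>t. \<forall>(g, \<beta>)\<in>T. g x + \<beta> * t \<le> 0)" for x
  proof
    assume "\<exists>t. \<forall>(g, \<beta>)\<in>T. g x + \<beta> * t \<le> 0"
    then obtain t where t: "\<And>g \<beta>. (g, \<beta>) \<in> T \<Longrightarrow> g x + \<beta> * t \<le> 0" by blast
    have "\<beta> * g' x - \<beta>' * g x \<le> 0" if "(g, \<beta>) \<in> Up" "(g', \<beta>') \<in> Lo" for g \<beta> g' \<beta>'
    proof -
      have "\<beta> * (g' x + \<beta>' * t) \<le> 0"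
        using t[of g' \<beta>'] that by (intro mult_nonneg_nonpos) (auto simp: Up_def Lo_def)
      moreover have "0 \<le> \<beta>' * (g x + \<beta> * t)"
        using t[of g \<beta>] that by (intro mult_nonpos_nonpos) (auto simp: Up_def Lo_def)
      ultimately show ?thesis by (simp add: algebra_simps)
    qed
    moreover have "g x \<le> 0" if "(g, \<beta>) \<in> Z" for g \<beta>
      using t[of g \<beta>] that by (auto simp: Z_def)
    ultimately have "\<forall>h\<in>fst ` Z. h x \<le> 0"
      "\<forall>h\<in>(\<lambda>((g, \<beta>), (g', \<beta>')). (\<lambda>x. \<beta> * g' x - \<beta>' * g x)) ` (Up \<times> Lo). h x \<le> 0"
      by auto
    then show "\<forall>h\<in>H. h x \<le> 0" by (simp only: H_def ball_Un)
  next
    assume H: "\<forall>h\<in>H. h x \<le> 0"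
    have Z: "g x \<le> 0" if "(g, \<beta>) \<in> Z" for g \<beta>
    proof -
      have "g \<in> H" unfolding H_def using image_eqI[of g fst "(g, \<beta>)" Z] that by simp
      then show ?thesis using H by blast
    qed
    have UL: "\<beta> * g' x - \<beta>' * g x \<le> 0" if "(g, \<beta>) \<in> Up" "(g', \<beta>') \<in> Lo" for g \<beta> g' \<beta>'
    proof -
      have "(\<lambda>((g, \<beta>), (g', \<beta>')). (\<lambda>x. \<beta> * g' x - \<beta>' * g x)) ((g, \<beta>), (g', \<beta>')) \<in> H"
        unfolding H_def using that by (intro UnI2 imageI) auto
      then show ?thesis using H by auto
    qed
    define up where "up = (\<lambda>(g, \<beta>). - g x / \<beta>) ` Up"
    define lo where "lo = (\<lambda>(g, \<beta>). - g x / \<beta>) ` Lo"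
    have le: "b \<le> a" if ab: "a \<in> up" "b \<in> lo" for a b
    proof -
      obtain g \<beta> g' \<beta>' where gb: "(g, \<beta>) \<in> Up" "(g', \<beta>') \<in> Lo" "a = - g x / \<beta>" "b = - g' x / \<beta>'"
        using ab by (auto simp: up_def lo_def)
      have "\<beta> > 0" "\<beta>' < 0" using gb by (auto simp: Up_def Lo_def)
      then show ?thesis using UL[OF gb(1,2)] unfolding gb(3,4) by (simp add: field_simps)
    qed
    have fin': "finite up" "finite lo" using finUL by (auto simp: up_def lo_def)
    \<comment> \<open>The largest lower bound serves, or the smallest upper bound if there are no
      lower ones.\<close>
    obtain t where t: "\<And>a. a \<in> up \<Longrightarrow> t \<le> a" "\<And>b. b \<in> lo \<Longrightarrow> b \<le> t"
    proof (cases "lo = {}")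
      case True
      show ?thesis
      proof (cases "up = {}")
        case True
        then show ?thesis using that[of 0] \<open>lo = {}\<close> by simp
      next
        case False
        then show ?thesis using that[of "Min up"] \<open>lo = {}\<close> fin' by simp
      qed
    next
      case False
      then show ?thesis using that[of "Max lo"] le fin' by simp
    qed
    have "g x + \<beta> * t \<le> 0" if T: "(g, \<beta>) \<in> T" for g \<beta>
    proof -
      consider "\<beta> = 0" | "\<beta> > 0" | "\<beta> < 0" by linarith
      then show ?thesis
      proof cases
        case 1
        then show ?thesis using Z[of g \<beta>] T by (simp add: Z_def)
      next
        case 2
        then have "- g x / \<beta> \<in> up" using T by (force simp: up_def Up_def)
        then show ?thesis using t(1)[of "- g x / \<beta>"] 2 by (simp add: field_simps)
      next
        case 3
        then have "- g x / \<beta> \<in> lo" using T by (force simp: lo_def Lo_def)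
        then show ?thesis using t(2)[of "- g x / \<beta>"] 3 by (simp add: field_simps)
      qed
    qed
    then show "\<exists>t. \<forall>(g, \<beta>)\<in>T. g x + \<beta> * t \<le> 0" by blast
  qed
  ultimately show ?thesis by blast
qed

lemma convex_hull_coord_bound:
  fixes V :: "(nat \<Rightarrow> real) set"
  assumes "finite V"
  obtains B where "\<And>x. x \<in> convex hull V \<Longrightarrow> \<bar>x i\<bar> \<le> B"
proof -
  define B where "B = (\<Sum>v\<in>V. \<bar>v i\<bar>)"
  have "convex {x :: nat \<Rightarrow> real. \<bar>x i\<bar> \<le> B}"
  proof (rule convexI)
    fix x y :: "nat \<Rightarrow> real" and u v :: real
    assume *: "x \<in> {x. \<bar>x i\<bar> \<le> B}" "y \<in> {x. \<bar>x i\<bar> \<le> B}" "0 \<le> u" "0 \<le> v" "u + v = 1"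
    have "\<bar>u * x i + v * y i\<bar> \<le> u * \<bar>x i\<bar> + v * \<bar>y i\<bar>"
      using * by (metis abs_mult abs_of_nonneg abs_triangle_ineq)
    also have "\<dots> \<le> u * B + v * B" using * by (intro add_mono mult_left_mono) auto
    also have "\<dots> = B" using *(5) by (simp flip: distrib_right)
    finally show "u *\<^sub>R x + v *\<^sub>R y \<in> {x. \<bar>x i\<bar> \<le> B}" by (simp add: scaleR_fun_def)
  qed
  moreover have "V \<subseteq> {x. \<bar>x i\<bar> \<le> B}"
    using assms by (auto simp: B_def intro!: member_le_sum)
  ultimately have "convex hull V \<subseteq> {x. \<bar>x i\<bar> \<le> B}" by (rule hull_minimal[rotated])
  then show thesis using that by blast
qed

text \<open>Writing a point of the new hull as \<open>t\<close> times \<open>v\<close> plus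
  \<open>1 - t\<close> times a point of the old one turns membership into inequalities affine in the
  point and \<open>t\<close>, from which \<open>t\<close> is eliminated.\<close>

lemma convex_hull_polyhedron:
  assumes "finite V" "V \<noteq> {}" "V \<subseteq> euclid n"
  shows "\<exists>H. finite H \<and> (\<forall>h\<in>H. affine_fun {..<n} h) \<and> convex hull V = polyhedron_of n H"
  using assms
proof (induction V rule: finite_ne_induct)
  case (singleton v)
  define H where "H = (\<lambda>i x. x i - v i) ` {..<n} \<union> (\<lambda>i x. v i - x i) ` {..<n}"
  have "finite H" by (simp add: H_def)
  moreover have "\<forall>h\<in>H. affine_fun {..<n} h"
    by (auto simp: H_def intro!: affine_fun_diff affine_fun_coord)
  moreover have "polyhedron_of n H = {v}"
  proof -
    have "x = v" if x: "x \<in> euclid n" "\<And>i. i < n \<Longrightarrow> x i \<le> v i" "\<And>i. i < n \<Longrightarrow> v i \<le> x i" for x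
    proof (rule ccontr)
      assume "x \<noteq> v"
      then obtain i where "i < n" "x i \<noteq> v i" using coord_neq[OF x(1), of v] singleton by blast
      then show False using x(2)[of i] x(3)[of i] by simp
    qed
    moreover have "polyhedron_of n H = {x \<in> euclid n. \<forall>i<n. x i \<le> v i \<and> v i \<le> x i}"
      unfolding polyhedron_of_def H_def ball_Un by auto
    ultimately show ?thesis using singleton by auto
  qed
  ultimately show ?case by (intro exI[of _ H]) simp
next
  case (insert v V)
  then obtain H where H: "finite H" "\<forall>h\<in>H. affine_fun {..<n} h" "convex hull V = polyhedron_of n H"
    by auto
  have v: "v \<in> euclid n" using insert by auto
  \<comment> \<open>\<open>h x \<le> t * h v\<close> is the constraint \<open>h\<close> on the point
    of the old hull, multiplied by \<open>1 - t\<close>; the last two pairs encode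
    \<open>0 \<le> t \<le> 1\<close>.\<close>
  define T where "T = (\<lambda>h. (h, - h v)) ` H \<union> {(\<lambda>_. 0, -1), (\<lambda>_. -1, 1)}"
  have "\<exists>H'. finite H' \<and> (\<forall>h\<in>H'. affine_fun {..<n} h) \<and>
     (\<forall>x. (\<forall>h\<in>H'. h x \<le> 0) \<longleftrightarrow> (\<exists>t::real. \<forall>(g, \<beta>)\<in>T. g x + \<beta> * t \<le> 0))"
    by (rule fourier_motzkin) (use H in \<open>auto simp: T_def\<close>)
  then obtain H' where H': "finite H'" "\<forall>h\<in>H'. affine_fun {..<n} h"
    "\<And>x. (\<forall>h\<in>H'. h x \<le> 0) \<longleftrightarrow> (\<exists>t::real. \<forall>(g, \<beta>)\<in>T. g x + \<beta> * t \<le> 0)" by blast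
  have H'T: "(\<forall>h\<in>H'. h x \<le> 0) \<longleftrightarrow> (\<exists>t\<ge>0. t \<le> 1 \<and> (\<forall>h\<in>H. h x \<le> t * h v))" for x
    unfolding H'(3) T_def by (auto simp: mult.commute)
  have lerp_h: "h (lerp x y r) = h x + r * (h y - h x)" if "h \<in> H" for h x y r
    using H(2) that by (intro affine_fun_lerp) auto
  have "convex hull (insert v V) = polyhedron_of n H'"
  proof (intro equalityI subsetI)
    fix x assume "x \<in> convex hull (insert v V)"
    then obtain u y where u: "0 \<le> u" "u \<le> 1" and y: "y \<in> convex hull V" and x: "x = lerp v y u"
      using insert(2) unfolding convex_hull_insert_alt lerp_scaleR by auto
    have "h x \<le> (1 - u) * h v" if h: "h \<in> H" for h
    proof -
      have "u * h y \<le> 0" using y h u H(3) by (auto simp: polyhedron_of_def mult_le_0_iff)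
      then show ?thesis unfolding x lerp_h[OF h] by (simp add: algebra_simps)
    qed
    then have "\<forall>h\<in>H'. h x \<le> 0" unfolding H'T using u by (intro exI[of _ "1 - u"]) auto
    moreover have "x \<in> euclid n" unfolding x using v y H(3) by (auto simp: polyhedron_of_def intro: lerp_euclid)
    ultimately show "x \<in> polyhedron_of n H'" by (simp add: polyhedron_of_def)
  next
    fix x assume x: "x \<in> polyhedron_of n H'"
    then have xe: "x \<in> euclid n" by (simp add: polyhedron_of_def)
    obtain t where t: "0 \<le> t" "t \<le> 1" and h: "\<And>h. h \<in> H \<Longrightarrow> h x \<le> t * h v"
      using x H'T[of x] by (auto simp: polyhedron_of_def)
    show "x \<in> convex hull (insert v V)"
    proof (cases "t = 1")
      \<comment> \<open>At \<open>t = 1\<close> the point of the old hull cannot be recovered by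
        division. The inequalities then make \<open>x - v\<close> a direction of recession of the
        old hull, and boundedness leaves only \<open>x = v\<close>.\<close>
      case True
      have "x = v"
      proof (rule ccontr)
        assume "x \<noteq> v"
        then obtain i where i: "i < n" "x i \<noteq> v i" using coord_neq[OF xe v] by blast
        obtain y where y: "y \<in> convex hull V" using insert(2) by (metis hull_inc ex_in_conv)
        obtain B where B: "\<And>x. x \<in> convex hull V \<Longrightarrow> \<bar>x i\<bar> \<le> B"
          using convex_hull_coord_bound[OF insert(1)] by blast
        define s where "s = (2 * B + 1) / \<bar>x i - v i\<bar>"
        have "0 \<le> B" using B[OF y] by linarith
        then have s: "0 \<le> s" by (simp add: s_def)
        define w where "w = (\<lambda>j. y j + s * (x j - v j))"
        have "w \<in> euclid n" using y xe v H(3) by (auto simp: w_def polyhedron_of_def euclid_def PiE_def extensional_def)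
        moreover have "h w \<le> 0" if hH: "h \<in> H" for h
        proof -
          obtain a b where ab: "\<And>x. h x = b + (\<Sum>i<n. a i * x i)" using affine_funE[OF bspec[OF H(2) hH]] by blast
          have "h w = h y + s * (h x - h v)"
            unfolding ab w_def by (simp add: sum.distrib sum_subtractf sum_distrib_left algebra_simps)
          moreover have "h y \<le> 0" using y hH H(3) by (auto simp: polyhedron_of_def)
          moreover have "s * (h x - h v) \<le> 0" using h[OF hH] True s by (simp add: mult_le_0_iff)
          ultimately show ?thesis by linarith
        qed
        ultimately have "w \<in> convex hull V" using H(3) by (simp add: polyhedron_of_def)
        then have "\<bar>w i\<bar> \<le> B" by (rule B)
        moreover have "\<bar>s * (x i - v i)\<bar> = 2 * B + 1" using i \<open>0 \<le> B\<close> by (simp add: s_def abs_mult)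
        ultimately show False using B[OF y] unfolding w_def by linarith
      qed
      then show ?thesis by (simp add: hull_inc)
    next
      case False
      then have t1: "t < 1" using t by simp
      define y where "y = lerp v x (1 / (1 - t))"
      have "h y \<le> 0" if hH: "h \<in> H" for h
      proof -
        have "h y = (h x - t * h v) / (1 - t)"
          unfolding y_def lerp_h[OF hH] using t1 by (simp add: field_simps)
        then show ?thesis using h[OF hH] t1 by (simp add: divide_le_0_iff)
      qed
      then have "y \<in> convex hull V" unfolding H(3) using lerp_euclid[OF v xe] by (simp add: polyhedron_of_def y_def)
      moreover have "x = lerp v y (1 - t)"
        unfolding y_def using t1 by (auto simp: lerp_def)
      ultimately show ?thesis
        unfolding convex_hull_insert_alt using insert(2) t by (auto simp: lerp_scaleR intro!: exI[of _ y] exI[of _ "1 - t"])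
    qed
  qed
  then show ?case using H' by blast
qed

text \<open>Gaussian elimination: an equation with a nonzero coefficient at \<open>l\<close> removes
  that unknown from the others. It serves to find a direction in which too few constraints cannot
  vary.\<close>

lemma homogeneous_system:
  fixes a :: "'h \<Rightarrow> nat \<Rightarrow> real"
  assumes "finite H" "finite I" "card H < card I"
  shows "\<exists>d. (\<exists>i\<in>I. d i \<noteq> 0) \<and> (\<forall>i. i \<notin> I \<longrightarrow> d i = 0) \<and> (\<forall>h\<in>H. (\<Sum>i\<in>I. a h i * d i) = 0)"
  using assms
proof (induction H arbitrary: I a rule: finite_induct)
  case empty
  then obtain i where "i \<in> I" by fastforce
  then show ?case by (intro exI[of _ "\<lambda>j. if j = i then 1 else 0"]) auto
next
  case (insert h H)
  show ?case
  proof (cases "\<exists>l\<in>I. a h l \<noteq> 0")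
    case False
    have "card H < card I" using insert by simp
    then obtain d where "\<exists>i\<in>I. d i \<noteq> 0" "\<forall>i. i \<notin> I \<longrightarrow> d i = 0" "\<forall>g\<in>H. (\<Sum>i\<in>I. a g i * d i) = 0"
      using insert.IH[of I a] insert.prems by blast
    moreover have "(\<Sum>i\<in>I. a h i * d i) = 0" using False by (intro sum.neutral) auto
    ultimately show ?thesis by blast
  next
    case True
    then obtain l where l: "l \<in> I" "a h l \<noteq> 0" by blast
    define I' where "I' = I - {l}"
    have I': "finite I'" "l \<notin> I'" "I = insert l I'" using insert.prems l by (auto simp: I'_def)
    have "card H < card I'" using insert.prems insert.hyps I' by simp
    then obtain d where d: "\<exists>i\<in>I'. d i \<noteq> 0" "\<forall>i. i \<notin> I' \<longrightarrow> d i = 0"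
      "\<forall>g\<in>H. (\<Sum>i\<in>I'. (a g i - a g l * a h i / a h l) * d i) = 0"
      using insert.IH[of I' "\<lambda>g i. a g i - a g l * a h i / a h l"] I' by blast
    define S where "S = (\<Sum>i\<in>I'. a h i * d i)"
    define e where "e = d(l := - S / a h l)"
    have sum: "(\<Sum>i\<in>I. a g i * e i) = (\<Sum>i\<in>I'. a g i * d i) - a g l * S / a h l" for g
    proof -
      have "(\<Sum>i\<in>I'. a g i * e i) = (\<Sum>i\<in>I'. a g i * d i)"
        using I'(2) by (intro sum.cong) (auto simp: e_def)
      then show ?thesis unfolding I'(3) using I' by (simp add: e_def)
    qed
    have "(\<Sum>i\<in>I. a h i * e i) = 0" unfolding sum using l by (simp add: S_def)
    moreover have "(\<Sum>i\<in>I. a g i * e i) = 0" if "g \<in> H" for g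
    proof -
      have "(\<Sum>i\<in>I'. (a g i - a g l * a h i / a h l) * d i) = (\<Sum>i\<in>I'. a g i * d i) - a g l * S / a h l"
        by (simp add: S_def left_diff_distrib sum_subtractf sum_distrib_left sum_divide_distrib mult.assoc)
      then show ?thesis using d(3) that unfolding sum by simp
    qed
    moreover have "\<exists>i\<in>I. e i \<noteq> 0" using d(1) I' by (auto simp: e_def)
    moreover have "\<forall>i. i \<notin> I \<longrightarrow> e i = 0" using d(2) I' by (auto simp: e_def)
    ultimately show ?thesis by (intro exI[of _ e]) auto
  qed
qed

section \<open>Dimension and number of faces\<close>

lemma affine_fun_linear_part:
  assumes "affine_fun I h"
  shows "\<exists>L. linear L \<and> (\<forall>x d s. h (\<lambda>i. x i + s * d i) = h x + s * L d)"
proof -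
  obtain a b where ab: "\<And>x. h x = b + (\<Sum>i\<in>I. a i * x i)" using assms by (rule affine_funE) blast
  have "linear (\<lambda>d. \<Sum>i\<in>I. a i * d i)"
    by (rule linearI) (simp_all add: scaleR_fun_def sum.distrib sum_distrib_left algebra_simps)
  moreover have "h (\<lambda>i. x i + s * d i) = h x + s * (\<Sum>i\<in>I. a i * d i)" for x d s
    unfolding ab by (simp add: sum.distrib sum_distrib_left algebra_simps)
  ultimately show ?thesis by blast
qed

lemma feasible_direction:
  assumes "finite G" "\<And>g. g \<in> G \<Longrightarrow> affine_fun I g" "\<And>g. g \<in> G \<Longrightarrow> g z < 0"
  shows "\<exists>\<epsilon>>0::real. \<forall>g\<in>G. g (\<lambda>i. z i + \<epsilon> * d i) < 0"
proof -
  have "eventually (\<lambda>\<epsilon>::real. g (\<lambda>i. z i + \<epsilon> * d i) < 0) (at_right 0)" if g: "g \<in> G" for g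
  proof -
    obtain L where L: "\<forall>x d s. g (\<lambda>i. x i + s * d i) = g x + s * L d"
      using affine_fun_linear_part[OF assms(2)[OF g]] by blast
    have "((\<lambda>\<epsilon>. g z + \<epsilon> * L d) \<longlongrightarrow> g z + 0 * L d) (at_right 0)" by (intro tendsto_intros)
    then show ?thesis unfolding L[rule_format] using assms(3)[OF g] by (intro order_tendstoD(2)) auto
  qed
  then have "eventually (\<lambda>\<epsilon>::real. \<forall>g\<in>G. g (\<lambda>i. z i + \<epsilon> * d i) < 0) (at_right 0)"
    using assms(1) by (simp add: eventually_ball_finite)
  then have "eventually (\<lambda>\<epsilon>::real. 0 < \<epsilon> \<and> (\<forall>g\<in>G. g (\<lambda>i. z i + \<epsilon> * d i) < 0)) (at_right 0)"
    by (intro eventually_conj eventually_at_right_less)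
  from eventually_happens'[OF _ this] show ?thesis by (auto simp: trivial_limit_at_right_real)
qed

text \<open>A basis of the kernel together with \<open>w\<close> is a basis of \<open>U\<close>. The
  finite spanning set \<open>E\<close> keeps bases finite, since the space of functions on
  \<open>nat\<close> is infinite-dimensional.\<close>

lemma dim_kernel_inter:
  fixes U :: "'a::real_vector set" and L :: "'a \<Rightarrow> real"
  assumes U: "subspace U" "U \<subseteq> span E" "finite E" and L: "linear L" and w: "w \<in> U" "L w \<noteq> 0"
  shows "dim {d \<in> U. L d = 0} + 1 = dim U"
proof -
  let ?K = "{d \<in> U. L d = 0}"
  have K: "subspace ?K"
    using U(1) L by (auto simp: subspace_def linear_add linear_cmul linear_0)
  obtain B where B: "B \<subseteq> ?K" "independent B" "?K \<subseteq> span B" "card B = dim ?K"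
    using basis_exists[of ?K] by blast
  have fin: "finite B" using independent_span_bound[OF U(3) B(2)] B(1) U(2) by blast
  have spB: "span B \<subseteq> ?K" using B(1) K by (rule span_minimal)
  have wB: "w \<notin> span B" using spB w by auto
  have ind: "independent (insert w B)" using B(2) wB by (rule independent_insertI[rotated])
  have "span (insert w B) = U"
  proof (intro equalityI subsetI)
    fix d assume d: "d \<in> U"
    have "d - (L d / L w) *\<^sub>R w \<in> ?K"
      using d w U(1) L by (auto simp: subspace_diff subspace_scale linear_diff linear_cmul)
    then have "d - (L d / L w) *\<^sub>R w \<in> span B" using B(3) by blast
    then show "d \<in> span (insert w B)" using span_breakdown_eq by blast
  qed (use B(1) w U(1) span_minimal[of "insert w B" U] in blast)
  then have "span (insert w B) = span U" using U(1) by (simp add: span_eq_iff[THEN iffD2])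
  then have "dim U = card (insert w B)" using ind by (rule dim_eq_card)
  moreover have "w \<notin> B" using wB span_base by blast
  ultimately show ?thesis using B(4) fin by simp
qed

text \<open>The direction space of the affine subspace \<open>euclid n\<close>.\<close>

definition zero_outside :: "nat \<Rightarrow> (nat \<Rightarrow> real) set" where
  "zero_outside n = {d. \<forall>i\<ge>n. d i = 0}"

lemma subspace_zero_outside: "subspace (zero_outside n)"
  by (auto simp: subspace_def zero_outside_def scaleR_fun_def)

lemma zero_outside_span: "zero_outside n \<subseteq> span ((\<lambda>i j. if j = i then 1 else 0) ` {..<n})"
proof
  fix d assume d: "d \<in> zero_outside n"
  have sum_app: "(\<Sum>i\<in>S. f i) j = (\<Sum>i\<in>S. f i j)" if "finite S" for S j and f :: "nat \<Rightarrow> nat \<Rightarrow> real"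
    using that by (induction S rule: finite_induct) auto
  have "d = (\<Sum>i<n. d i *\<^sub>R (\<lambda>j. if j = i then 1 else 0))"
  proof
    fix j
    have "(\<Sum>i<n. d i *\<^sub>R (\<lambda>j. if j = i then 1 else 0)) j = (\<Sum>i<n. if j = i then d i else 0)"
      by (simp add: sum_app scaleR_fun_def if_distrib[of "\<lambda>t. _ * t"] cong: if_cong)
    also have "\<dots> = d j" using d by (auto simp: zero_outside_def)
    finally show "d j = (\<Sum>i<n. d i *\<^sub>R (\<lambda>j. if j = i then 1 else 0)) j" by simp
  qed
  also have "\<dots> \<in> span ((\<lambda>i j. if j = i then 1 else 0) ` {..<n})"
    by (intro span_sum span_scale span_base) auto
  finally show "d \<in> span ((\<lambda>i j. if j = i then 1 else 0) ` {..<n})" .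
qed

lemma diff_zero_outside: "x \<in> euclid n \<Longrightarrow> y \<in> euclid n \<Longrightarrow> x - y \<in> zero_outside n"
  by (auto simp: zero_outside_def euclid_def PiE_def extensional_def)

lemma translate_euclid: "x \<in> euclid n \<Longrightarrow> d \<in> zero_outside n \<Longrightarrow> (\<lambda>i. x i + s * d i) \<in> euclid n"
  by (auto simp: euclid_def zero_outside_def PiE_def extensional_def)

text \<open>\<open>z\<close> acts as a relatively interior point: small steps from it inside
  \<open>S\<close> point in every direction of \<open>W\<close>, so the differences span
  \<open>W\<close>.\<close>

lemma affine_dim_eq_dim:
  assumes W: "subspace W" and sub: "\<And>x y. x \<in> S \<Longrightarrow> y \<in> S \<Longrightarrow> x - y \<in> W"
    and z: "z \<in> S" and dir: "\<And>d. d \<in> W \<Longrightarrow> \<exists>\<epsilon>>0. z + \<epsilon> *\<^sub>R d \<in> S"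
  shows "affine_dim S = dim W"
proof -
  let ?D = "{x - y | x y. x \<in> S \<and> y \<in> S}"
  have "?D \<subseteq> W" using sub by blast
  moreover have "W \<subseteq> span ?D"
  proof
    fix d assume "d \<in> W"
    then obtain \<epsilon> where \<epsilon>: "\<epsilon> > 0" "z + \<epsilon> *\<^sub>R d \<in> S" using dir by blast
    then have "(z + \<epsilon> *\<^sub>R d) - z \<in> span ?D" using z by (intro span_base) blast
    then have "\<epsilon> *\<^sub>R d \<in> span ?D" by simp
    then have "(1 / \<epsilon>) *\<^sub>R (\<epsilon> *\<^sub>R d) \<in> span ?D" by (rule span_scale)
    moreover have "(1 / \<epsilon>) *\<^sub>R (\<epsilon> *\<^sub>R d) = d" using \<epsilon>(1) by simp
    ultimately show "d \<in> span ?D" by (simp only:)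
  qed
  ultimately have "span ?D = W" using W by (meson span_minimal subset_antisym)
  then have "dim ?D = dim W" using dim_span[of ?D] by simp
  then show ?thesis by (simp add: affine_dim_def)
qed

text \<open>A nonempty face is determined by the constraints tight at its most generic point, hence
  by a subset of \<open>H\<close>. Finiteness keeps the number of facets from being the default
  cardinality of an infinite set.\<close>

lemma finite_faces_polyhedron:
  assumes fin: "finite H" and aff: "\<And>h. h \<in> H \<Longrightarrow> affine_fun {..<n} h"
  shows "finite {F. F face_of polyhedron_of n H \<and> F \<noteq> {}}"
proof -
  let ?P = "polyhedron_of n H"
  have "F \<in> (\<lambda>T. {x \<in> ?P. \<forall>h\<in>T. h x = 0}) ` Pow H" if F: "F face_of ?P" "F \<noteq> {}" for F
  proof -
    define tight where "tight x = {h \<in> H. h x = 0}" for x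
    have FP: "F \<subseteq> ?P" and conv: "convex F" using F by (auto simp: face_of_def)
    \<comment> \<open>A point of the face with fewest tight constraints. Its midpoint with any other
      point of the face has only tight constraints of both, so those at \<open>x\<close> are tight
      on the whole face.\<close>
    define x where "x = arg_min (\<lambda>x. card (tight x)) (\<lambda>x. x \<in> F)"
    obtain x0 where "x0 \<in> F" using F(2) by blast
    then have x: "x \<in> F" and min: "\<And>y. y \<in> F \<Longrightarrow> card (tight x) \<le> card (tight y)"
      using arg_min_nat_lemma[of "\<lambda>x. x \<in> F" x0 "\<lambda>x. card (tight x)"] by (auto simp: x_def)
    have xP: "x \<in> euclid n" "\<And>h. h \<in> H \<Longrightarrow> h x \<le> 0" using x FP by (auto simp: polyhedron_of_def)
    have tight_sub: "tight x \<subseteq> tight y" if y: "y \<in> F" for y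
    proof -
      define w where "w = lerp x y (1 / 2)"
      have "w \<in> F" unfolding w_def lerp_scaleR using conv x y by (intro convexD) auto
      have hw: "h w = (h x + h y) / 2" if "h \<in> H" for h
        unfolding w_def affine_fun_lerp[OF aff[OF that]] by (simp add: field_simps)
      have "tight w \<subseteq> tight x \<inter> tight y"
      proof
        fix h assume h: "h \<in> tight w"
        then have "h \<in> H" "h x \<le> 0" "h y \<le> 0" "h w = 0" using xP y FP by (auto simp: tight_def polyhedron_of_def)
        then show "h \<in> tight x \<inter> tight y" using hw[of h] by (auto simp: tight_def)
      qed
      moreover have "finite (tight x)" using fin by (simp add: tight_def)
      ultimately have "tight w = tight x"
        using min[OF \<open>w \<in> F\<close>] by (intro card_seteq) auto
      then show ?thesis using \<open>tight w \<subseteq> tight x \<inter> tight y\<close> by auto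
    qed
    have "F = {y \<in> ?P. \<forall>h\<in>tight x. h y = 0}"
    proof (intro equalityI subsetI)
      fix y assume "y \<in> F"
      then show "y \<in> {y \<in> ?P. \<forall>h\<in>tight x. h y = 0}" using tight_sub[of y] FP by (auto simp: tight_def)
    next
      fix y assume y: "y \<in> {y \<in> ?P. \<forall>h\<in>tight x. h y = 0}"
      show "y \<in> F"
      proof (cases "y = x")
        case False
        \<comment> \<open>The segment from \<open>y\<close> to \<open>x\<close> is prolonged a
          little inside the polyhedron; \<open>x\<close> is then interior to a segment starting at
          \<open>y\<close>, and the face property puts \<open>y\<close> into
          \<open>F\<close>.\<close>
        have "\<exists>\<epsilon>>0::real. \<forall>h\<in>H - tight x. h (\<lambda>i. x i + \<epsilon> * (x i - y i)) < 0"
          by (rule feasible_direction) (use fin aff xP in \<open>auto simp: tight_def less_le\<close>)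
        then obtain \<epsilon> :: real where \<epsilon>: "\<epsilon> > 0" "\<forall>h\<in>H - tight x. h (\<lambda>i. x i + \<epsilon> * (x i - y i)) < 0" by blast
        define w where "w = lerp x y (- \<epsilon>)"
        have w: "w = (\<lambda>i. x i + \<epsilon> * (x i - y i))" by (simp add: w_def lerp_def algebra_simps)
        have "h w \<le> 0" if "h \<in> H" for h
        proof (cases "h \<in> tight x")
          case True
          then show ?thesis unfolding w_def affine_fun_lerp[OF aff[OF that]] using y by (auto simp: tight_def)
        next
          case False
          then show ?thesis using \<epsilon>(2) that w by (simp add: less_imp_le)
        qed
        then have "w \<in> ?P" using xP y lerp_euclid[of x n y] by (auto simp: polyhedron_of_def w_def)
        moreover have "x \<in> open_segment y w"
        proof -
          have "x = (1 - 1 / (1 + \<epsilon>)) *\<^sub>R y + (1 / (1 + \<epsilon>)) *\<^sub>R w"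
            using \<epsilon>(1) unfolding w lerp_scaleR[symmetric] by (auto simp: lerp_def fun_eq_iff field_simps)
          moreover have "y \<noteq> w"
          proof
            assume "y = w"
            then have "(1 + \<epsilon>) * (x i - y i) = 0" for i
              using fun_cong[OF \<open>y = w\<close>, of i] unfolding w by (simp add: algebra_simps)
            then show False using False \<epsilon>(1) by (auto simp: fun_eq_iff)
          qed
          ultimately show ?thesis using \<epsilon>(1) unfolding in_segment by (intro conjI exI[of _ "1 / (1 + \<epsilon>)"]) auto
        qed
        ultimately show "y \<in> F" using face_ofD[OF F(1), of x y w] x y by blast
      qed (use x in simp)
    qed
    moreover have "tight x \<in> Pow H" by (auto simp: tight_def)
    ultimately show ?thesis by blast
  qed
  then have "{F. F face_of ?P \<and> F \<noteq> {}} \<subseteq> (\<lambda>T. {x \<in> ?P. \<forall>h\<in>T. h x = 0}) ` Pow H" by blast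
  then show ?thesis using fin by (meson finite_Pow_iff finite_imageI finite_subset)
qed

lemma tight_face_of:
  assumes "\<And>h. h \<in> H \<Longrightarrow> affine_fun {..<n} h" "h \<in> H"
  shows "{x \<in> polyhedron_of n H. h x = 0} face_of polyhedron_of n H"
  unfolding face_of_def
proof (intro conjI ballI impI)
  have comb: "g ((1 - u) *\<^sub>R x + u *\<^sub>R y) = (1 - u) * g x + u * g y" if "g \<in> H" for g x y u
    using affine_fun_lerp[OF assms(1)[OF that], of x y u] by (simp add: lerp_scaleR algebra_simps)
  show "convex {x \<in> polyhedron_of n H. h x = 0}"
    unfolding convex_alt
  proof (intro ballI allI impI)
    fix x y u assume xy: "x \<in> {x \<in> polyhedron_of n H. h x = 0}" "y \<in> {x \<in> polyhedron_of n H. h x = 0}"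
      and u: "0 \<le> u \<and> u \<le> (1::real)"
    have "g ((1 - u) *\<^sub>R x + u *\<^sub>R y) \<le> 0" if "g \<in> H" for g
    proof -
      have "(1 - u) * g x \<le> 0" "u * g y \<le> 0" 
        using xy u that by (auto simp: polyhedron_of_def intro!: mult_nonneg_nonpos)
      then show ?thesis unfolding comb[OF that] by linarith
    qed
    moreover have "(1 - u) *\<^sub>R x + u *\<^sub>R y \<in> euclid n"
      unfolding lerp_scaleR[symmetric] using xy by (intro lerp_euclid) (auto simp: polyhedron_of_def)
    ultimately show "(1 - u) *\<^sub>R x + u *\<^sub>R y \<in> {x \<in> polyhedron_of n H. h x = 0}"
      using xy comb[OF assms(2)] by (simp add: polyhedron_of_def)
  qed
  fix a b x assume ab: "a \<in> polyhedron_of n H" "b \<in> polyhedron_of n H" 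
    and x: "x \<in> {x \<in> polyhedron_of n H. h x = 0}" "x \<in> open_segment a b"
  obtain u where u: "0 < u" "u < 1" "x = (1 - u) *\<^sub>R a + u *\<^sub>R b" using x(2) by (auto simp: in_segment)
  have "(1 - u) * h a + u * h b = 0" using x(1) comb[OF assms(2)] u(3) by simp
  moreover have "h a \<le> 0" "h b \<le> 0" using ab assms(2) by (auto simp: polyhedron_of_def)
  moreover have "(1 - u) * h a \<le> 0" "u * h b \<le> 0" using u calculation by (auto intro!: mult_nonneg_nonpos)
  ultimately have "(1 - u) * h a = 0" "u * h b = 0" by linarith+
  then show "a \<in> {x \<in> polyhedron_of n H. h x = 0}" "b \<in> {x \<in> polyhedron_of n H. h x = 0}"
    using u ab by auto
qed auto

text \<open>In an irredundant description every constraint is the only one tight at some point of the polytope, so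
  distinct constraints cut out distinct facets.\<close>

lemma polytope_polyhedron_facets:
  assumes Pe: "P \<subseteq> euclid n" and P: "polytope P" and vol: "vol n P > 0"
  shows "\<exists>H. finite H \<and> (\<forall>h\<in>H. affine_fun {..<n} h) \<and> P = polyhedron_of n H \<and> n \<le> card H \<and> card H \<le> card (facets P)"
proof -
  obtain V where V: "finite V" "P = convex hull V" using P by (auto simp: polytope_def)
  have "P \<noteq> {}" using vol by auto
  then have "V \<noteq> {}" using V by auto
  moreover have "V \<subseteq> euclid n" using V Pe by (meson hull_subset order_trans)
  ultimately have ex: "\<exists>H. finite H \<and> (\<forall>h\<in>H. affine_fun {..<n} h) \<and> P = polyhedron_of n H"
    using convex_hull_polyhedron[OF V(1)] V(2) by blast
  \<comment> \<open>Least cardinality makes the system irredundant: dropping a constraint admits a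
    point that violates it and no other.\<close>
  define H where "H = arg_min card (\<lambda>H. finite H \<and> (\<forall>h\<in>H. affine_fun {..<n} h) \<and> P = polyhedron_of n H)"
  have H: "finite H" "\<And>h. h \<in> H \<Longrightarrow> affine_fun {..<n} h" "P = polyhedron_of n H"
    and min: "\<And>H'. finite H' \<Longrightarrow> (\<forall>h\<in>H'. affine_fun {..<n} h) \<Longrightarrow> P = polyhedron_of n H' \<Longrightarrow> card H \<le> card H'"
    using arg_min_nat_lemma[of "\<lambda>H. finite H \<and> (\<forall>h\<in>H. affine_fun {..<n} h) \<and> P = polyhedron_of n H" _ card] ex
    unfolding H_def by blast+
  have irr: "\<exists>x\<in>euclid n. 0 < h x \<and> (\<forall>g\<in>H - {h}. g x \<le> 0)" if h: "h \<in> H" for h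
  proof (rule ccontr)
    assume no: "\<not> ?thesis"
    have "P = polyhedron_of n (H - {h})"
      unfolding H(3) using no h by (force simp: polyhedron_of_def not_less)
    then have "card H \<le> card (H - {h})" using H by (intro min) auto
    then show False using h H(1) by (metis card_Diff1_less not_le)
  qed
  \<comment> \<open>Without an interior point \<open>P\<close> would be covered by the zero sets of
    the constraints. These are null, as irredundancy excludes a constraint vanishing everywhere, so
    the volume would be zero.\<close>
  have "\<exists>z\<in>P. \<forall>h\<in>H. h z < 0"
  proof (rule ccontr)
    assume no: "\<not> ?thesis"
    have null: "emeasure (euclid_lborel n) {x \<in> euclid n. h x = 0} = 0" if h: "h \<in> H" for h
      using irr[OF h] by (auto intro: flat_measure_hyperplane[OF flat_measure_euclid H(2)[OF h]])
    have sets: "{x \<in> euclid n. h x = 0} \<in> sets (euclid_lborel n)" if h: "h \<in> H" for h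
    proof -
      have "h \<in> borel_measurable (euclid_lborel n)"
        unfolding euclid_lborel_def by (rule measurable_affine_fun[OF H(2)[OF h]]) auto
      from measurable_sets[OF this, of "{0}"] show ?thesis by (simp add: vimage_def Int_def conj_commute)
    qed
    have "P \<subseteq> (\<Union>h\<in>H. {x \<in> euclid n. h x = 0})"
      using no unfolding H(3) by (force simp: polyhedron_of_def)
    then have "emeasure (euclid_lborel n) P \<le> emeasure (euclid_lborel n) (\<Union>h\<in>H. {x \<in> euclid n. h x = 0})"
      using sets H(1) by (intro emeasure_mono sets.finite_UN) auto
    also have "\<dots> \<le> (\<Sum>h\<in>H. emeasure (euclid_lborel n) {x \<in> euclid n. h x = 0})"
      using sets H(1) by (intro emeasure_subadditive_finite) auto
    also have "\<dots> = 0" using null by simp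
    finally show False using vol by (simp add: measure_def)
  qed
  then obtain z where z: "z \<in> P" "\<And>h. h \<in> H \<Longrightarrow> h z < 0" by blast
  have ze: "z \<in> euclid n" using z Pe by blast
  have linear_part: "\<exists>L. linear L \<and> (\<forall>x d s. h (\<lambda>i. x i + s * d i) = h x + s * L d)" if "h \<in> H" for h
    by (rule affine_fun_linear_part[OF H(2)[OF that]])
  have dimP: "affine_dim P = dim (zero_outside n)"
  proof (rule affine_dim_eq_dim[OF subspace_zero_outside _ z(1)])
    fix x y assume "x \<in> P" "y \<in> P"
    then show "x - y \<in> zero_outside n" using Pe by (intro diff_zero_outside) auto
  next
    fix d assume d: "d \<in> zero_outside n"
    obtain \<epsilon> :: real where "\<epsilon> > 0" "\<forall>g\<in>H. g (\<lambda>i. z i + \<epsilon> * d i) < 0"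
      using feasible_direction[of H "{..<n}" z, where d = d] H(1,2) z(2) by blast
    moreover have "z + \<epsilon> *\<^sub>R d = (\<lambda>i. z i + \<epsilon> * d i)" by (auto simp: scaleR_fun_def)
    ultimately show "\<exists>\<epsilon>>0. z + \<epsilon> *\<^sub>R d \<in> P"
      using translate_euclid[OF ze d] unfolding H(3) by (auto simp: polyhedron_of_def intro!: exI[of _ \<epsilon>] less_imp_le)
  qed
  define F where "F h = {x \<in> P. h x = 0}" for h :: "(nat \<Rightarrow> real) \<Rightarrow> real"
  have point: "\<exists>y\<in>F h. \<forall>g\<in>H - {h}. g y < 0" if h: "h \<in> H" for h
  proof -
    obtain x where x: "x \<in> euclid n" "0 < h x" "\<And>g. g \<in> H - {h} \<Longrightarrow> g x \<le> 0" using irr[OF h] by blast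
    \<comment> \<open>The segment from the interior point \<open>z\<close> to a point violating only
      \<open>h\<close> meets the zero set of \<open>h\<close> here; the share of \<open>z\<close>
      keeps all other constraints strict.\<close>
    define t where "t = h z / (h z - h x)"
    have t: "0 < t" "t < 1" using z(2)[OF h] x(2) by (auto simp: t_def field_simps)
    define y where "y = lerp z x t"
    have hy: "h y = 0" unfolding y_def affine_fun_lerp[OF H(2)[OF h]] t_def using z(2)[OF h] x(2) by (simp add: field_simps)
    have gy: "g y < 0" if g: "g \<in> H - {h}" for g
    proof -
      have "g y = (1 - t) * g z + t * g x"
        unfolding y_def using affine_fun_lerp[OF H(2), of g z x t] g by (simp add: algebra_simps)
      moreover have "(1 - t) * g z < 0" using t z(2) g by (intro mult_pos_neg) auto
      moreover have "t * g x \<le> 0" using t x(3)[OF g] by (intro mult_nonneg_nonpos) auto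
      ultimately show ?thesis by linarith
    qed
    have "y \<in> P" unfolding H(3) polyhedron_of_def
      using hy gy lerp_euclid[OF ze x(1)] by (force simp: y_def intro: less_imp_le)
    then show ?thesis using hy gy by (auto simp: F_def)
  qed
  have "F ` H \<subseteq> facets P"
  proof
    fix S assume "S \<in> F ` H"
    then obtain h where h: "h \<in> H" "S = F h" by blast
    obtain y where y: "y \<in> F h" "\<forall>g\<in>H - {h}. g y < 0" using point[OF h(1)] by blast
    have ye: "y \<in> euclid n" using y(1) Pe by (auto simp: F_def)
    obtain L where L: "linear L" "\<And>x d s. h (\<lambda>i. x i + s * d i) = h x + s * L d"
      using linear_part[OF h(1)] by blast
    have diff: "L (x - y) = h x - h y" for x y
      using L(2)[of y 1 "x - y"] by simp
    have "affine_dim (F h) = dim {d \<in> zero_outside n. L d = 0}"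
    proof (rule affine_dim_eq_dim[OF _ _ y(1)])
      show "subspace {d \<in> zero_outside n. L d = 0}"
        using subspace_zero_outside[of n] L(1) by (auto simp: subspace_def linear_add linear_cmul linear_0)
    next
      fix u v assume uv: "u \<in> F h" "v \<in> F h"
      then have "u - v \<in> zero_outside n" using Pe by (intro diff_zero_outside) (auto simp: F_def)
      then show "u - v \<in> {d \<in> zero_outside n. L d = 0}" using uv by (simp add: diff F_def)
    next
      fix d assume d: "d \<in> {d \<in> zero_outside n. L d = 0}"
      obtain \<epsilon> :: real where \<epsilon>: "\<epsilon> > 0" "\<forall>g\<in>H - {h}. g (\<lambda>i. y i + \<epsilon> * d i) < 0"
        using feasible_direction[of "H - {h}" "{..<n}" y, where d = d] H(1,2) y(2) by auto
      have w: "y + \<epsilon> *\<^sub>R d = (\<lambda>i. y i + \<epsilon> * d i)" by (auto simp: scaleR_fun_def)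
      have "h (y + \<epsilon> *\<^sub>R d) = 0" unfolding w L(2) using d y(1) by (simp add: F_def)
      moreover have "y + \<epsilon> *\<^sub>R d \<in> P"
      proof -
        have "g (y + \<epsilon> *\<^sub>R d) \<le> 0" if "g \<in> H" for g
          using \<epsilon>(2) calculation that w by (cases "g = h") (auto intro: less_imp_le)
        then show ?thesis unfolding H(3) polyhedron_of_def using translate_euclid[OF ye, of d \<epsilon>] d w by auto
      qed
      ultimately show "\<exists>\<epsilon>>0. y + \<epsilon> *\<^sub>R d \<in> F h" using \<epsilon>(1) by (auto simp: F_def)
    qed
    moreover have "dim {d \<in> zero_outside n. L d = 0} + 1 = dim (zero_outside n)"
    proof (rule dim_kernel_inter[OF subspace_zero_outside zero_outside_span _ L(1)])
      show "y - z \<in> zero_outside n" using ye ze by (rule diff_zero_outside)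
      show "L (y - z) \<noteq> 0" using y(1) z(2)[OF h(1)] by (simp add: diff F_def)
    qed simp
    moreover have "F h face_of P" unfolding F_def H(3) by (rule tight_face_of) (use H(2) h in auto)
    ultimately show "S \<in> facets P" using y(1) h(2) dimP by (auto simp: facets_def)
  qed
  moreover have "finite (facets P)"
    using finite_faces_polyhedron[OF H(1,2)] unfolding H(3)[symmetric] facets_def
    by (rule rev_finite_subset) auto
  moreover have "inj_on F H"
  proof (rule inj_onI, rule ccontr)
    fix g h assume gh: "g \<in> H" "h \<in> H" "F g = F h" "g \<noteq> h"
    obtain y where "y \<in> F h" "\<forall>g\<in>H - {h}. g y < 0" using point[OF gh(2)] by blast
    then have "g y = 0" "g y < 0" using gh by (auto simp: F_def)
    then show False by simp
  qed
  ultimately have "card H \<le> card (facets P)" by (metis card_image card_mono)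
  \<comment> \<open>With fewer than \<open>n\<close> constraints some nonzero direction changes none
    of them, and \<open>P\<close> would contain a line.\<close>
  moreover have "n \<le> card H"
  proof (rule ccontr)
    assume "\<not> n \<le> card H"
    define A where "A h = (SOME a. \<exists>b. \<forall>x. h x = b + (\<Sum>i<n. a i * x i))" for h :: "(nat \<Rightarrow> real) \<Rightarrow> real"
    have A: "\<exists>b. \<forall>x. h x = b + (\<Sum>i<n. A h i * x i)" if "h \<in> H" for h
      using H(2)[OF that] unfolding A_def affine_fun_def by (rule someI_ex)
    obtain d where d: "\<exists>i\<in>{..<n}. d i \<noteq> 0" "\<forall>i. i \<notin> {..<n} \<longrightarrow> d i = 0" "\<forall>h\<in>H. (\<Sum>i<n. A h i * d i) = 0"
      using homogeneous_system[OF H(1), of "{..<n}" A] \<open>\<not> n \<le> card H\<close> by auto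
    have dz: "d \<in> zero_outside n" using d(2) by (simp add: zero_outside_def)
    have inP: "(\<lambda>i. z i + s * d i) \<in> P" for s
    proof -
      have "h (\<lambda>i. z i + s * d i) \<le> 0" if h: "h \<in> H" for h
      proof -
        define a where "a = A h"
        obtain b where b: "\<And>x. h x = b + (\<Sum>i<n. a i * x i)" using A[OF h] unfolding a_def by blast
        have "h (\<lambda>i. z i + s * d i) = h z + s * (\<Sum>i<n. a i * d i)"
          unfolding b by (simp add: sum.distrib sum_distrib_left algebra_simps)
        moreover have "(\<Sum>i<n. a i * d i) = 0" using d(3) h by (simp add: a_def)
        ultimately show ?thesis using z(2)[OF h] by simp
      qed
      then show ?thesis unfolding H(3) polyhedron_of_def using translate_euclid[OF ze dz] by simp
    qed
    obtain i where i: "i < n" "d i \<noteq> 0" using d(1) by auto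
    obtain B where B: "\<And>x. x \<in> P \<Longrightarrow> \<bar>x i\<bar> \<le> B" using convex_hull_coord_bound[OF V(1), of i] V(2) by blast
    have "\<bar>z i + ((B + 1 - z i) / d i) * d i\<bar> \<le> B" by (rule B[OF inP])
    then show False using i(2) by simp
  qed
  ultimately show ?thesis using H by blast
qed

section \<open>Volume of balls and choice of parameters\<close>

text \<open>A Chernoff bound: on the ball, the product over the coordinates of Gaussians with
  variance \<open>r\<^sup>2 / n\<close> and height \<open>exp (1 / 2)\<close> is at least
  \<open>1\<close>. Its integral is the \<open>n\<close>-th power of
  \<open>sqrt (2 * pi * exp 1) * r / sqrt n\<close>, and the constant is below
  \<open>5\<close>.\<close>

lemma euclid_ball_volume:
  assumes n: "0 < n" and r: "0 < r"
  shows "emeasure (euclid_lborel n) (euclid_ball n y r) \<le> ennreal ((5 * r / sqrt (real n)) ^ n)"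
proof -
  define \<sigma> where "\<sigma> = r / sqrt (real n)"
  have \<sigma>: "\<sigma> > 0" "\<sigma>\<^sup>2 = r\<^sup>2 / real n" using n r by (auto simp: \<sigma>_def power_divide)
  define a where "a = exp (1 / 2) * sqrt (2 * pi * \<sigma>\<^sup>2)"
  have a: "a > 0" unfolding a_def using \<sigma>(1) by simp
  define f where "f i t = ennreal a * ennreal (normal_density (y i) \<sigma> t)" for i t
  have f: "f i t = ennreal (exp (1 / 2 - (t - y i)\<^sup>2 / (2 * \<sigma>\<^sup>2)))" for i t
  proof -
    have "a * normal_density (y i) \<sigma> t = exp (1 / 2) * exp (- (t - y i)\<^sup>2 / (2 * \<sigma>\<^sup>2))"
      unfolding a_def normal_density_def using \<sigma>(1) by simp
    also have "\<dots> = exp (1 / 2 - (t - y i)\<^sup>2 / (2 * \<sigma>\<^sup>2))" by (simp flip: exp_add)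
    finally show ?thesis using a by (simp add: f_def flip: ennreal_mult')
  qed
  have int: "integral\<^sup>N lborel (f i) = ennreal a" for i
  proof -
    interpret prob_space "density lborel (\<lambda>t. ennreal (normal_density (y i) \<sigma> t))"
      by (rule prob_space_normal_density[OF \<sigma>(1)])
    have "(\<integral>\<^sup>+t. ennreal (normal_density (y i) \<sigma> t) \<partial>lborel) = 1"
      using emeasure_space_1 by (simp add: emeasure_density)
    then show ?thesis unfolding f_def by (simp add: nn_integral_cmult)
  qed
  have "emeasure (euclid_lborel n) (euclid_ball n y r) = (\<integral>\<^sup>+x. indicator (euclid_ball n y r) x \<partial>euclid_lborel n)"
    by simp
  also have "\<dots> \<le> (\<integral>\<^sup>+x. (\<Prod>i<n. f i (x i)) \<partial>euclid_lborel n)"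
  proof (rule nn_integral_mono)
    fix x
    show "indicator (euclid_ball n y r) x \<le> (\<Prod>i<n. f i (x i))"
    proof (cases "x \<in> euclid_ball n y r")
      case True
      have "(\<Prod>i<n. f i (x i)) = ennreal (exp (\<Sum>i<n. 1 / 2 - (x i - y i)\<^sup>2 / (2 * \<sigma>\<^sup>2)))"
        unfolding f by (simp add: prod_ennreal exp_sum)
      also have "(\<Sum>i<n. 1 / 2 - (x i - y i)\<^sup>2 / (2 * \<sigma>\<^sup>2)) = real n / 2 - sqdist n x y / (2 * \<sigma>\<^sup>2)"
        by (simp add: sqdist_def sum_subtractf sum_divide_distrib)
      finally have eq: "(\<Prod>i<n. f i (x i)) = ennreal (exp (real n / 2 - sqdist n x y / (2 * \<sigma>\<^sup>2)))" .
      have "sqdist n x y \<le> r\<^sup>2" using True by (simp add: euclid_ball_def)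
      then have "sqdist n x y / (2 * \<sigma>\<^sup>2) \<le> r\<^sup>2 / (2 * \<sigma>\<^sup>2)" by (rule divide_right_mono) simp
      also have "\<dots> = real n / 2" unfolding \<sigma>(2) using n r by simp
      finally show ?thesis unfolding eq using True by simp
    qed simp
  qed
  also have "\<dots> = (\<Prod>i<n. integral\<^sup>N lborel (f i))"
    unfolding euclid_lborel_def by (rule lborels.product_nn_integral_prod) (auto simp: f_def)
  also have "\<dots> = ennreal (a ^ n)" unfolding int using a by (simp add: ennreal_power)
  also have "\<dots> \<le> ennreal ((5 * r / sqrt (real n)) ^ n)"
  proof (intro ennreal_leI power_mono)
    have "exp 1 * (2 * pi) \<le> 3 * (2 * 4)" using exp_le pi_less_4 by (intro mult_mono) auto
    also have "\<dots> \<le> (5::real)\<^sup>2" by simp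
    finally have "sqrt (exp 1 * (2 * pi)) \<le> 5" by (rule real_le_lsqrt[rotated -1]) simp_all
    moreover have "exp (1 / 2 :: real) = sqrt (exp 1)"
      by (rule real_sqrt_unique[symmetric]) (simp_all flip: exp_double)
    ultimately have "exp (1 / 2) * sqrt (2 * pi) \<le> 5" by (simp add: real_sqrt_mult)
    then have "(exp (1 / 2) * sqrt (2 * pi)) * \<sigma> \<le> 5 * \<sigma>" using \<sigma> by (intro mult_right_mono) auto
    moreover have "a = (exp (1 / 2) * sqrt (2 * pi)) * \<sigma>" using \<sigma>(1) by (simp add: a_def real_sqrt_mult)
    ultimately show "a \<le> 5 * r / sqrt (real n)" by (simp add: \<sigma>_def)
  qed (use a in simp)
  finally show ?thesis .
qed

text \<open>The radius \<open>\<rho>\<close> has to be of order \<open>sqrt n\<close> times the side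
  of the cube of volume \<open>V\<close>, for the sake of the gain, and yet so small that the balls
  lose at most half of the volume. All quantities are compared through their logarithms, with
  \<open>l\<close> as the unit for powers of \<open>n\<close>.\<close>

lemma numeric_bound:
  fixes n :: nat and k q V N :: real
  assumes n: "12 < n" and k: "1 \<le> k" and q: "0 < q" and V: "0 < V" "V \<le> (5 * (real n powr q) / sqrt (real n)) ^ n"
    and N: "1 \<le> N" "N \<le> real n powr k"
  shows "\<exists>\<rho> K s. 0 < \<rho> \<and> 2 * s \<le> n \<and> 2 * (real n powr q) * real n / \<rho> + 1 \<le> K \<and>
    (N * K) ^ s * (5 * (\<rho> * (1 + 1 / real n) ^ s) / sqrt (real n)) ^ n \<le> V / 2 \<and>
    V powr (4 / real n + 3 * 100 / (real n * ln (real n))) * exp (- 100 * (k + 3 * q)) * (real n / ln (real n))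
      \<le> \<rho> ^ 4 * kappa n n * real s / 2"
proof -
  (* exp w is the side of the cube of volume V, and exp (\<beta> * l) the radius of the bounding ball in units of that side *)
  define l where "l = ln (real n)"
  define w where "w = ln V / real n"
  define \<beta> where "\<beta> = q - w / l"
  \<comment> \<open>Logarithm of the factor by which \<open>\<rho>\<close> stays below
    \<open>sqrt n\<close> times the side. Per dimension, \<open>(N * K) ^ s\<close> costs
    \<open>k + \<beta> + 1.5 + \<tau> / 2\<close> and a ball contributes
    \<open>3 + w - \<tau>\<close>; this choice makes the sum \<open>w - 1/2\<close>.\<close>
  define \<tau> where "\<tau> = 2 * (k + \<beta> + 5)"
  define \<rho> where "\<rho> = exp (l / 2 + w - \<tau>)"
  define K where "K = 2 * (real n powr q) * real n / \<rho> + 1"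
  \<comment> \<open>With this many steps, a loss polynomial in \<open>n\<close> at each of them is
    exponential in \<open>n\<close> altogether.\<close>
  define s where "s = nat \<lfloor>real n / l\<rfloor>"
  have n13: "13 \<le> real n" using n by simp
  have el: "exp l = real n" using n13 by (simp add: l_def)
  have exp2: "5 \<le> exp (2::real)" using exp_lower_Taylor_quadratic[of 2] by simp
  have "exp (2::real) = exp 1 * exp 1" by (simp flip: exp_add)
  also have "\<dots> \<le> 3 * 3" using exp_le by (intro mult_mono) auto
  finally have l2: "2 \<le> l" unfolding l_def using n13 by (subst ln_ge_iff) auto
  \<comment> \<open>The ratio \<open>13 / 20 = 0.65\<close>, less the \<open>1/2\<close> coming from
    \<open>sqrt n\<close>, is the \<open>0.15\<close> in the bound for
    \<open>\<beta>\<close>.\<close>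
  have ln5: "20 * ln 5 \<le> 13 * l"
  proof -
    have "20 * ln 5 = ln ((5::real) ^ 20)" by (subst ln_realpow) simp_all
    also have "\<dots> \<le> ln (13 ^ 13)" by (subst ln_le_cancel_iff) auto
    also have "\<dots> = 13 * ln 13" by (subst ln_realpow) simp_all
    also have "\<dots> \<le> 13 * l" unfolding l_def using n13 by simp
    finally show ?thesis .
  qed
  have Vw: "V = exp (real n * w)" using V n13 by (simp add: w_def)
  have sqrt_n: "sqrt (real n) = exp (l / 2)"
    by (rule real_sqrt_unique) (simp_all add: el flip: exp_double)
  have Rl: "real n powr q = exp (q * l)" using n13 by (simp add: powr_def l_def)
  have wl: "w = (q - \<beta>) * l" using l2 by (simp add: \<beta>_def)
  \<comment> \<open>The volume of the bounding ball limits \<open>V\<close>, which amounts to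
    \<open>\<beta> \<ge> 1/2 - ln 5 / l\<close>.\<close>
  have \<beta>: "- 0.15 \<le> \<beta>"
  proof -
    have "5 * (real n powr q) / sqrt (real n) = exp (ln 5 + q * l - l / 2)"
      unfolding Rl sqrt_n by (simp add: exp_add exp_diff)
    then have "exp (real n * w) \<le> exp (real n * (ln 5 + q * l - l / 2))"
      using V(2) unfolding Vw by (simp add: exp_of_nat_mult)
    then have "w \<le> ln 5 + q * l - l / 2" using n13 by simp
    then have "0 \<le> (\<beta> + 0.15) * l" using ln5 unfolding wl by (simp add: algebra_simps)
    then show ?thesis using l2 by (simp add: zero_le_mult_iff)
  qed
  have \<tau>: "0 \<le> \<tau>" using \<beta> k by (simp add: \<tau>_def)
  have \<beta>l: "0 \<le> l / 2 + \<beta> * l"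
  proof -
    have "- 0.15 * l \<le> \<beta> * l" using \<beta> l2 by (intro mult_right_mono) auto
    then show ?thesis using l2 by simp
  qed
  have n_l: "1 \<le> real n / l" 
  proof -
    have "l \<le> real n - 1" unfolding l_def using n13 by (intro ln_le_minus_one) auto
    then show ?thesis using l2 by simp
  qed
  have s_le: "real s \<le> real n / l" using n_l by (simp add: s_def)
  have s_ge: "real n / l / 2 \<le> real s"
  proof -
    define x where "x = real n / l"
    have "1 \<le> \<lfloor>x\<rfloor>" "real s = of_int \<lfloor>x\<rfloor>" using n_l by (simp_all add: s_def x_def)
    moreover have "x - 1 < of_int \<lfloor>x\<rfloor>" by linarith
    ultimately have "x / 2 \<le> real s" by linarith
    then show ?thesis by (simp add: x_def)
  qed
  have s_n: "2 * s \<le> n"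
  proof -
    have "real n / l \<le> real n / 2" using l2 by (intro divide_left_mono) auto
    then have "2 * real s \<le> real n" using s_le by linarith
    then have "real (2 * s) \<le> real n" by simp
    then show ?thesis by (simp only: of_nat_le_iff)
  qed
  have K_le: "K \<le> exp (2 + l / 2 + \<beta> * l + \<tau>)"
  proof -
    have "2 * (real n powr q) * real n / \<rho> = 2 * (exp (q * l) * exp l / exp (l / 2 + w - \<tau>))"
      unfolding Rl \<rho>_def el by simp
    also have "\<dots> = 2 * exp (q * l + l - (l / 2 + w - \<tau>))"
      by (simp only: exp_add[symmetric] exp_diff[symmetric])
    also have "q * l + l - (l / 2 + w - \<tau>) = l / 2 + \<beta> * l + \<tau>" unfolding wl by (simp add: algebra_simps)
    finally have "K = 2 * exp (l / 2 + \<beta> * l + \<tau>) + 1" by (simp add: K_def)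
    also have "1 \<le> exp (l / 2 + \<beta> * l + \<tau>)" using \<beta>l \<tau> by simp
    also have "2 * exp (l / 2 + \<beta> * l + \<tau>) + exp (l / 2 + \<beta> * l + \<tau>) = 3 * exp (l / 2 + \<beta> * l + \<tau>)" by simp
    also have "\<dots> \<le> exp 2 * exp (l / 2 + \<beta> * l + \<tau>)" using exp2 by (intro mult_right_mono) auto
    also have "\<dots> = exp (2 + l / 2 + \<beta> * l + \<tau>)" by (simp add: exp_add)
    finally show ?thesis by simp
  qed
  have K0: "0 \<le> K" unfolding K_def \<rho>_def by simp
  define Q where "Q = k * l + (2 + l / 2 + \<beta> * l + \<tau>)"
  have Q0: "0 \<le> Q" using k l2 \<beta>l \<tau> by (simp add: Q_def)
  have sQ: "real s * Q \<le> real n * (k + \<beta> + 1.5 + \<tau> / 2)"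
  proof -
    \<comment> \<open>Because \<open>l \<ge> 2\<close>, the count depends on \<open>\<tau>\<close>
      with coefficient \<open>1/2\<close> only, so the balls, with coefficient \<open>1\<close>, win
      for large \<open>\<tau>\<close>.\<close>
    have "2 + \<tau> \<le> (1 + \<tau> / 2) * l" using mult_left_mono[OF l2, of "1 + \<tau> / 2"] \<tau> by simp
    then have "Q \<le> (k + \<beta> + 1.5 + \<tau> / 2) * l" by (simp add: Q_def algebra_simps)
    then have "real s * Q \<le> (real n / l) * ((k + \<beta> + 1.5 + \<tau> / 2) * l)"
      using s_le Q0 l2 by (intro mult_mono) auto
    then show ?thesis using l2 by simp
  qed
  have NK: "(N * K) ^ s \<le> exp (real n * (k + \<beta> + 1.5 + \<tau> / 2))"
  proof -
    have "N * K \<le> exp (k * l) * exp (2 + l / 2 + \<beta> * l + \<tau>)"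
      using N K0 K_le n13 by (intro mult_mono) (auto simp: powr_def l_def)
    then have "N * K \<le> exp Q" by (simp add: Q_def exp_add)
    then have "(N * K) ^ s \<le> exp Q ^ s" using N K0 by (intro power_mono) auto
    also have "\<dots> = exp (real s * Q)" by (simp add: exp_of_nat_mult)
    finally show ?thesis using sQ by (meson exp_le_cancel_iff order_trans)
  qed
  have ball: "(5 * (\<rho> * (1 + 1 / real n) ^ s) / sqrt (real n)) ^ n \<le> exp (real n * (3 + w - \<tau>))"
  proof -
    \<comment> \<open>The accumulated growth of the radii stays below \<open>e\<close>, as there are
      at most \<open>n\<close> steps.\<close>
    have "(1 + 1 / real n) ^ s \<le> exp (1 / real n) ^ s" 
      using exp_ge_add_one_self[of "1 / real n"] by (intro power_mono) auto
    also have "\<dots> = exp (real s / real n)" by (simp flip: exp_of_nat_mult)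
    also have "\<dots> \<le> exp 1" using s_n n13 by simp
    finally have "5 * (\<rho> * (1 + 1 / real n) ^ s) / sqrt (real n) \<le> exp 2 * (\<rho> * exp 1) / sqrt (real n)"
      using exp2 by (intro divide_right_mono mult_mono) (auto simp: \<rho>_def)
    also have "\<dots> = exp (3 + w - \<tau>)"
      unfolding \<rho>_def sqrt_n by (simp flip: exp_add exp_diff)
    finally have "(5 * (\<rho> * (1 + 1 / real n) ^ s) / sqrt (real n)) ^ n \<le> exp (3 + w - \<tau>) ^ n"
      by (intro power_mono) (auto simp: \<rho>_def)
    then show ?thesis by (simp add: exp_of_nat_mult)
  qed
  have half: "(N * K) ^ s * (5 * (\<rho> * (1 + 1 / real n) ^ s) / sqrt (real n)) ^ n \<le> V / 2"
  proof -
    have "(N * K) ^ s * (5 * (\<rho> * (1 + 1 / real n) ^ s) / sqrt (real n)) ^ n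
      \<le> exp (real n * (k + \<beta> + 1.5 + \<tau> / 2)) * exp (real n * (3 + w - \<tau>))"
      using NK ball by (intro mult_mono) (auto simp: \<rho>_def)
    also have "\<dots> = exp (real n * (k + \<beta> + 1.5 + \<tau> / 2) + real n * (3 + w - \<tau>))" by (simp add: exp_add)
    also have "real n * (k + \<beta> + 1.5 + \<tau> / 2) + real n * (3 + w - \<tau>) = real n * w - real n / 2"
    proof -
      have "(k + \<beta> + 1.5 + \<tau> / 2) + (3 + w - \<tau>) = w - 1 / 2" unfolding \<tau>_def by (simp add: field_simps)
      then have "real n * ((k + \<beta> + 1.5 + \<tau> / 2) + (3 + w - \<tau>)) = real n * (w - 1 / 2)" by simp
      then show ?thesis by (simp only: distrib_left right_diff_distrib mult_1_right times_divide_eq_right)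
    qed
    also have "exp (real n * w - real n / 2) \<le> exp (real n * w - 1)" using n13 by simp
    also have "\<dots> = V / exp 1" unfolding Vw by (simp add: exp_diff)
    also have "\<dots> \<le> V / 2" using V exp_ge_add_one_self[of "1::real"] by (intro divide_left_mono) auto
    finally show ?thesis .
  qed
  have kap: "1 / (80 * (real n)\<^sup>2) \<le> kappa n n"
  proof -
    have "(real n + 1)\<^sup>2 * (real n + 2)\<^sup>2 \<le> (2 * real n)\<^sup>2 * (2 * real n)\<^sup>2"
      using n13 by (intro mult_mono power_mono) auto
    also have "\<dots> = 16 * ((real n)\<^sup>2 * (real n)\<^sup>2)" by (simp add: power2_eq_square)
    finally have "(real n)\<^sup>2 / (5 * (16 * ((real n)\<^sup>2 * (real n)\<^sup>2))) \<le> kappa n n"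
      unfolding kappa_def using n13 by (intro divide_left_mono) auto
    moreover have "(real n)\<^sup>2 / (5 * (16 * ((real n)\<^sup>2 * (real n)\<^sup>2))) = 1 / (80 * (real n)\<^sup>2)"
      using n13 by (simp add: field_simps)
    ultimately show ?thesis by simp
  qed
  \<comment> \<open>The origin of the odd exponent of \<open>V\<close>: its second term yields
    \<open>300 * w / l\<close>, which combines with \<open>300 * q\<close> to
    \<open>300 * \<beta>\<close>, so that only the ratio of the bounding radius to the side
    enters.\<close>
  have "V powr (4 / real n + 3 * 100 / (real n * ln (real n))) * exp (- 100 * (k + 3 * q))
      = exp (4 * w - 100 * k - 300 * \<beta>)"
  proof -
    have "(4 / real n + 3 * 100 / (real n * ln (real n))) * ln V = 4 * w + 300 * (w / l)"
      by (simp add: w_def l_def distrib_right)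
    moreover have "w / l = q - \<beta>" by (simp add: \<beta>_def)
    ultimately show ?thesis using V by (simp add: powr_def algebra_simps flip: exp_add)
  qed
  \<comment> \<open>Amounts to \<open>92 * k + 292 * \<beta> \<ge> 46\<close>, which
    \<open>k \<ge> 1\<close> and \<open>\<beta> \<ge> - 0.15\<close> yield with little to spare; the
    size of the constant \<open>100\<close> is tested here.\<close>
  also have "\<dots> \<le> exp (4 * w - 4 * \<tau> - 6)" using k \<beta> by (simp add: \<tau>_def)
  also have "\<dots> = exp (4 * w - 4 * \<tau>) / exp 6" by (simp add: exp_diff)
  \<comment> \<open>\<open>320 = 80 * 2 * 2\<close>: from the weight \<open>kappa n n\<close>, from
    rounding the number of steps, and from the half of the gain lost to the balls.\<close>
  also have "\<dots> \<le> exp (4 * w - 4 * \<tau>) / 320"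
  proof (rule divide_left_mono)
    have "1.625 \<le> exp (1 / 2 :: real)" using exp_lower_Taylor_quadratic[of "1/2"] by (simp add: power2_eq_square)
    then have "1.625 ^ 12 \<le> exp (1 / 2 :: real) ^ 12" by (rule power_mono) simp
    also have "\<dots> = exp 6" by (simp flip: exp_of_nat_mult)
    finally show "320 \<le> exp (6::real)" by (simp add: power_divide)
  qed auto
  finally have "V powr (4 / real n + 3 * 100 / (real n * ln (real n))) * exp (- 100 * (k + 3 * q)) * (real n / ln (real n))
      \<le> exp (4 * w - 4 * \<tau>) / 320 * (real n / ln (real n))"
    using l2 unfolding l_def by (intro mult_right_mono) auto
  also have "\<dots> = (exp (4 * w - 4 * \<tau>) * (real n)\<^sup>2) * (1 / (80 * (real n)\<^sup>2)) * (real n / l / 2) / 2"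
    using n13 by (simp add: l_def)
  also have "\<dots> \<le> (exp (4 * w - 4 * \<tau>) * (real n)\<^sup>2) * kappa n n * real s / 2"
    using kap s_ge l2 by (intro divide_right_mono mult_mono) (auto simp: kappa_nonneg)
  also have "exp (4 * w - 4 * \<tau>) * (real n)\<^sup>2 = \<rho> ^ 4"
  proof -
    have "\<rho> ^ 4 = exp (4 * (l / 2 + w - \<tau>))" by (simp add: \<rho>_def flip: exp_of_nat_mult)
    also have "4 * (l / 2 + w - \<tau>) = (4 * w - 4 * \<tau>) + (l + l)" by simp
    also have "exp \<dots> = exp (4 * w - 4 * \<tau>) * (real n)\<^sup>2" by (simp only: exp_add el power2_eq_square)
    finally show ?thesis by simp
  qed
  finally show ?thesis
    using half s_n K_def by (intro exI[of _ \<rho>] exI[of _ K] exI[of _ s]) (auto simp: \<rho>_def)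
qed

section \<open>The variance bound for the whole polytope\<close>

theorem theorem8:
  "\<exists>c::real. c > 0 \<and>
     (\<forall>(n::nat) (k::real) (q::real) (P :: (nat \<Rightarrow> real) set).
        n > 12 \<longrightarrow> k > 0 \<longrightarrow> q > 0 \<longrightarrow>
        P \<subseteq> euclid n \<longrightarrow> polytope P \<longrightarrow> vol n P > 0 \<longrightarrow>
        real (card (facets P)) \<le> real n powr k \<longrightarrow>
        P \<subseteq> euclid_cball n (real n powr q) \<longrightarrow>
        prob_space.variance (uniform_measure (euclid_lborel n) P) (\<lambda>x. (euclid_norm n x)\<^sup>2)
          \<ge> vol n P powr (4 / real n + 3 * c / (real n * ln (real n)))
              * exp (- c * (k + 3 * q)) * (real n / ln (real n)))"
proof (intro exI[of _ 100] conjI allI impI)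
  show "(0::real) < 100" by simp
  fix n :: nat and k q :: real and P :: "(nat \<Rightarrow> real) set"
  assume n: "12 < n" and "0 < k" and q: "0 < q" and Pe: "P \<subseteq> euclid n" and poly: "polytope P"
    and vol: "0 < vol n P" and facets: "real (card (facets P)) \<le> real n powr k"
    and ball: "P \<subseteq> euclid_cball n (real n powr q)"
  define R where "R = real n powr q"
  have R: "0 < R" using n by (simp add: R_def)
  obtain H where H: "finite H" "\<forall>h\<in>H. affine_fun {..<n} h" "P = polyhedron_of n H"
    "n \<le> card H" "card H \<le> card (facets P)"
    using polytope_polyhedron_facets[OF Pe poly vol] by blast
  define J where "J = {0..<card H}"
  obtain h where h: "bij_betw h J H" using ex_bij_betw_nat_finite[OF H(1)] unfolding J_def by blast
  have P_def: "P = {x \<in> euclid n. \<forall>j\<in>J. h j x \<le> 0}"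
    unfolding H(3) polyhedron_of_def bij_betw_imp_surj_on[OF h, symmetric] by simp
  have cardJ: "card J = card H" by (simp add: J_def)
  have "bounded_polyhedron n J h R"
  proof
    show "finite J" by (simp add: J_def)
    show "affine_fun {..<n} (h j)" if "j \<in> J" for j using that H(2) bij_betwE[OF h] by blast
    show "{x \<in> euclid n. \<forall>j\<in>J. h j x \<le> 0} \<subseteq> euclid_cball n R" using ball by (simp add: R_def P_def)
  qed
  then interpret bounded_polyhedron n J h R P
    by (simp_all only: P_def)
  define N where "N = real (card J)"
  have N: "1 \<le> N" "N \<le> real n powr k" "real n \<le> N"
    using H(4,5) n facets unfolding N_def cardJ by linarith+
  \<comment> \<open>There are at least \<open>n\<close> facets, so \<open>n powr k\<close> is at
    least \<open>n\<close>.\<close>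
  have k: "1 \<le> k"
  proof (rule ccontr)
    assume "\<not> 1 \<le> k"
    then have "real n powr k < real n powr 1" using n by (intro powr_less_mono) auto
    then show False using N n by simp
  qed
  define V where "V = vol n P"
  have V: "0 < V" using vol by (simp add: V_def)
  have norm_sq: "(euclid_norm n x)\<^sup>2 = sqdist n x (\<lambda>_. 0)" for x
    by (simp add: euclid_norm_def L2_set_def sqdist_def sum_nonneg)
  have P_ball: "P \<subseteq> euclid_ball n (\<lambda>_. 0) R"
  proof
    fix x assume x: "x \<in> P"
    then have "x \<in> euclid n" "euclid_norm n x \<le> R" using bounded by (auto simp: euclid_cball_def)
    moreover have "0 \<le> euclid_norm n x" by (simp add: euclid_norm_def L2_set_nonneg)
    ultimately show "x \<in> euclid_ball n (\<lambda>_. 0) R"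
      unfolding euclid_ball_def norm_sq[symmetric] by (auto intro: power_mono)
  qed
  have emP: "emeasure (euclid_lborel n) P \<le> ennreal ((5 * R / sqrt (real n)) ^ n)"
    by (rule order_trans[OF emeasure_mono[OF P_ball sets_euclid_ball] euclid_ball_volume]) (use n R in auto)
  then have fin: "emeasure (euclid_lborel n) P \<noteq> \<infinity>" by (auto simp: top_unique)
  then have em: "emeasure (euclid_lborel n) P = ennreal V"
    by (simp add: V_def emeasure_eq_ennreal_measure)
  have V_le: "V \<le> (5 * (real n powr q) / sqrt (real n)) ^ n"
    using emP R n unfolding em R_def by (simp add: ennreal_le_iff)
  obtain \<rho> K s where \<rho>: "0 < \<rho>" and s: "2 * s \<le> n" and K: "2 * R * real n / \<rho> + 1 \<le> K"
    and small: "(N * K) ^ s * (5 * (\<rho> * (1 + 1 / real n) ^ s) / sqrt (real n)) ^ n \<le> V / 2"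
    and target: "V powr (4 / real n + 3 * 100 / (real n * ln (real n))) * exp (- 100 * (k + 3 * q)) * (real n / ln (real n))
      \<le> \<rho> ^ 4 * kappa n n * real s / 2"
    using numeric_bound[OF n k q V V_le N(1,2)] unfolding R_def by blast
  \<comment> \<open>The volume bound for a ball of the largest radius; the induction derives the
    bounds on lower-dimensional faces from it.\<close>
  define \<Delta> where "\<Delta> = (5 * (\<rho> * (1 + 1 / real n) ^ s) / sqrt (real n)) ^ n"
  have \<Delta>: "0 \<le> \<Delta>" using \<rho> by (simp add: \<Delta>_def)
  have PE: "P \<inter> euclid n = P" using Pe by blast
  have balls: "emeasure (euclid_lborel n) (P \<inter> euclid n \<inter> euclid_ball n y (\<rho> * (1 + 1 / real n) ^ s)) \<le> ennreal \<Delta>" for y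
  proof -
    have "emeasure (euclid_lborel n) (P \<inter> euclid n \<inter> euclid_ball n y (\<rho> * (1 + 1 / real n) ^ s)) 
        \<le> emeasure (euclid_lborel n) (euclid_ball n y (\<rho> * (1 + 1 / real n) ^ s))"
      by (rule emeasure_mono) auto
    also have "\<dots> \<le> ennreal \<Delta>" unfolding \<Delta>_def using n \<rho> by (intro euclid_ball_volume mult_pos_pos zero_less_power add_pos_nonneg) auto
    finally show ?thesis .
  qed
  define U where "U = uniform_measure (euclid_lborel n) P"
  interpret U: prob_space U
    unfolding U_def using fin V by (intro prob_space_uniform_measure) (auto simp: em)
  define f where "f x = (euclid_norm n x)\<^sup>2" for x
  have f_sq: "f = (\<lambda>x. sqdist n x (\<lambda>_. 0))" by (rule ext) (simp add: f_def norm_sq)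
  have [measurable]: "f \<in> borel_measurable (euclid_lborel n)" unfolding f_sq by measurable
  have [measurable]: "f \<in> borel_measurable U" unfolding U_def by measurable
  define c where "c = U.expectation f"
  \<comment> \<open>Boundedness makes the squared deviation integrable; otherwise its Bochner
    integral would be the default \<open>0\<close>.\<close>
  have bound: "AE x in U. norm ((f x - c)\<^sup>2) \<le> (R\<^sup>2 + \<bar>c\<bar>)\<^sup>2"
    unfolding U_def
  proof (rule AE_uniform_measureI)
    show "AE x in euclid_lborel n. x \<in> P \<longrightarrow> norm ((f x - c)\<^sup>2) \<le> (R\<^sup>2 + \<bar>c\<bar>)\<^sup>2"
    proof (intro AE_I2 impI)
      fix x assume "x \<in> P"
      then have "f x \<le> R\<^sup>2" "0 \<le> f x" using P_ball unfolding f_sq euclid_ball_def by auto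
      then have "\<bar>f x - c\<bar> \<le> R\<^sup>2 + \<bar>c\<bar>" by linarith
      then have "\<bar>f x - c\<bar>\<^sup>2 \<le> (R\<^sup>2 + \<bar>c\<bar>)\<^sup>2" by (rule power_mono) simp
      then show "norm ((f x - c)\<^sup>2) \<le> (R\<^sup>2 + \<bar>c\<bar>)\<^sup>2" by simp
    qed
  qed simp
  have int: "integrable U (\<lambda>x. (f x - c)\<^sup>2)"
    by (rule U.integrable_const_bound[OF bound]) measurable
  define v where "v = U.expectation (\<lambda>x. (f x - c)\<^sup>2)"
  have v: "0 \<le> v" by (simp add: v_def)
  have "ennreal v = (\<integral>\<^sup>+x. ennreal ((f x - c)\<^sup>2) \<partial>U)"
    unfolding v_def by (rule nn_integral_eq_integral[OF int, symmetric]) simp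
  also have "\<dots> = (\<integral>\<^sup>+x. ennreal ((f x - c)\<^sup>2) * indicator P x \<partial>euclid_lborel n) / ennreal V"
    unfolding U_def by (subst nn_integral_uniform_measure) (auto simp: em)
  finally have "ennreal V * ennreal v 
      = (\<integral>\<^sup>+x. ennreal ((f x - c)\<^sup>2) * indicator P x \<partial>euclid_lborel n) * ennreal V / ennreal V"
    by (simp only: ennreal_times_divide mult.commute)
  also have "\<dots> = (\<integral>\<^sup>+x. ennreal ((f x - c)\<^sup>2) * indicator P x \<partial>euclid_lborel n)"
    by (rule ennreal_mult_divide_eq) (use V in auto)
  finally have I: "(\<integral>\<^sup>+x. ennreal ((f x - c)\<^sup>2) * indicator P x \<partial>euclid_lborel n) = ennreal (V * v)"
    using V by (simp add: ennreal_mult')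
  \<comment> \<open>\<open>P\<close> is taken as its own top face, with the origin as centre and the
    expectation as constant.\<close>
  have "ennreal (\<rho> ^ 4 * kappa n n * real s) * ennreal V
      \<le> ennreal (V * v) + ennreal (\<rho> ^ 4 * kappa n n * (real s * (N * K) ^ s * \<Delta>))"
    using face_variance[OF flat_measure_euclid, of s \<rho> K \<Delta> "\<lambda>_. 0" c] s n \<rho> K \<Delta> balls
    unfolding PE em N_def I[symmetric] f_sq by simp
  moreover have N0: "0 \<le> N * K"
  proof -
    have "0 \<le> 2 * R * real n / \<rho>" using R \<rho> by simp
    then show ?thesis using N K by simp
  qed
  ultimately have "ennreal (\<rho> ^ 4 * kappa n n * real s * V) \<le> ennreal (V * v + \<rho> ^ 4 * kappa n n * (real s * (N * K) ^ s * \<Delta>))"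
    using V v \<rho> \<Delta> kappa_nonneg[of n n] by (subst ennreal_plus) (auto simp: ennreal_mult')
  then have "\<rho> ^ 4 * kappa n n * real s * V \<le> V * v + \<rho> ^ 4 * kappa n n * (real s * (N * K) ^ s * \<Delta>)"
    using V v \<rho> \<Delta> N0 kappa_nonneg[of n n] by (subst (asm) ennreal_le_iff) auto
  \<comment> \<open>At most half of the gain is lost to the balls.\<close>
  moreover have "\<rho> ^ 4 * kappa n n * (real s * ((N * K) ^ s * \<Delta>)) \<le> \<rho> ^ 4 * kappa n n * (real s * (V / 2))"
    using small \<rho> kappa_nonneg[of n n] unfolding \<Delta>_def by (intro mult_left_mono) auto
  ultimately have "(\<rho> ^ 4 * kappa n n * real s / 2) * V \<le> v * V"
    by (simp add: algebra_simps)
  then have "\<rho> ^ 4 * kappa n n * real s / 2 \<le> v" using V by simp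
  then show "vol n P powr (4 / real n + 3 * 100 / (real n * ln (real n))) * exp (- 100 * (k + 3 * q)) * (real n / ln (real n))
      \<le> prob_space.variance (uniform_measure (euclid_lborel n) P) (\<lambda>x. (euclid_norm n x)\<^sup>2)"
    using target unfolding v_def c_def f_def U_def V_def by linarith
qed

end
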